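(* Let $k$ be a field, let $H$ be a Hopf algebra over $k$, and let $A$ be an $H$-comodule algebra with coinvariant subalgebra $B=A^H$ such that (i) $B$ is central in $A$, and (ii) there is a $B$-linear $H$-comodule isomorphism $u: B\otimes H\to A$, where $B\otimes H$ carries the coaction $\mathrm{id}_B\otimes\Delta$. Let $\mu_A: T(X_H)\to S(t_H)\otimes A$ be the algebra morphism determined by $\mu_A(X_h)=\sum_{(h)} t_{h_{(1)}}\otimes u(1_B\otimes h_{(2)})$ for all $h\in H$, and let $I_H(A)\subset T(X_H)$ be the set of $H$-identities for $A$. Then: (a) $\operatorname{Ker}(\mu_A)\subset I_H(A)$. (b) If the field $k$ is infinite, then $I_H(A)=\operatorname{Ker}(\mu_A)$.
   Context: All algebras are associative unital $k$-algebras, and unadorned tensor products are over $k$. $\Delta$ and $\varepsilon$ are the comultiplication and counit of $H$, with Sweedler notation $\Delta(h)=\sum_{(h)}h_{(1)}\otimes h_{(2)}$. An $H$-comodule algebra is an algebra $A$ with a right $H$-comodule structure whose coaction $\delta:A\to A\otimes H$ is an algebra morphism; $A^H=\{a\in A\mid \delta(a)=a\otimes 1\}$. An $H$-comodule algebra morphism is an algebra morphism that is also a comodule map. $X_H$ is a copy of the vector space $H$, with identity map $h\mapsto X_h$; the tensor algebra $T(X_H)$ is an $H$-comodule algebra whose coaction is the algebra morphism determined by $\delta(X_h)=\sum_{(h)}X_{h_{(1)}}\otimes h_{(2)}$. $t_H$ is another copy of $H$, with identity map $h\mapsto t_h$, and $S(t_H)$ is its symmetric algebra over $k$. An element $P\in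 T(X_H)$ is an $H$-identity for $A$ if $\mu(P)=0$ for all $H$-comodule algebra morphisms $\mu:T(X_H)\to A$. *)

theory Defs
  imports "HOL-Algebra.QuotRing" "HOL-Algebra.Module"
begin

text \<open>
  All modules and algebras are \<open>('k, 'a) module\<close> records with explicit carriers; functions
  are only meaningful on the carriers. In all definitions below \<open>K\<close> is the base field.
\<close>

section \<open>Algebras over a field\<close>

text \<open>The zero algebra is allowed. The library locale \<open>algebra\<close> is restricted to
  commutative algebras, hence this variant.\<close>

locale k_algebra = K?: field K + module K A + A?: ring A for K (structure) and A (structure) +
  assumes smult_mult_left:
      "\<lbrakk>c \<in> carrier K; x \<in> carrier A; y \<in> carrier A\<rbrakk>
        \<Longrightarrow> (c \<odot>\<^bsub>A\<^esub> x) \<otimes>\<^bsub>A\<^esub> y = c \<odot>\<^bsub>A\<^esub> (x \<otimes>\<^bsub>A\<^esub> y)"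
    and smult_mult_right:
      "\<lbrakk>c \<in> carrier K; x \<in> carrier A; y \<in> carrier A\<rbrakk>
        \<Longrightarrow> x \<otimes>\<^bsub>A\<^esub> (c \<odot>\<^bsub>A\<^esub> y) = c \<odot>\<^bsub>A\<^esub> (x \<otimes>\<^bsub>A\<^esub> y)"

definition lin_hom :: "'k ring \<Rightarrow> ('k, 'a) module \<Rightarrow> ('k, 'b) module \<Rightarrow> ('a \<Rightarrow> 'b) set" where
  "lin_hom K V W = {f \<in> carrier V \<rightarrow> carrier W.
     (\<forall>x\<in>carrier V. \<forall>y\<in>carrier V. f (x \<oplus>\<^bsub>V\<^esub> y) = f x \<oplus>\<^bsub>W\<^esub> f y) \<and>
     (\<forall>c\<in>carrier K. \<forall>x\<in>carrier V. f (c \<odot>\<^bsub>V\<^esub> x) = c \<odot>\<^bsub>W\<^esub> f x)}"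

definition alg_hom :: "'k ring \<Rightarrow> ('k, 'a) module \<Rightarrow> ('k, 'b) module \<Rightarrow> ('a \<Rightarrow> 'b) set" where
  "alg_hom K A A' = ring_hom A A' \<inter> lin_hom K A A'"

section \<open>Monoid algebras and quotients\<close>

definition monoid_algebra ::
    "'k ring \<Rightarrow> ('g, 's) monoid_scheme \<Rightarrow> ('k, 'g \<Rightarrow> 'k) module" where
  "monoid_algebra K G =
    \<lparr>carrier = {f. (\<forall>x. f x \<in> carrier K) \<and> (\<forall>x. x \<notin> carrier G \<longrightarrow> f x = \<zero>\<^bsub>K\<^esub>) \<and>
        finite {x. f x \<noteq> \<zero>\<^bsub>K\<^esub>}},
     mult = (\<lambda>f g z. \<Oplus>\<^bsub>K\<^esub>p \<in> {(x, y). f x \<noteq> \<zero>\<^bsub>K\<^esub> \<and> g y \<noteq> \<zero>\<^bsub>K\<^esub> \<and> x \<otimes>\<^bsub>G\<^esub> y = z}.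
        f (fst p) \<otimes>\<^bsub>K\<^esub> g (snd p)),
     one = (\<lambda>x. if x = \<one>\<^bsub>G\<^esub> then \<one>\<^bsub>K\<^esub> else \<zero>\<^bsub>K\<^esub>),
     zero = (\<lambda>x. \<zero>\<^bsub>K\<^esub>),
     add = (\<lambda>f g x. f x \<oplus>\<^bsub>K\<^esub> g x),
     smult = (\<lambda>c f x. c \<otimes>\<^bsub>K\<^esub> f x)\<rparr>"

definition basis_elem :: "'k ring \<Rightarrow> 'g \<Rightarrow> 'g \<Rightarrow> 'k" where
  "basis_elem K x = (\<lambda>y. if y = x then \<one>\<^bsub>K\<^esub> else \<zero>\<^bsub>K\<^esub>)"

text \<open>The quotient ring \<open>A Quot I\<close> together with its scalar multiplication.\<close>

definition quot_alg :: "('k, 'a) module \<Rightarrow> 'a set \<Rightarrow> ('k, 'a set) module" where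
  "quot_alg A I =
    \<lparr>carrier = carrier (A Quot I), mult = mult (A Quot I), one = one (A Quot I),
     zero = zero (A Quot I), add = add (A Quot I),
     smult = (\<lambda>c X. \<Union>x\<in>X. I +>\<^bsub>A\<^esub> (c \<odot>\<^bsub>A\<^esub> x))\<rparr>"

definition submod_span :: "'k ring \<Rightarrow> ('k, 'a) module \<Rightarrow> 'a set \<Rightarrow> 'a set" where
  "submod_span K V S = \<Inter>{N. submodule N K V \<and> S \<subseteq> N}"

section \<open>Tensor products\<close>

text \<open>
  \<open>V \<otimes> W\<close> is the free module on \<open>V \<times> W\<close> modulo the span of the bilinearity relations. The
  free module is taken as the monoid algebra of the multiplicative monoid \<open>V \<times> W\<close>; the
  span of the relations is then a two-sided ideal, and the quotient carries the usual product
  \<open>(v \<otimes> w) (v' \<otimes> w') = v v' \<otimes> w w'\<close>.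
\<close>

definition free_pairs ::
    "'k ring \<Rightarrow> ('k, 'v) module \<Rightarrow> ('k, 'w) module \<Rightarrow> ('k, 'v \<times> 'w \<Rightarrow> 'k) module" where
  "free_pairs K V W = monoid_algebra K (V \<times>\<times> W)"

definition tensor_rels ::
    "'k ring \<Rightarrow> ('k, 'v) module \<Rightarrow> ('k, 'w) module \<Rightarrow> ('v \<times> 'w \<Rightarrow> 'k) set" where
  "tensor_rels K V W = (let F = free_pairs K V W; e = (\<lambda>v w. basis_elem K (v, w)) in
     {e (v \<oplus>\<^bsub>V\<^esub> v') w \<ominus>\<^bsub>F\<^esub> (e v w \<oplus>\<^bsub>F\<^esub> e v' w) | v v' w.
        v \<in> carrier V \<and> v' \<in> carrier V \<and> w \<in> carrier W} \<union>
     {e v (w \<oplus>\<^bsub>W\<^esub> w') \<ominus>\<^bsub>F\<^esub> (e v w \<oplus>\<^bsub>F\<^esub> e v w') | v w w'.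
        v \<in> carrier V \<and> w \<in> carrier W \<and> w' \<in> carrier W} \<union>
     {e (c \<odot>\<^bsub>V\<^esub> v) w \<ominus>\<^bsub>F\<^esub> (c \<odot>\<^bsub>F\<^esub> e v w) | c v w.
        c \<in> carrier K \<and> v \<in> carrier V \<and> w \<in> carrier W} \<union>
     {e v (c \<odot>\<^bsub>W\<^esub> w) \<ominus>\<^bsub>F\<^esub> (c \<odot>\<^bsub>F\<^esub> e v w) | c v w.
        c \<in> carrier K \<and> v \<in> carrier V \<and> w \<in> carrier W})"

definition tensor_null ::
    "'k ring \<Rightarrow> ('k, 'v) module \<Rightarrow> ('k, 'w) module \<Rightarrow> ('v \<times> 'w \<Rightarrow> 'k) set" where
  "tensor_null K V W = submod_span K (free_pairs K V W) (tensor_rels K V W)"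

definition tensor ::
    "'k ring \<Rightarrow> ('k, 'v) module \<Rightarrow> ('k, 'w) module \<Rightarrow> ('k, ('v \<times> 'w \<Rightarrow> 'k) set) module" where
  "tensor K V W = quot_alg (free_pairs K V W) (tensor_null K V W)"

definition pure_tensor ::
    "'k ring \<Rightarrow> ('k, 'v) module \<Rightarrow> ('k, 'w) module \<Rightarrow> 'v \<Rightarrow> 'w \<Rightarrow> ('v \<times> 'w \<Rightarrow> 'k) set" where
  "pure_tensor K V W v w = tensor_null K V W +>\<^bsub>free_pairs K V W\<^esub> basis_elem K (v, w)"

text \<open>For bilinear \<open>\<phi>\<close>, the linear map \<open>V \<otimes> W \<rightarrow> U\<close> with \<open>v \<otimes> w \<mapsto> \<phi> v w\<close>, evaluated on a
  representative of the coset \<open>X\<close>; it implements Sweedler notation: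
  \<open>tensor_lift K U \<phi> (\<Delta> h)\<close> is \<open>\<Sum> \<phi> h\<^sub>(\<^sub>1\<^sub>) h\<^sub>(\<^sub>2\<^sub>)\<close>.\<close>

definition tensor_lift ::
    "'k ring \<Rightarrow> ('k, 'u) module \<Rightarrow> ('v \<Rightarrow> 'w \<Rightarrow> 'u) \<Rightarrow> ('v \<times> 'w \<Rightarrow> 'k) set \<Rightarrow> 'u" where
  "tensor_lift K U \<phi> X = (let f = (SOME f. f \<in> X) in
     \<Oplus>\<^bsub>U\<^esub>p \<in> {p. f p \<noteq> \<zero>\<^bsub>K\<^esub>}. f p \<odot>\<^bsub>U\<^esub> \<phi> (fst p) (snd p))"

text \<open>\<open>f \<otimes> g : V \<otimes> W \<rightarrow> V' \<otimes> W'\<close>; only the target modules occur as arguments.\<close>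

definition tensor_map ::
    "'k ring \<Rightarrow> ('k, 'v2) module \<Rightarrow> ('k, 'w2) module \<Rightarrow> ('v \<Rightarrow> 'v2) \<Rightarrow> ('w \<Rightarrow> 'w2) \<Rightarrow>
      ('v \<times> 'w \<Rightarrow> 'k) set \<Rightarrow> ('v2 \<times> 'w2 \<Rightarrow> 'k) set" where
  "tensor_map K V' W' f g =
     tensor_lift K (tensor K V' W') (\<lambda>v w. pure_tensor K V' W' (f v) (g w))"

text \<open>The canonical isomorphism \<open>U \<otimes> (V \<otimes> W) \<rightarrow> (U \<otimes> V) \<otimes> W\<close>.\<close>

definition tensor_assoc ::
    "'k ring \<Rightarrow> ('k, 'u) module \<Rightarrow> ('k, 'v) module \<Rightarrow> ('k, 'w) module \<Rightarrow>
      ('u \<times> ('v \<times> 'w \<Rightarrow> 'k) set \<Rightarrow> 'k) set \<Rightarrow> (('u \<times> 'v \<Rightarrow> 'k) set \<times> 'w \<Rightarrow> 'k) set" where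
  "tensor_assoc K U V W =
     tensor_lift K (tensor K (tensor K U V) W) (\<lambda>u.
       tensor_lift K (tensor K (tensor K U V) W) (\<lambda>v w.
         pure_tensor K (tensor K U V) W (pure_tensor K U V u v) w))"

section \<open>Tensor algebra and symmetric algebra\<close>

definition free_monoid :: "'v set \<Rightarrow> 'v list monoid" where
  "free_monoid X = \<lparr>carrier = lists X, mult = (@), one = []\<rparr>"

text \<open>\<open>T(V)\<close> as the free associative algebra on the set \<open>V\<close> modulo the ideal that makes the
  inclusion of the generators linear.\<close>

definition free_words :: "'k ring \<Rightarrow> ('k, 'v) module \<Rightarrow> ('k, 'v list \<Rightarrow> 'k) module" where
  "free_words K V = monoid_algebra K (free_monoid (carrier V))"

definition tensor_alg_null :: "'k ring \<Rightarrow> ('k, 'v) module \<Rightarrow> ('v list \<Rightarrow> 'k) set" where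
  "tensor_alg_null K V = (let F = free_words K V; e = (\<lambda>v. basis_elem K [v]) in
     Idl\<^bsub>F\<^esub> ({e (v \<oplus>\<^bsub>V\<^esub> w) \<ominus>\<^bsub>F\<^esub> (e v \<oplus>\<^bsub>F\<^esub> e w) | v w. v \<in> carrier V \<and> w \<in> carrier V} \<union>
       {e (c \<odot>\<^bsub>V\<^esub> v) \<ominus>\<^bsub>F\<^esub> (c \<odot>\<^bsub>F\<^esub> e v) | c v. c \<in> carrier K \<and> v \<in> carrier V}))"

definition tensor_alg :: "'k ring \<Rightarrow> ('k, 'v) module \<Rightarrow> ('k, ('v list \<Rightarrow> 'k) set) module" where
  "tensor_alg K V = quot_alg (free_words K V) (tensor_alg_null K V)"

definition X_gen :: "'k ring \<Rightarrow> ('k, 'v) module \<Rightarrow> 'v \<Rightarrow> ('v list \<Rightarrow> 'k) set" where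
  "X_gen K V v = tensor_alg_null K V +>\<^bsub>free_words K V\<^esub> basis_elem K [v]"

text \<open>For linear \<open>f : V \<rightarrow> A\<close>, the algebra morphism \<open>T(V) \<rightarrow> A\<close> determined by \<open>X_v \<mapsto> f v\<close>,
  evaluated on a representative of the coset \<open>P\<close>.\<close>

definition tensor_alg_lift ::
    "'k ring \<Rightarrow> ('k, 'a) module \<Rightarrow> ('v \<Rightarrow> 'a) \<Rightarrow> ('v list \<Rightarrow> 'k) set \<Rightarrow> 'a" where
  "tensor_alg_lift K A f P = (let p = (SOME p. p \<in> P) in
     \<Oplus>\<^bsub>A\<^esub>w \<in> {w. p w \<noteq> \<zero>\<^bsub>K\<^esub>}. p w \<odot>\<^bsub>A\<^esub> foldr (\<lambda>v a. f v \<otimes>\<^bsub>A\<^esub> a) w \<one>\<^bsub>A\<^esub>)"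

definition sym_alg_null :: "'k ring \<Rightarrow> ('k, 'v) module \<Rightarrow> ('v list \<Rightarrow> 'k) set set" where
  "sym_alg_null K V = (let T = tensor_alg K V; X = X_gen K V in
     Idl\<^bsub>T\<^esub> {X v \<otimes>\<^bsub>T\<^esub> X w \<ominus>\<^bsub>T\<^esub> X w \<otimes>\<^bsub>T\<^esub> X v | v w. v \<in> carrier V \<and> w \<in> carrier V})"

definition sym_alg :: "'k ring \<Rightarrow> ('k, 'v) module \<Rightarrow> ('k, ('v list \<Rightarrow> 'k) set set) module" where
  "sym_alg K V = quot_alg (tensor_alg K V) (sym_alg_null K V)"

definition t_gen :: "'k ring \<Rightarrow> ('k, 'v) module \<Rightarrow> 'v \<Rightarrow> ('v list \<Rightarrow> 'k) set set" where
  "t_gen K V v = sym_alg_null K V +>\<^bsub>tensor_alg K V\<^esub> X_gen K V v"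

section \<open>Hopf algebras and comodule algebras\<close>

locale hopf_algebra = k_algebra K H for K (structure) and H (structure) +
  fixes \<Delta> :: "'b \<Rightarrow> ('b \<times> 'b \<Rightarrow> 'a) set" and \<epsilon> :: "'b \<Rightarrow> 'a" and S :: "'b \<Rightarrow> 'b"
  assumes comul_hom: "\<Delta> \<in> alg_hom K H (tensor K H H)"
    and counit_hom: "\<epsilon> \<in> ring_hom H K"
    and counit_smult: "\<lbrakk>c \<in> carrier K; h \<in> carrier H\<rbrakk> \<Longrightarrow> \<epsilon> (c \<odot>\<^bsub>H\<^esub> h) = c \<otimes>\<^bsub>K\<^esub> \<epsilon> h"
    and coassoc: "h \<in> carrier H \<Longrightarrow>
      tensor_map K (tensor K H H) H \<Delta> (\<lambda>x. x) (\<Delta> h) =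
      tensor_assoc K H H H (tensor_map K H (tensor K H H) (\<lambda>x. x) \<Delta> (\<Delta> h))"
    and counit_left: "h \<in> carrier H \<Longrightarrow> tensor_lift K H (\<lambda>x y. \<epsilon> x \<odot>\<^bsub>H\<^esub> y) (\<Delta> h) = h"
    and counit_right: "h \<in> carrier H \<Longrightarrow> tensor_lift K H (\<lambda>x y. \<epsilon> y \<odot>\<^bsub>H\<^esub> x) (\<Delta> h) = h"
    and antipode_lin: "S \<in> lin_hom K H H"
    and antipode_left: "h \<in> carrier H \<Longrightarrow>
      tensor_lift K H (\<lambda>x y. S x \<otimes>\<^bsub>H\<^esub> y) (\<Delta> h) = \<epsilon> h \<odot>\<^bsub>H\<^esub> \<one>\<^bsub>H\<^esub>"
    and antipode_right: "h \<in> carrier H \<Longrightarrow>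
      tensor_lift K H (\<lambda>x y. x \<otimes>\<^bsub>H\<^esub> S y) (\<Delta> h) = \<epsilon> h \<odot>\<^bsub>H\<^esub> \<one>\<^bsub>H\<^esub>"

text \<open>Right comodule algebras; \<open>\<Delta>\<close> and \<open>\<epsilon>\<close> are the coalgebra structure of \<open>H\<close>.\<close>

locale comodule_algebra = k_algebra K A
  for K :: "'k ring" and H :: "('k, 'h) module" and \<Delta> :: "'h \<Rightarrow> ('h \<times> 'h \<Rightarrow> 'k) set"
    and \<epsilon> :: "'h \<Rightarrow> 'k" and A :: "('k, 'a) module" and \<delta> :: "'a \<Rightarrow> ('a \<times> 'h \<Rightarrow> 'k) set" +
  assumes coaction_hom: "\<delta> \<in> alg_hom K A (tensor K A H)"
    and coaction_coassoc: "a \<in> carrier A \<Longrightarrow>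
      tensor_map K (tensor K A H) H \<delta> (\<lambda>h. h) (\<delta> a) =
      tensor_assoc K A H H (tensor_map K A (tensor K H H) (\<lambda>x. x) \<Delta> (\<delta> a))"
    and coaction_counit: "a \<in> carrier A \<Longrightarrow> tensor_lift K A (\<lambda>x h. \<epsilon> h \<odot>\<^bsub>A\<^esub> x) (\<delta> a) = a"

definition comodule_map ::
    "'k ring \<Rightarrow> ('k, 'h) module \<Rightarrow> ('k, 'v) module \<Rightarrow> ('v \<Rightarrow> ('v \<times> 'h \<Rightarrow> 'k) set) \<Rightarrow>
      ('k, 'w) module \<Rightarrow> ('w \<Rightarrow> ('w \<times> 'h \<Rightarrow> 'k) set) \<Rightarrow> ('v \<Rightarrow> 'w) \<Rightarrow> bool" where
  "comodule_map K H V \<delta>V W \<delta>W f \<longleftrightarrow> f \<in> lin_hom K V W \<and>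
     (\<forall>v\<in>carrier V. \<delta>W (f v) = tensor_map K W H f (\<lambda>h. h) (\<delta>V v))"

text \<open>\<open>A\<^sup>H\<close>, as an algebra.\<close>

definition coinvariants ::
    "'k ring \<Rightarrow> ('k, 'h) module \<Rightarrow> ('k, 'a) module \<Rightarrow> ('a \<Rightarrow> ('a \<times> 'h \<Rightarrow> 'k) set) \<Rightarrow>
      ('k, 'a) module" where
  "coinvariants K H A \<delta> = A\<lparr>carrier := {a \<in> carrier A. \<delta> a = pure_tensor K A H a \<one>\<^bsub>H\<^esub>}\<rparr>"

text \<open>The coaction \<open>id \<otimes> \<Delta>\<close> on \<open>V \<otimes> H\<close>, with values in \<open>(V \<otimes> H) \<otimes> H\<close>.\<close>

definition cofree_coaction ::
    "'k ring \<Rightarrow> ('k, 'h) module \<Rightarrow> ('h \<Rightarrow> ('h \<times> 'h \<Rightarrow> 'k) set) \<Rightarrow> ('k, 'v) module \<Rightarrow>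
      ('v \<times> 'h \<Rightarrow> 'k) set \<Rightarrow> (('v \<times> 'h \<Rightarrow> 'k) set \<times> 'h \<Rightarrow> 'k) set" where
  "cofree_coaction K H \<Delta> V X =
     tensor_assoc K V H H (tensor_map K V (tensor K H H) (\<lambda>v. v) \<Delta> X)"

text \<open>\<open>b\<close> acts on \<open>B \<otimes> H\<close> by \<open>b (b' \<otimes> h) = b b' \<otimes> h\<close>.\<close>

definition B_linear_comodule_iso ::
    "'k ring \<Rightarrow> ('k, 'h) module \<Rightarrow> ('h \<Rightarrow> ('h \<times> 'h \<Rightarrow> 'k) set) \<Rightarrow>
      ('k, 'a) module \<Rightarrow> ('a \<Rightarrow> ('a \<times> 'h \<Rightarrow> 'k) set) \<Rightarrow> ('k, 'a) module \<Rightarrow>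
      (('a \<times> 'h \<Rightarrow> 'k) set \<Rightarrow> 'a) \<Rightarrow> bool" where
  "B_linear_comodule_iso K H \<Delta> A \<delta> B u \<longleftrightarrow>
     comodule_map K H (tensor K B H) (cofree_coaction K H \<Delta> B) A \<delta> u \<and>
     bij_betw u (carrier (tensor K B H)) (carrier A) \<and>
     (\<forall>b\<in>carrier B. \<forall>x\<in>carrier (tensor K B H).
        u (tensor_map K B H (\<lambda>b'. b \<otimes>\<^bsub>B\<^esub> b') (\<lambda>h. h) x) = b \<otimes>\<^bsub>A\<^esub> u x)"

section \<open>Polynomial identities\<close>

text \<open>\<open>\<delta>(X_h) = \<Sum> X_{h\<^sub>(\<^sub>1\<^sub>)} \<otimes> h\<^sub>(\<^sub>2\<^sub>)\<close>\<close>

definition T_coaction ::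
    "'k ring \<Rightarrow> ('k, 'h) module \<Rightarrow> ('h \<Rightarrow> ('h \<times> 'h \<Rightarrow> 'k) set) \<Rightarrow>
      ('h list \<Rightarrow> 'k) set \<Rightarrow> (('h list \<Rightarrow> 'k) set \<times> 'h \<Rightarrow> 'k) set" where
  "T_coaction K H \<Delta> = tensor_alg_lift K (tensor K (tensor_alg K H) H)
     (\<lambda>h. tensor_map K (tensor_alg K H) H (X_gen K H) (\<lambda>h'. h') (\<Delta> h))"

definition H_identities ::
    "'k ring \<Rightarrow> ('k, 'h) module \<Rightarrow> ('h \<Rightarrow> ('h \<times> 'h \<Rightarrow> 'k) set) \<Rightarrow>
      ('k, 'a) module \<Rightarrow> ('a \<Rightarrow> ('a \<times> 'h \<Rightarrow> 'k) set) \<Rightarrow> ('h list \<Rightarrow> 'k) set set" where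
  "H_identities K H \<Delta> A \<delta> = {P \<in> carrier (tensor_alg K H).
     \<forall>\<mu> \<in> alg_hom K (tensor_alg K H) A.
       comodule_map K H (tensor_alg K H) (T_coaction K H \<Delta>) A \<delta> \<mu> \<longrightarrow> \<mu> P = \<zero>\<^bsub>A\<^esub>}"

text \<open>\<open>\<mu>\<^sub>A(X_h) = \<Sum> t_{h\<^sub>(\<^sub>1\<^sub>)} \<otimes> u(1\<^sub>B \<otimes> h\<^sub>(\<^sub>2\<^sub>))\<close>\<close>

definition mu_A ::
    "'k ring \<Rightarrow> ('k, 'h) module \<Rightarrow> ('h \<Rightarrow> ('h \<times> 'h \<Rightarrow> 'k) set) \<Rightarrow>
      ('k, 'a) module \<Rightarrow> ('k, 'a) module \<Rightarrow> (('a \<times> 'h \<Rightarrow> 'k) set \<Rightarrow> 'a) \<Rightarrow>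
      ('h list \<Rightarrow> 'k) set \<Rightarrow> (('h list \<Rightarrow> 'k) set set \<times> 'a \<Rightarrow> 'k) set" where
  "mu_A K H \<Delta> A B u = tensor_alg_lift K (tensor K (sym_alg K H) A)
     (\<lambda>h. tensor_map K (sym_alg K H) A (t_gen K H)
        (\<lambda>h'. u (pure_tensor K B H \<one>\<^bsub>B\<^esub> h')) (\<Delta> h))"

end

theory Submission
  imports Defs
begin

text \<open>
  A comodule algebra morphism \<open>\<mu> : T(X\<^sub>H) \<rightarrow> A\<close> is the same as a comodule map \<open>f : H \<rightarrow> A\<close>, and
  since \<open>A \<cong> B \<otimes> H\<close> is cofree, such maps are exactly the maps \<open>f h = \<Sum> \<nu>(h\<^sub>(\<^sub>1\<^sub>)) u(1 \<otimes> h\<^sub>(\<^sub>2\<^sub>))\<close> with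
  \<open>\<nu> : H \<rightarrow> B\<close> linear. As \<open>B\<close> is central, \<open>\<nu>\<close> extends to an algebra morphism
  \<open>\<Psi> : S(t\<^sub>H) \<otimes> A \<rightarrow> A\<close>, \<open>t\<^sub>h \<otimes> a \<mapsto> \<nu>(h) a\<close>, and \<open>\<mu> = \<Psi> \<circ> \<mu>\<^sub>A\<close>; hence the kernel of \<open>\<mu>\<^sub>A\<close>
  consists of identities. Conversely, already the maps \<open>\<nu> = \<chi> 1\<close> with \<open>\<chi> : H \<rightarrow> k\<close> a functional
  separate the points of \<open>S(t\<^sub>H) \<otimes> A\<close> when \<open>k\<close> is infinite: a vector-valued polynomial in finitely many
  linearly independent \<open>t\<^sub>v\<close> which vanishes at all points is zero, by induction on the number of
  variables.
\<close>

section \<open>Linear maps and algebra morphisms\<close>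

text \<open>The linear map \<nu> attached to a comodule map f is (id \<otimes> \<epsilon>) after the
  inverse of u after f; that it gives back f is the counit law for the cofree comodule. What shapes
  the converse is that the variables t_v satisfy linear relations, so the values of a functional at
  several v cannot be prescribed freely. Vectors are therefore adjoined one at a time. A vector in
  the span of the earlier ones brings no new variable. For any other v there is a functional that is
  0 on the earlier span and 1 at v; adding multiples of it moves the value at v through all of k
  while the coefficients, which involve earlier variables only, keep their values. What remains is
  that a nonzero polynomial in one scalar variable with coefficients in A has finitely many roots.
  All lifts to quotients are evaluated at a chosen representative, so the vanishing of each map on
  the relations has to precede any computation with it. After that, identities are checked on pure
  tensors or on generators.\<close>

lemma lin_homI:
  assumes "\<And>x. x \<in> carrier V \<Longrightarrow> f x \<in> carrier W"
    and "\<And>x y. x \<in> carrier V \<Longrightarrow> y \<in> carrier V \<Longrightarrow> f (x \<oplus>\<^bsub>V\<^esub> y) = f x \<oplus>\<^bsub>W\<^esub> f y"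
    and "\<And>c x. c \<in> carrier K \<Longrightarrow> x \<in> carrier V \<Longrightarrow> f (c \<odot>\<^bsub>V\<^esub> x) = c \<odot>\<^bsub>W\<^esub> f x"
  shows "f \<in> lin_hom K V W"
  using assms by (auto simp: lin_hom_def)

lemma lin_hom_closed: "f \<in> lin_hom K V W \<Longrightarrow> x \<in> carrier V \<Longrightarrow> f x \<in> carrier W"
  by (auto simp: lin_hom_def)

lemma lin_hom_add:
  "f \<in> lin_hom K V W \<Longrightarrow> x \<in> carrier V \<Longrightarrow> y \<in> carrier V \<Longrightarrow> f (x \<oplus>\<^bsub>V\<^esub> y) = f x \<oplus>\<^bsub>W\<^esub> f y"
  by (auto simp: lin_hom_def)

lemma lin_hom_smult:
  "f \<in> lin_hom K V W \<Longrightarrow> c \<in> carrier K \<Longrightarrow> x \<in> carrier V \<Longrightarrow> f (c \<odot>\<^bsub>V\<^esub> x) = c \<odot>\<^bsub>W\<^esub> f x"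
  by (auto simp: lin_hom_def)

lemma lin_hom_id: "(\<lambda>x. x) \<in> lin_hom K V V"
  by (auto simp: lin_hom_def)

lemma lin_hom_comp:
  "f \<in> lin_hom K U V \<Longrightarrow> g \<in> lin_hom K V W \<Longrightarrow> (\<lambda>x. g (f x)) \<in> lin_hom K U W"
  by (auto simp: lin_hom_def Pi_iff)

lemma lin_hom_zero:
  assumes "module K V" "module K W" "f \<in> lin_hom K V W"
  shows "f \<zero>\<^bsub>V\<^esub> = \<zero>\<^bsub>W\<^esub>"
proof -
  interpret V: module K V by fact
  interpret W: module K W by fact
  have "f (\<zero>\<^bsub>K\<^esub> \<odot>\<^bsub>V\<^esub> \<zero>\<^bsub>V\<^esub>) = \<zero>\<^bsub>K\<^esub> \<odot>\<^bsub>W\<^esub> f \<zero>\<^bsub>V\<^esub>"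
    using assms(3) by (intro lin_hom_smult) auto
  then show ?thesis using lin_hom_closed[OF assms(3)] by simp
qed

lemma (in module) a_inv_eq_smult:
  "x \<in> carrier M \<Longrightarrow> \<ominus>\<^bsub>M\<^esub> x = (\<ominus> \<one>) \<odot>\<^bsub>M\<^esub> x"
  by (simp add: smult_l_minus)

lemma lin_hom_minus:
  assumes "module K V" "module K W" "f \<in> lin_hom K V W" "x \<in> carrier V" "y \<in> carrier V"
  shows "f (x \<ominus>\<^bsub>V\<^esub> y) = f x \<ominus>\<^bsub>W\<^esub> f y"
proof -
  interpret V: module K V by fact
  interpret W: module K W by fact
  show ?thesis
    using assms(4,5) lin_hom_closed[OF assms(3)] unfolding a_minus_def
    by (simp add: V.a_inv_eq_smult W.a_inv_eq_smult lin_hom_add[OF assms(3)] lin_hom_smult[OF assms(3)])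
qed

lemma k_algebra_module: "k_algebra K V \<Longrightarrow> module K V"
  by (simp add: k_algebra_def)

lemma alg_hom_lin: "f \<in> alg_hom K V W \<Longrightarrow> f \<in> lin_hom K V W"
  by (simp add: alg_hom_def)

lemma alg_homI:
  assumes "f \<in> lin_hom K V W" "f \<one>\<^bsub>V\<^esub> = \<one>\<^bsub>W\<^esub>"
    "\<And>x y. x \<in> carrier V \<Longrightarrow> y \<in> carrier V \<Longrightarrow> f (x \<otimes>\<^bsub>V\<^esub> y) = f x \<otimes>\<^bsub>W\<^esub> f y"
  shows "f \<in> alg_hom K V W"
  using assms by (auto simp: alg_hom_def lin_hom_def intro!: ring_hom_memI)

lemma alg_hom_mult:
  "f \<in> alg_hom K V W \<Longrightarrow> x \<in> carrier V \<Longrightarrow> y \<in> carrier V \<Longrightarrow> f (x \<otimes>\<^bsub>V\<^esub> y) = f x \<otimes>\<^bsub>W\<^esub> f y"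
  by (auto simp: alg_hom_def ring_hom_mult)

lemma alg_hom_one: "f \<in> alg_hom K V W \<Longrightarrow> f \<one>\<^bsub>V\<^esub> = \<one>\<^bsub>W\<^esub>"
  by (auto simp: alg_hom_def ring_hom_one)

lemma alg_hom_comp:
  assumes "f \<in> alg_hom K U V" "g \<in> alg_hom K V W"
  shows "(\<lambda>x. g (f x)) \<in> alg_hom K U W"
  by (rule alg_homI[OF lin_hom_comp[OF assms[THEN alg_hom_lin]]])
    (simp_all add: alg_hom_mult[OF assms(1)] alg_hom_mult[OF assms(2)] alg_hom_one[OF assms(1)]
      alg_hom_one[OF assms(2)] lin_hom_closed[OF alg_hom_lin[OF assms(1)]])

section \<open>Monoid algebras\<close>

locale field_monoid = K?: field K + G?: monoid G
  for K :: "'k ring" and G :: "'g monoid"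
begin

abbreviation F where "F \<equiv> monoid_algebra K G"

abbreviation supp where "supp f \<equiv> {x. f x \<noteq> \<zero>\<^bsub>K\<^esub>}"

lemma F_carrier:
  "f \<in> carrier F \<longleftrightarrow> (\<forall>x. f x \<in> carrier K) \<and> supp f \<subseteq> carrier G \<and> finite (supp f)"
  by (auto simp: monoid_algebra_def)

lemma F_add: "f \<oplus>\<^bsub>F\<^esub> g = (\<lambda>x. f x \<oplus>\<^bsub>K\<^esub> g x)"
  by (simp add: monoid_algebra_def)

lemma F_zero: "\<zero>\<^bsub>F\<^esub> = (\<lambda>x. \<zero>\<^bsub>K\<^esub>)"
  by (simp add: monoid_algebra_def)

lemma F_one: "\<one>\<^bsub>F\<^esub> = basis_elem K \<one>\<^bsub>G\<^esub>"
  by (simp add: monoid_algebra_def basis_elem_def)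

lemma F_smult: "c \<odot>\<^bsub>F\<^esub> f = (\<lambda>x. c \<otimes>\<^bsub>K\<^esub> f x)"
  by (simp add: monoid_algebra_def)

lemma supp_add: "f \<in> carrier F \<Longrightarrow> g \<in> carrier F \<Longrightarrow> supp (\<lambda>x. f x \<oplus>\<^bsub>K\<^esub> g x) \<subseteq> supp f \<union> supp g"
  by (auto simp: F_carrier)

lemma supp_smult: "c \<in> carrier K \<Longrightarrow> supp (\<lambda>x. c \<otimes>\<^bsub>K\<^esub> f x) \<subseteq> supp f"
  by auto

lemma F_closed_add:
  assumes "f \<in> carrier F" "g \<in> carrier F"
  shows "f \<oplus>\<^bsub>F\<^esub> g \<in> carrier F"
proof -
  have "finite (supp f \<union> supp g)" "supp f \<union> supp g \<subseteq> carrier G"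
    "\<forall>x. f x \<in> carrier K" "\<forall>x. g x \<in> carrier K"
    using assms by (auto simp: F_carrier)
  moreover have "finite (supp (\<lambda>x. f x \<oplus>\<^bsub>K\<^esub> g x))"
    using supp_add[OF assms] calculation(1) by (rule finite_subset)
  ultimately show ?thesis using supp_add[OF assms]
    unfolding F_carrier F_add by blast
qed

lemma F_closed_smult:
  assumes "c \<in> carrier K" "f \<in> carrier F"
  shows "c \<odot>\<^bsub>F\<^esub> f \<in> carrier F"
proof -
  have "finite (supp f)" using assms by (simp add: F_carrier)
  with supp_smult[OF assms(1)] have "finite (supp (\<lambda>x. c \<otimes>\<^bsub>K\<^esub> f x))" by (rule finite_subset)
  then show ?thesis using assms supp_smult[OF assms(1), of f]
    unfolding F_carrier F_smult by blast
qed

lemma basis_closed: "x \<in> carrier G \<Longrightarrow> basis_elem K x \<in> carrier F"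
  by (auto simp: F_carrier basis_elem_def)

lemma F_module: "module K F"
proof (rule moduleI)
  show "cring K" by (rule is_cring)
  show "abelian_group F"
  proof (rule abelian_groupI)
    fix x assume x: "x \<in> carrier F"
    have "(\<ominus>\<^bsub>K\<^esub> \<one>\<^bsub>K\<^esub>) \<odot>\<^bsub>F\<^esub> x \<oplus>\<^bsub>F\<^esub> x = \<zero>\<^bsub>F\<^esub>"
      using x by (auto simp: F_carrier F_add F_zero F_smult l_minus l_neg)
    then show "\<exists>y\<in>carrier F. y \<oplus>\<^bsub>F\<^esub> x = \<zero>\<^bsub>F\<^esub>"
      using F_closed_smult[OF _ x] by blast
  qed (auto simp: F_closed_add, auto simp: F_carrier F_add F_zero K.a_ac)
qed (auto simp: F_closed_add F_closed_smult,
    auto simp: F_carrier F_add F_zero F_smult K.l_distr K.r_distr K.m_assoc)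

text \<open>The induction runs over a finite set containing the support; deleting one point splits
  off a multiple of a basis element. The zero function is covered by \<open>smult\<close> with the
  scalar zero.\<close>

lemma F_induct [consumes 1, case_names basis add smult]:
  assumes "f \<in> carrier F"
    and basis: "\<And>x. x \<in> carrier G \<Longrightarrow> P (basis_elem K x)"
    and add: "\<And>f g. f \<in> carrier F \<Longrightarrow> g \<in> carrier F \<Longrightarrow> P f \<Longrightarrow> P g \<Longrightarrow> P (f \<oplus>\<^bsub>F\<^esub> g)"
    and smult: "\<And>c f. c \<in> carrier K \<Longrightarrow> f \<in> carrier F \<Longrightarrow> P f \<Longrightarrow> P (c \<odot>\<^bsub>F\<^esub> f)"
  shows "P f"
proof -
  interpret F: module K F by (rule F_module)
  have "finite X \<Longrightarrow> (\<And>f. f \<in> carrier F \<Longrightarrow> supp f \<subseteq> X \<Longrightarrow> P f)" for X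
  proof (induction X rule: finite_induct)
    case empty
    have e: "basis_elem K \<one>\<^bsub>G\<^esub> \<in> carrier F" by (simp add: basis_closed)
    have "f = \<zero>\<^bsub>K\<^esub> \<odot>\<^bsub>F\<^esub> basis_elem K \<one>\<^bsub>G\<^esub>" using empty e by (auto simp: F_zero)
    then show ?case using smult[OF _ e basis] by auto
  next
    case (insert x X)
    show ?case
    proof (cases "f x = \<zero>\<^bsub>K\<^esub>")
      case True
      then have "supp f \<subseteq> X" using insert.prems by auto
      then show ?thesis using insert by blast
    next
      case False
      let ?g = "f(x := \<zero>\<^bsub>K\<^esub>)"
      have x: "x \<in> carrier G" using False insert.prems by (auto simp: F_carrier)
      have s: "supp ?g \<subseteq> X" "supp ?g \<subseteq> supp f" using insert.prems by auto
      have g: "?g \<in> carrier F" using s insert.prems finite_subset[OF s(2)] by (auto simp: F_carrier)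
      have fx: "f x \<in> carrier K" using insert.prems by (auto simp: F_carrier)
      have "f = ?g \<oplus>\<^bsub>F\<^esub> (f x \<odot>\<^bsub>F\<^esub> basis_elem K x)"
        using insert.prems fx by (auto simp: F_carrier F_add F_smult basis_elem_def fun_eq_iff)
      moreover have "P (?g \<oplus>\<^bsub>F\<^esub> (f x \<odot>\<^bsub>F\<^esub> basis_elem K x))"
        using x g fx by (intro add insert.IH[OF g s(1)] smult basis F_closed_smult basis_closed)
      ultimately show ?thesis by simp
    qed
  qed
  then show ?thesis using assms(1) F_carrier by blast
qed

text \<open>The condition on the product of the two indices sits in the summand instead of the index
  set, so that products of different functions can be summed over one common rectangle.\<close>

definition conv_term where
  "conv_term f g z p = (if fst p \<otimes>\<^bsub>G\<^esub> snd p = z then f (fst p) \<otimes>\<^bsub>K\<^esub> g (snd p) else \<zero>\<^bsub>K\<^esub>)"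

text \<open>The index set of the product depends on the supports. Any finite rectangle containing
  them gives the same sum, which makes products with \<open>f\<close>, \<open>f'\<close> and their
  sum comparable term by term.\<close>

lemma F_mult_superset:
  assumes "f \<in> carrier F" "g \<in> carrier F" "finite X" "finite Y" "supp f \<subseteq> X" "supp g \<subseteq> Y"
  shows "(f \<otimes>\<^bsub>F\<^esub> g) z = (\<Oplus>\<^bsub>K\<^esub>p\<in>X \<times> Y. conv_term f g z p)"
proof -
  have "(f \<otimes>\<^bsub>F\<^esub> g) z = (\<Oplus>\<^bsub>K\<^esub>p \<in> {(x, y). f x \<noteq> \<zero>\<^bsub>K\<^esub> \<and> g y \<noteq> \<zero>\<^bsub>K\<^esub> \<and> x \<otimes>\<^bsub>G\<^esub> y = z}.
        f (fst p) \<otimes>\<^bsub>K\<^esub> g (snd p))" by (simp add: monoid_algebra_def)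
  also have "\<dots> = (\<Oplus>\<^bsub>K\<^esub>p\<in>X \<times> Y. conv_term f g z p)"
    using assms by (intro add.finprod_mono_neutral_cong_left)
      (auto simp: conv_term_def F_carrier Pi_iff subset_iff)
  finally show ?thesis .
qed

lemma conv_term_closed: "f \<in> carrier F \<Longrightarrow> g \<in> carrier F \<Longrightarrow> conv_term f g z p \<in> carrier K"
  by (auto simp: conv_term_def F_carrier)

lemma F_mult_distr:
  assumes f: "f \<in> carrier F" and f': "f' \<in> carrier F" and g: "g \<in> carrier F"
  shows "(f \<oplus>\<^bsub>F\<^esub> f') \<otimes>\<^bsub>F\<^esub> g = f \<otimes>\<^bsub>F\<^esub> g \<oplus>\<^bsub>F\<^esub> f' \<otimes>\<^bsub>F\<^esub> g"
    and "g \<otimes>\<^bsub>F\<^esub> (f \<oplus>\<^bsub>F\<^esub> f') = g \<otimes>\<^bsub>F\<^esub> f \<oplus>\<^bsub>F\<^esub> g \<otimes>\<^bsub>F\<^esub> f'"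
proof -
  let ?X = "supp f \<union> supp f'" and ?Y = "supp g"
  have s: "finite ?X" "finite ?Y" "supp f \<subseteq> ?X" "supp f' \<subseteq> ?X" "supp (f \<oplus>\<^bsub>F\<^esub> f') \<subseteq> ?X" "supp g \<subseteq> ?Y"
    using f f' g supp_add[OF f f'] by (auto simp: F_carrier F_add)
  note c = F_closed_add[OF f f']
  have "((f \<oplus>\<^bsub>F\<^esub> f') \<otimes>\<^bsub>F\<^esub> g) z = (f \<otimes>\<^bsub>F\<^esub> g \<oplus>\<^bsub>F\<^esub> f' \<otimes>\<^bsub>F\<^esub> g) z" for z
  proof -
    have t: "conv_term (f \<oplus>\<^bsub>F\<^esub> f') g z = (\<lambda>p. conv_term f g z p \<oplus>\<^bsub>K\<^esub> conv_term f' g z p)"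
      using f f' g by (auto simp: conv_term_def F_carrier F_add K.l_distr)
    show ?thesis unfolding F_mult_superset[OF c g s(1,2,5,6)] t F_add[of "f \<otimes>\<^bsub>F\<^esub> g"]
      F_mult_superset[OF f g s(1,2,3,6)] F_mult_superset[OF f' g s(1,2,4,6)]
      using f f' g by (intro finsum_addf) (auto simp: conv_term_closed)
  qed
  then show "(f \<oplus>\<^bsub>F\<^esub> f') \<otimes>\<^bsub>F\<^esub> g = f \<otimes>\<^bsub>F\<^esub> g \<oplus>\<^bsub>F\<^esub> f' \<otimes>\<^bsub>F\<^esub> g" by blast
  have "(g \<otimes>\<^bsub>F\<^esub> (f \<oplus>\<^bsub>F\<^esub> f')) z = (g \<otimes>\<^bsub>F\<^esub> f \<oplus>\<^bsub>F\<^esub> g \<otimes>\<^bsub>F\<^esub> f') z" for z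
  proof -
    have t: "conv_term g (f \<oplus>\<^bsub>F\<^esub> f') z = (\<lambda>p. conv_term g f z p \<oplus>\<^bsub>K\<^esub> conv_term g f' z p)"
      using f f' g by (auto simp: conv_term_def F_carrier F_add K.r_distr)
    show ?thesis unfolding F_mult_superset[OF g c s(2,1,6,5)] t F_add[of "g \<otimes>\<^bsub>F\<^esub> f"]
      F_mult_superset[OF g f s(2,1,6,3)] F_mult_superset[OF g f' s(2,1,6,4)]
      using f f' g by (intro finsum_addf) (auto simp: conv_term_closed)
  qed
  then show "g \<otimes>\<^bsub>F\<^esub> (f \<oplus>\<^bsub>F\<^esub> f') = g \<otimes>\<^bsub>F\<^esub> f \<oplus>\<^bsub>F\<^esub> g \<otimes>\<^bsub>F\<^esub> f'" by blast
qed

lemma F_mult_smult: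
  assumes f: "f \<in> carrier F" and g: "g \<in> carrier F" and c: "c \<in> carrier K"
  shows "(c \<odot>\<^bsub>F\<^esub> f) \<otimes>\<^bsub>F\<^esub> g = c \<odot>\<^bsub>F\<^esub> (f \<otimes>\<^bsub>F\<^esub> g)"
    and "f \<otimes>\<^bsub>F\<^esub> (c \<odot>\<^bsub>F\<^esub> g) = c \<odot>\<^bsub>F\<^esub> (f \<otimes>\<^bsub>F\<^esub> g)"
proof -
  let ?X = "supp f" and ?Y = "supp g"
  have s: "finite ?X" "finite ?Y" "supp f \<subseteq> ?X" "supp g \<subseteq> ?Y" "supp (c \<odot>\<^bsub>F\<^esub> f) \<subseteq> ?X" "supp (c \<odot>\<^bsub>F\<^esub> g) \<subseteq> ?Y"
    using f g c by (auto simp: F_carrier F_smult)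
  have "((c \<odot>\<^bsub>F\<^esub> f) \<otimes>\<^bsub>F\<^esub> g) z = (c \<odot>\<^bsub>F\<^esub> (f \<otimes>\<^bsub>F\<^esub> g)) z"
    "(f \<otimes>\<^bsub>F\<^esub> (c \<odot>\<^bsub>F\<^esub> g)) z = (c \<odot>\<^bsub>F\<^esub> (f \<otimes>\<^bsub>F\<^esub> g)) z" for z
  proof -
    have t: "conv_term (c \<odot>\<^bsub>F\<^esub> f) g z = (\<lambda>p. c \<otimes>\<^bsub>K\<^esub> conv_term f g z p)"
        "conv_term f (c \<odot>\<^bsub>F\<^esub> g) z = (\<lambda>p. c \<otimes>\<^bsub>K\<^esub> conv_term f g z p)"
      using f g c by (auto simp: conv_term_def F_carrier F_smult K.m_assoc K.m_lcomm)
    have r: "c \<otimes>\<^bsub>K\<^esub> (\<Oplus>\<^bsub>K\<^esub>p\<in>?X \<times> ?Y. conv_term f g z p) = (\<Oplus>\<^bsub>K\<^esub>p\<in>?X \<times> ?Y. c \<otimes>\<^bsub>K\<^esub> conv_term f g z p)"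
      using s f g c by (intro finsum_rdistr) (auto simp: conv_term_closed)
    show "((c \<odot>\<^bsub>F\<^esub> f) \<otimes>\<^bsub>F\<^esub> g) z = (c \<odot>\<^bsub>F\<^esub> (f \<otimes>\<^bsub>F\<^esub> g)) z"
      "(f \<otimes>\<^bsub>F\<^esub> (c \<odot>\<^bsub>F\<^esub> g)) z = (c \<odot>\<^bsub>F\<^esub> (f \<otimes>\<^bsub>F\<^esub> g)) z"
      unfolding F_mult_superset[OF F_closed_smult[OF c f] g s(1,2,5,4)]
        F_mult_superset[OF f F_closed_smult[OF c g] s(1,2,3,6)] t F_smult[of c "f \<otimes>\<^bsub>F\<^esub> g"]
        F_mult_superset[OF f g s(1-4)] r by (rule refl)+
  qed
  then show "(c \<odot>\<^bsub>F\<^esub> f) \<otimes>\<^bsub>F\<^esub> g = c \<odot>\<^bsub>F\<^esub> (f \<otimes>\<^bsub>F\<^esub> g)"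
    "f \<otimes>\<^bsub>F\<^esub> (c \<odot>\<^bsub>F\<^esub> g) = c \<odot>\<^bsub>F\<^esub> (f \<otimes>\<^bsub>F\<^esub> g)" by blast+
qed

lemma F_mult_basis:
  assumes "x \<in> carrier G" "y \<in> carrier G"
  shows "basis_elem K x \<otimes>\<^bsub>F\<^esub> basis_elem K y = basis_elem K (x \<otimes>\<^bsub>G\<^esub> y)"
proof
  fix z
  have "(basis_elem K x \<otimes>\<^bsub>F\<^esub> basis_elem K y) z
      = (\<Oplus>\<^bsub>K\<^esub>p\<in>{x} \<times> {y}. conv_term (basis_elem K x) (basis_elem K y) z p)"
    using assms by (intro F_mult_superset basis_closed) (auto simp: basis_elem_def)
  also have "{x} \<times> {y} = {(x, y)}" by auto
  also have "(\<Oplus>\<^bsub>K\<^esub>p\<in>{(x, y)}. conv_term (basis_elem K x) (basis_elem K y) z p)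
     = conv_term (basis_elem K x) (basis_elem K y) z (x, y)"
    using assms by (subst finsum_insert) (auto simp: conv_term_closed basis_closed)
  finally show "(basis_elem K x \<otimes>\<^bsub>F\<^esub> basis_elem K y) z = basis_elem K (x \<otimes>\<^bsub>G\<^esub> y) z"
    by (auto simp: conv_term_def basis_elem_def)
qed

text \<open>Bilinearity reduces both factors to basis elements, whose product is again a basis
  element.\<close>

lemma F_mult_closed:
  assumes "f \<in> carrier F" "g \<in> carrier F"
  shows "f \<otimes>\<^bsub>F\<^esub> g \<in> carrier F"
  using assms
proof (induction rule: F_induct)
  case (basis x)
  show ?case using basis(2,1)
    by (induction rule: F_induct)
      (auto simp: F_mult_basis F_mult_distr F_mult_smult F_closed_add F_closed_smult basis_closed)
qed (auto simp: F_mult_distr F_mult_smult F_closed_add F_closed_smult)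

lemma F_algebra: "k_algebra K F"
proof -
  interpret F: module K F by (rule F_module)
  \<comment> \<open>Trilinearity reduces the claim to basis elements, one argument at a time; there
    it is associativity in \<open>G\<close>.\<close>
  have assoc: "f \<otimes>\<^bsub>F\<^esub> g \<otimes>\<^bsub>F\<^esub> h = f \<otimes>\<^bsub>F\<^esub> (g \<otimes>\<^bsub>F\<^esub> h)"
    if "f \<in> carrier F" "g \<in> carrier F" "h \<in> carrier F" for f g h
    using that
  proof (induction rule: F_induct)
    case (basis x)
    note h = basis(3)
    show ?case using basis(2,1)
    proof (induction rule: F_induct)
      case (basis y)
      show ?case using h basis
        by (induction rule: F_induct)
          (auto simp: F_mult_basis G.m_assoc F_mult_distr F_mult_smult F_mult_closed basis_closed)
    qed (auto simp: F_mult_distr F_mult_smult F_mult_closed basis_closed h)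
  qed (auto simp: F_mult_distr F_mult_smult F_mult_closed)
  have one: "\<one>\<^bsub>F\<^esub> \<in> carrier F" by (simp add: F_one basis_closed)
  have l_one: "\<one>\<^bsub>F\<^esub> \<otimes>\<^bsub>F\<^esub> f = f" and r_one: "f \<otimes>\<^bsub>F\<^esub> \<one>\<^bsub>F\<^esub> = f" if "f \<in> carrier F" for f
    using that
    by (induction rule: F_induct) (auto simp: F_mult_basis F_one F_mult_distr F_mult_smult basis_closed)
  have "ring F"
    by (intro ringI F.abelian_group_axioms monoidI)
      (auto simp: assoc one l_one r_one F_mult_distr F_mult_closed)
  then show ?thesis
    using F_module K.field_axioms by (simp add: k_algebra_def k_algebra_axioms_def F_mult_smult)
qed

end

section \<open>Linear extension from the monoid basis\<close>

definition lin_ext :: "'k ring \<Rightarrow> ('k, 'u) module \<Rightarrow> ('g \<Rightarrow> 'u) \<Rightarrow> ('g \<Rightarrow> 'k) \<Rightarrow> 'u" where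
  "lin_ext K U \<phi> f = (\<Oplus>\<^bsub>U\<^esub>p \<in> {p. f p \<noteq> \<zero>\<^bsub>K\<^esub>}. f p \<odot>\<^bsub>U\<^esub> \<phi> p)"

context field_monoid begin

lemma lin_ext_superset:
  assumes "module K U" "\<phi> \<in> carrier G \<rightarrow> carrier U" "f \<in> carrier F" "finite X" "supp f \<subseteq> X" "X \<subseteq> carrier G"
  shows "lin_ext K U \<phi> f = (\<Oplus>\<^bsub>U\<^esub>p\<in>X. f p \<odot>\<^bsub>U\<^esub> \<phi> p)"
proof -
  interpret U: module K U by fact
  show ?thesis unfolding lin_ext_def using assms
    by (intro U.M.add.finprod_mono_neutral_cong_left)
      (auto simp: F_carrier Pi_iff subset_iff)
qed

lemma lin_ext_lin:
  assumes "module K U" "\<phi> \<in> carrier G \<rightarrow> carrier U"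
  shows "lin_ext K U \<phi> \<in> lin_hom K F U"
proof (rule lin_homI)
  interpret U: module K U by fact
  have summand: "f p \<odot>\<^bsub>U\<^esub> \<phi> p \<in> carrier U" if "f \<in> carrier F" "p \<in> carrier G" for f p
    using that assms(2) by (auto simp: F_carrier)
  have summands: "(\<lambda>p. f p \<odot>\<^bsub>U\<^esub> \<phi> p) \<in> X \<rightarrow> carrier U" if "f \<in> carrier F" "X \<subseteq> carrier G" for f X
    using that summand by auto
  fix f assume f: "f \<in> carrier F"
  then have sf: "finite (supp f)" "supp f \<subseteq> carrier G" by (auto simp: F_carrier)
  show "lin_ext K U \<phi> f \<in> carrier U"
    unfolding lin_ext_def using sf summands[OF f] by (intro U.M.finsum_closed) auto
  {
    fix g assume g: "g \<in> carrier F"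
    let ?X = "supp f \<union> supp g"
    have X: "finite ?X" "?X \<subseteq> carrier G" "supp f \<subseteq> ?X" "supp g \<subseteq> ?X" "supp (f \<oplus>\<^bsub>F\<^esub> g) \<subseteq> ?X"
      using f g supp_add[OF f g] by (auto simp: F_carrier F_add)
    have "lin_ext K U \<phi> (f \<oplus>\<^bsub>F\<^esub> g) = (\<Oplus>\<^bsub>U\<^esub>p\<in>?X. (f \<oplus>\<^bsub>F\<^esub> g) p \<odot>\<^bsub>U\<^esub> \<phi> p)"
      using X f g by (intro lin_ext_superset assms F_closed_add)
    also have "\<dots> = (\<Oplus>\<^bsub>U\<^esub>p\<in>?X. f p \<odot>\<^bsub>U\<^esub> \<phi> p \<oplus>\<^bsub>U\<^esub> g p \<odot>\<^bsub>U\<^esub> \<phi> p)"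
      using X f g assms(2) summand
      by (intro U.M.finsum_cong') (auto simp: F_add F_carrier subset_iff U.smult_l_distr Pi_iff)
    also have "\<dots> = (\<Oplus>\<^bsub>U\<^esub>p\<in>?X. f p \<odot>\<^bsub>U\<^esub> \<phi> p) \<oplus>\<^bsub>U\<^esub> (\<Oplus>\<^bsub>U\<^esub>p\<in>?X. g p \<odot>\<^bsub>U\<^esub> \<phi> p)"
      using X f g summands by (intro U.M.finsum_addf) auto
    also have "\<dots> = lin_ext K U \<phi> f \<oplus>\<^bsub>U\<^esub> lin_ext K U \<phi> g"
      using lin_ext_superset[OF assms f X(1,3,2)] lin_ext_superset[OF assms g X(1,4,2)] by simp
    finally show "lin_ext K U \<phi> (f \<oplus>\<^bsub>F\<^esub> g) = lin_ext K U \<phi> f \<oplus>\<^bsub>U\<^esub> lin_ext K U \<phi> g" .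
  }
  {
    fix c assume c: "c \<in> carrier K"
    have "lin_ext K U \<phi> (c \<odot>\<^bsub>F\<^esub> f) = (\<Oplus>\<^bsub>U\<^esub>p\<in>supp f. (c \<odot>\<^bsub>F\<^esub> f) p \<odot>\<^bsub>U\<^esub> \<phi> p)"
      using sf c f supp_smult[OF c, of f]
      by (intro lin_ext_superset assms F_closed_smult) (auto simp: F_smult)
    also have "\<dots> = (\<Oplus>\<^bsub>U\<^esub>p\<in>supp f. c \<odot>\<^bsub>U\<^esub> (f p \<odot>\<^bsub>U\<^esub> \<phi> p))"
      using sf c f assms(2) summand
      by (intro U.M.finsum_cong') (auto simp: F_smult F_carrier subset_iff U.smult_assoc1 Pi_iff)
    also have "\<dots> = c \<odot>\<^bsub>U\<^esub> lin_ext K U \<phi> f"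
      unfolding lin_ext_def using sf c summands[OF f] by (intro U.finsum_smult_ldistr[symmetric]) auto
    finally show "lin_ext K U \<phi> (c \<odot>\<^bsub>F\<^esub> f) = c \<odot>\<^bsub>U\<^esub> lin_ext K U \<phi> f" .
  }
qed

lemma lin_ext_basis:
  assumes "module K U" "\<phi> \<in> carrier G \<rightarrow> carrier U" "x \<in> carrier G"
  shows "lin_ext K U \<phi> (basis_elem K x) = \<phi> x"
proof -
  interpret U: module K U by fact
  have "lin_ext K U \<phi> (basis_elem K x) = (\<Oplus>\<^bsub>U\<^esub>p\<in>{x}. basis_elem K x p \<odot>\<^bsub>U\<^esub> \<phi> p)"
    using assms by (intro lin_ext_superset basis_closed) (auto simp: basis_elem_def)
  also have "\<dots> = \<phi> x" using assms
    by (subst U.M.finsum_insert) (auto simp: basis_elem_def Pi_iff)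
  finally show ?thesis .
qed

text \<open>Both sides of multiplicativity are bilinear, so it suffices on basis elements, where it
  is the hypothesis on \<open>\<phi>\<close>.\<close>

lemma lin_ext_alg:
  assumes "k_algebra K U" "\<phi> \<in> carrier G \<rightarrow> carrier U" "\<phi> \<one>\<^bsub>G\<^esub> = \<one>\<^bsub>U\<^esub>"
    "\<And>x y. x \<in> carrier G \<Longrightarrow> y \<in> carrier G \<Longrightarrow> \<phi> (x \<otimes>\<^bsub>G\<^esub> y) = \<phi> x \<otimes>\<^bsub>U\<^esub> \<phi> y"
  shows "lin_ext K U \<phi> \<in> alg_hom K F U"
proof (rule alg_homI)
  interpret U: k_algebra K U by fact
  interpret F: k_algebra K F by (rule F_algebra)
  note lin = lin_ext_lin[OF U.module_axioms assms(2)]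
  note basis = lin_ext_basis[OF U.module_axioms assms(2)]
  note rules = funcset_mem[OF assms(2)] lin_hom_add[OF lin] lin_hom_smult[OF lin] lin_hom_closed[OF lin]
    F_mult_distr F_mult_smult F_mult_closed basis_closed F_closed_add F_closed_smult
    U.A.l_distr U.A.r_distr U.smult_mult_left U.smult_mult_right
  show "lin_ext K U \<phi> \<in> lin_hom K F U" by (rule lin)
  show "lin_ext K U \<phi> \<one>\<^bsub>F\<^esub> = \<one>\<^bsub>U\<^esub>" by (simp add: F_one basis assms)
  show "lin_ext K U \<phi> (x \<otimes>\<^bsub>F\<^esub> y) = lin_ext K U \<phi> x \<otimes>\<^bsub>U\<^esub> lin_ext K U \<phi> y"
    if "x \<in> carrier F" "y \<in> carrier F" for x y
    using that
  proof (induction x rule: F_induct)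
    case (basis x)
    show ?case using basis(2,1)
      by (induction y rule: F_induct)
        (simp_all add: F_mult_basis \<open>\<And>x. x \<in> carrier G \<Longrightarrow> lin_ext K U \<phi> (basis_elem K x) = \<phi> x\<close> assms rules)
  qed (simp_all add: rules)
qed

end

section \<open>Quotient algebras\<close>

text \<open>The choice of a representative is the one made in \<open>tensor_lift\<close> and
  \<open>tensor_alg_lift\<close>, so that both turn out to be \<open>quot_lift\<close> of a linear
  extension.\<close>

definition quot_lift :: "('a \<Rightarrow> 'c) \<Rightarrow> 'a set \<Rightarrow> 'c" where
  "quot_lift \<phi> X = \<phi> (SOME x. x \<in> X)"

locale algebra_ideal = k_algebra K A + ideal I A
  for K :: "'k ring" and A :: "('k, 'a) module" and I
begin

abbreviation Q where "Q \<equiv> quot_alg A I"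

text \<open>Scalars act through multiples of the unit, so a ring ideal of an algebra is also a
  submodule.\<close>

lemma I_smult: "c \<in> carrier K \<Longrightarrow> x \<in> I \<Longrightarrow> c \<odot>\<^bsub>A\<^esub> x \<in> I"
proof -
  assume c: "c \<in> carrier K" and x: "x \<in> I"
  have "(c \<odot>\<^bsub>A\<^esub> \<one>\<^bsub>A\<^esub>) \<otimes>\<^bsub>A\<^esub> x \<in> I" using c x by (intro I_l_closed) auto
  then show ?thesis using c x a_Hcarr by (simp add: smult_mult_left)
qed

lemma Q_simps:
  "x \<in> carrier A \<Longrightarrow> y \<in> carrier A \<Longrightarrow> (I +>\<^bsub>A\<^esub> x) \<oplus>\<^bsub>Q\<^esub> (I +>\<^bsub>A\<^esub> y) = I +>\<^bsub>A\<^esub> (x \<oplus>\<^bsub>A\<^esub> y)"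
  "x \<in> carrier A \<Longrightarrow> y \<in> carrier A \<Longrightarrow> (I +>\<^bsub>A\<^esub> x) \<otimes>\<^bsub>Q\<^esub> (I +>\<^bsub>A\<^esub> y) = I +>\<^bsub>A\<^esub> (x \<otimes>\<^bsub>A\<^esub> y)"
  "\<one>\<^bsub>Q\<^esub> = I +>\<^bsub>A\<^esub> \<one>\<^bsub>A\<^esub>" "\<zero>\<^bsub>Q\<^esub> = I"
  by (simp_all add: quot_alg_def FactRing_def rcoset_mult_add a_rcos_sum)

lemma Q_carrier: "carrier Q = (\<lambda>x. I +>\<^bsub>A\<^esub> x) ` carrier A"
  by (auto simp: quot_alg_def FactRing_simps)

lemma Q_smult:
  assumes c: "c \<in> carrier K" and x: "x \<in> carrier A"
  shows "c \<odot>\<^bsub>Q\<^esub> (I +>\<^bsub>A\<^esub> x) = I +>\<^bsub>A\<^esub> (c \<odot>\<^bsub>A\<^esub> x)"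
proof -
  \<comment> \<open>The scalar multiple of a coset is defined as a union over all its
    representatives. They differ by elements of \<open>I\<close>, which is closed under scalars, so
    all members of the union are the same coset.\<close>
  have "I +>\<^bsub>A\<^esub> (c \<odot>\<^bsub>A\<^esub> y) = I +>\<^bsub>A\<^esub> (c \<odot>\<^bsub>A\<^esub> x)" if y: "y \<in> I +>\<^bsub>A\<^esub> x" for y
  proof -
    obtain h where h: "h \<in> I" "y = h \<oplus>\<^bsub>A\<^esub> x" using y by (auto simp: a_r_coset_def r_coset_def)
    have "c \<odot>\<^bsub>A\<^esub> y = c \<odot>\<^bsub>A\<^esub> h \<oplus>\<^bsub>A\<^esub> c \<odot>\<^bsub>A\<^esub> x" using h c x a_Hcarr by (simp add: smult_r_distr)
    then have "c \<odot>\<^bsub>A\<^esub> y \<in> I +>\<^bsub>A\<^esub> (c \<odot>\<^bsub>A\<^esub> x)"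
      using I_smult[OF c h(1)] by (auto simp: a_r_coset_def r_coset_def)
    then show ?thesis using c x by (intro a_repr_independence'[symmetric]) auto
  qed
  then have "(\<Union>y\<in>I +>\<^bsub>A\<^esub> x. I +>\<^bsub>A\<^esub> (c \<odot>\<^bsub>A\<^esub> y)) = (\<Union>y\<in>I +>\<^bsub>A\<^esub> x. I +>\<^bsub>A\<^esub> (c \<odot>\<^bsub>A\<^esub> x))"
    by (rule SUP_cong[OF refl])
  also have "\<dots> = I +>\<^bsub>A\<^esub> (c \<odot>\<^bsub>A\<^esub> x)" using a_rcos_self[OF x] by (subst UN_constant) auto
  finally show ?thesis by (simp add: quot_alg_def)
qed

lemma Q_ring: "ring Q"
proof -
  interpret R: ring "A Quot I" by (rule quotient_is_ring)
  have "abelian_group Q"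
  proof (rule abelian_groupI)
    fix x assume "x \<in> carrier Q"
    then show "\<exists>y\<in>carrier Q. y \<oplus>\<^bsub>Q\<^esub> x = \<zero>\<^bsub>Q\<^esub>"
      using R.l_neg[of x] R.a_inv_closed[of x] by (auto simp: quot_alg_def)
  qed (auto simp: quot_alg_def R.a_ac)
  moreover have "Group.monoid Q"
    by (rule monoidI) (auto simp: quot_alg_def R.m_assoc)
  ultimately show ?thesis
    by (rule ringI) (auto simp: quot_alg_def R.l_distr R.r_distr)
qed

lemma Q_algebra: "k_algebra K Q"
proof -
  interpret R: ring Q by (rule Q_ring)
  have "module K Q"
    by (rule moduleI[OF K.is_cring R.abelian_group_axioms])
      (auto simp: Q_carrier Q_simps Q_smult smult_l_distr smult_r_distr smult_assoc1)
  then show ?thesis using R.ring_axioms K.field_axioms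
    by (auto simp: k_algebra_def k_algebra_axioms_def Q_carrier Q_simps Q_smult
      smult_mult_left smult_mult_right)
qed

lemma coset_hom: "(\<lambda>x. I +>\<^bsub>A\<^esub> x) \<in> alg_hom K A Q"
  by (intro alg_homI lin_homI) (auto simp: Q_carrier Q_simps Q_smult)

lemma coset_eq:
  assumes "x \<in> carrier A" "y \<in> carrier A" "x \<ominus>\<^bsub>A\<^esub> y \<in> I"
  shows "I +>\<^bsub>A\<^esub> x = I +>\<^bsub>A\<^esub> y"
proof -
  have "x = (x \<ominus>\<^bsub>A\<^esub> y) \<oplus>\<^bsub>A\<^esub> y" using assms by (simp add: a_minus_def a_assoc l_neg)
  then have "x \<in> I +>\<^bsub>A\<^esub> y" using assms(3) by (auto simp: a_r_coset_def r_coset_def)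
  then show ?thesis using assms by (intro a_repr_independence'[symmetric]) auto
qed

text \<open>The chosen representative differs from \<open>x\<close> by an element of
  \<open>I\<close>, which \<open>\<phi>\<close> annihilates; hence the choice does not
  matter.\<close>

lemma quot_lift_coset:
  assumes "module K C" "\<phi> \<in> lin_hom K A C" "\<And>x. x \<in> I \<Longrightarrow> \<phi> x = \<zero>\<^bsub>C\<^esub>" "x \<in> carrier A"
  shows "quot_lift \<phi> (I +>\<^bsub>A\<^esub> x) = \<phi> x"
proof -
  interpret C: module K C by fact
  have "(SOME y. y \<in> I +>\<^bsub>A\<^esub> x) \<in> I +>\<^bsub>A\<^esub> x" using a_rcos_self[OF assms(4)] by (rule someI)
  then obtain h where h: "h \<in> I" "(SOME y. y \<in> I +>\<^bsub>A\<^esub> x) = h \<oplus>\<^bsub>A\<^esub> x"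
    by (auto simp: a_r_coset_def r_coset_def)
  then show ?thesis unfolding quot_lift_def
    using assms a_Hcarr by (simp add: lin_hom_add[OF assms(2)] lin_hom_closed[OF assms(2)])
qed

lemma quot_lift_lin:
  assumes "module K C" "\<phi> \<in> lin_hom K A C" "\<And>x. x \<in> I \<Longrightarrow> \<phi> x = \<zero>\<^bsub>C\<^esub>"
  shows "quot_lift \<phi> \<in> lin_hom K Q C"
  by (rule lin_homI) (auto simp: Q_carrier Q_simps Q_smult quot_lift_coset[OF assms]
    lin_hom_closed[OF assms(2)] lin_hom_add[OF assms(2)] lin_hom_smult[OF assms(2)])

lemma quot_lift_alg:
  assumes "module K C" "\<phi> \<in> alg_hom K A C" "\<And>x. x \<in> I \<Longrightarrow> \<phi> x = \<zero>\<^bsub>C\<^esub>"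
  shows "quot_lift \<phi> \<in> alg_hom K Q C"
proof -
  note lin = alg_hom_lin[OF assms(2)]
  show ?thesis
    by (intro alg_homI quot_lift_lin assms lin)
      (auto simp: Q_carrier Q_simps quot_lift_coset[OF assms(1) lin assms(3)]
        alg_hom_one[OF assms(2)] alg_hom_mult[OF assms(2)])
qed

end

lemma kernel_ideal:
  assumes "k_algebra K A" "k_algebra K C" "\<phi> \<in> alg_hom K A C"
  shows "ideal {x \<in> carrier A. \<phi> x = \<zero>\<^bsub>C\<^esub>} A"
proof -
  interpret A: k_algebra K A by fact
  interpret C: k_algebra K C by fact
  have "\<phi> \<in> ring_hom A C" using assms(3) by (simp add: alg_hom_def)
  then interpret ring_hom_ring A C \<phi>
    by (rule ring_hom_ringI2[OF A.A.ring_axioms C.A.ring_axioms])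
  show ?thesis using kernel_is_ideal unfolding a_kernel_def' .
qed

section \<open>Tensor products of algebras\<close>

lemma kernel_submodule:
  assumes "module K V" "module K U" "\<phi> \<in> lin_hom K V U"
  shows "submodule {x \<in> carrier V. \<phi> x = \<zero>\<^bsub>U\<^esub>} K V"
proof -
  interpret V: module K V by fact
  interpret U: module K U by fact
  show ?thesis
    by (rule V.submoduleI)
      (auto simp: lin_hom_add[OF assms(3)] lin_hom_smult[OF assms(3)] lin_hom_zero[OF assms]
        V.a_inv_eq_smult)
qed

section \<open>Bilinear maps\<close>

definition bilin ::
    "'k ring \<Rightarrow> ('k, 'v) module \<Rightarrow> ('k, 'w) module \<Rightarrow> ('k, 'u) module \<Rightarrow> ('v \<Rightarrow> 'w \<Rightarrow> 'u) \<Rightarrow> bool" where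
  "bilin K V W U \<phi> \<longleftrightarrow> (\<forall>v\<in>carrier V. \<phi> v \<in> lin_hom K W U) \<and>
     (\<forall>w\<in>carrier W. (\<lambda>v. \<phi> v w) \<in> lin_hom K V U)"

lemma bilinD:
  assumes "bilin K V W U \<phi>"
  shows "v \<in> carrier V \<Longrightarrow> w \<in> carrier W \<Longrightarrow> \<phi> v w \<in> carrier U"
    and "v \<in> carrier V \<Longrightarrow> v' \<in> carrier V \<Longrightarrow> w \<in> carrier W \<Longrightarrow>
      \<phi> (v \<oplus>\<^bsub>V\<^esub> v') w = \<phi> v w \<oplus>\<^bsub>U\<^esub> \<phi> v' w"
    and "v \<in> carrier V \<Longrightarrow> w \<in> carrier W \<Longrightarrow> w' \<in> carrier W \<Longrightarrow>
      \<phi> v (w \<oplus>\<^bsub>W\<^esub> w') = \<phi> v w \<oplus>\<^bsub>U\<^esub> \<phi> v w'"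
    and "c \<in> carrier K \<Longrightarrow> v \<in> carrier V \<Longrightarrow> w \<in> carrier W \<Longrightarrow> \<phi> (c \<odot>\<^bsub>V\<^esub> v) w = c \<odot>\<^bsub>U\<^esub> \<phi> v w"
    and "c \<in> carrier K \<Longrightarrow> v \<in> carrier V \<Longrightarrow> w \<in> carrier W \<Longrightarrow> \<phi> v (c \<odot>\<^bsub>W\<^esub> w) = c \<odot>\<^bsub>U\<^esub> \<phi> v w"
  using assms unfolding bilin_def lin_hom_def by auto

lemma bilinI:
  assumes "\<And>v w. v \<in> carrier V \<Longrightarrow> w \<in> carrier W \<Longrightarrow> \<phi> v w \<in> carrier U"
    and "\<And>v v' w. v \<in> carrier V \<Longrightarrow> v' \<in> carrier V \<Longrightarrow> w \<in> carrier W \<Longrightarrow>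
      \<phi> (v \<oplus>\<^bsub>V\<^esub> v') w = \<phi> v w \<oplus>\<^bsub>U\<^esub> \<phi> v' w"
    and "\<And>v w w'. v \<in> carrier V \<Longrightarrow> w \<in> carrier W \<Longrightarrow> w' \<in> carrier W \<Longrightarrow>
      \<phi> v (w \<oplus>\<^bsub>W\<^esub> w') = \<phi> v w \<oplus>\<^bsub>U\<^esub> \<phi> v w'"
    and "\<And>c v w. c \<in> carrier K \<Longrightarrow> v \<in> carrier V \<Longrightarrow> w \<in> carrier W \<Longrightarrow> \<phi> (c \<odot>\<^bsub>V\<^esub> v) w = c \<odot>\<^bsub>U\<^esub> \<phi> v w"
    and "\<And>c v w. c \<in> carrier K \<Longrightarrow> v \<in> carrier V \<Longrightarrow> w \<in> carrier W \<Longrightarrow> \<phi> v (c \<odot>\<^bsub>W\<^esub> w) = c \<odot>\<^bsub>U\<^esub> \<phi> v w"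
  shows "bilin K V W U \<phi>"
  using assms unfolding bilin_def lin_hom_def by auto

lemma bilin_precomp:
  assumes "bilin K V W U \<phi>" "f \<in> lin_hom K V' V" "g \<in> lin_hom K W' W"
  shows "bilin K V' W' U (\<lambda>v w. \<phi> (f v) (g w))"
  by (rule bilinI) (simp_all add: bilinD[OF assms(1)] lin_hom_closed[OF assms(2)]
      lin_hom_add[OF assms(2)] lin_hom_smult[OF assms(2)] lin_hom_closed[OF assms(3)]
      lin_hom_add[OF assms(3)] lin_hom_smult[OF assms(3)])

section \<open>The tensor product as a quotient algebra and its universal property\<close>

locale tensor_pair = V: k_algebra K V + W: k_algebra K W
  for K :: "'k ring" and V :: "('k, 'v) module" and W :: "('k, 'w) module"

sublocale tensor_pair \<subseteq> P: field_monoid K "V \<times>\<times> W"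
  by (intro field_monoid.intro V.K.field_axioms DirProd_monoid V.A.monoid_axioms W.A.monoid_axioms)

sublocale tensor_pair \<subseteq> FP: k_algebra K "free_pairs K V W"
  unfolding free_pairs_def by (rule P.F_algebra)

context tensor_pair begin

abbreviation "N \<equiv> tensor_null K V W"
abbreviation "FP \<equiv> free_pairs K V W"
abbreviation "VW \<equiv> tensor K V W"
abbreviation e where "e v w \<equiv> basis_elem K (v, w)"
abbreviation pure where "pure v w \<equiv> pure_tensor K V W v w"

lemma e_closed: "v \<in> carrier V \<Longrightarrow> w \<in> carrier W \<Longrightarrow> e v w \<in> carrier FP"
  unfolding free_pairs_def by (rule P.basis_closed) simp

lemma e_mult:
  "v \<in> carrier V \<Longrightarrow> w \<in> carrier W \<Longrightarrow> v' \<in> carrier V \<Longrightarrow> w' \<in> carrier W \<Longrightarrow>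
    e v w \<otimes>\<^bsub>FP\<^esub> e v' w' = e (v \<otimes>\<^bsub>V\<^esub> v') (w \<otimes>\<^bsub>W\<^esub> w')"
  unfolding free_pairs_def by (subst P.F_mult_basis) auto

lemma FP_one: "\<one>\<^bsub>FP\<^esub> = e \<one>\<^bsub>V\<^esub> \<one>\<^bsub>W\<^esub>"
  unfolding free_pairs_def by (simp add: P.F_one)

lemma FP_induct [consumes 1, case_names basis add smult]:
  assumes "f \<in> carrier FP"
    "\<And>v w. v \<in> carrier V \<Longrightarrow> w \<in> carrier W \<Longrightarrow> P (e v w)"
    "\<And>f g. f \<in> carrier FP \<Longrightarrow> g \<in> carrier FP \<Longrightarrow> P f \<Longrightarrow> P g \<Longrightarrow> P (f \<oplus>\<^bsub>FP\<^esub> g)"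
    "\<And>c f. c \<in> carrier K \<Longrightarrow> f \<in> carrier FP \<Longrightarrow> P f \<Longrightarrow> P (c \<odot>\<^bsub>FP\<^esub> f)"
  shows "P f"
  using assms(1) unfolding free_pairs_def
  by (induction rule: P.F_induct) (use assms(2-4) in \<open>auto simp: free_pairs_def\<close>)

lemma rels_cases [consumes 1, case_names add_left add_right smult_left smult_right]:
  assumes "r \<in> tensor_rels K V W"
  obtains v v' w where "v \<in> carrier V" "v' \<in> carrier V" "w \<in> carrier W"
      "r = e (v \<oplus>\<^bsub>V\<^esub> v') w \<ominus>\<^bsub>FP\<^esub> (e v w \<oplus>\<^bsub>FP\<^esub> e v' w)"
  | v w w' where "v \<in> carrier V" "w \<in> carrier W" "w' \<in> carrier W"
      "r = e v (w \<oplus>\<^bsub>W\<^esub> w') \<ominus>\<^bsub>FP\<^esub> (e v w \<oplus>\<^bsub>FP\<^esub> e v w')"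
  | c v w where "c \<in> carrier K" "v \<in> carrier V" "w \<in> carrier W"
      "r = e (c \<odot>\<^bsub>V\<^esub> v) w \<ominus>\<^bsub>FP\<^esub> (c \<odot>\<^bsub>FP\<^esub> e v w)"
  | c v w where "c \<in> carrier K" "v \<in> carrier V" "w \<in> carrier W"
      "r = e v (c \<odot>\<^bsub>W\<^esub> w) \<ominus>\<^bsub>FP\<^esub> (c \<odot>\<^bsub>FP\<^esub> e v w)"
  using assms unfolding tensor_rels_def Let_def
proof (elim UnE CollectE exE conjE, goal_cases)
  case 1 then show ?case by (intro that(1))
next
  case 2 then show ?case by (intro that(2))
next
  case 3 then show ?case by (intro that(3))
next
  case 4 then show ?case by (intro that(4))
qed

lemma rels_intro:
  "v \<in> carrier V \<Longrightarrow> v' \<in> carrier V \<Longrightarrow> w \<in> carrier W \<Longrightarrow>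
    e (v \<oplus>\<^bsub>V\<^esub> v') w \<ominus>\<^bsub>FP\<^esub> (e v w \<oplus>\<^bsub>FP\<^esub> e v' w) \<in> tensor_rels K V W"
  "v \<in> carrier V \<Longrightarrow> w \<in> carrier W \<Longrightarrow> w' \<in> carrier W \<Longrightarrow>
    e v (w \<oplus>\<^bsub>W\<^esub> w') \<ominus>\<^bsub>FP\<^esub> (e v w \<oplus>\<^bsub>FP\<^esub> e v w') \<in> tensor_rels K V W"
  "c \<in> carrier K \<Longrightarrow> v \<in> carrier V \<Longrightarrow> w \<in> carrier W \<Longrightarrow>
    e (c \<odot>\<^bsub>V\<^esub> v) w \<ominus>\<^bsub>FP\<^esub> (c \<odot>\<^bsub>FP\<^esub> e v w) \<in> tensor_rels K V W"
  "c \<in> carrier K \<Longrightarrow> v \<in> carrier V \<Longrightarrow> w \<in> carrier W \<Longrightarrow>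
    e v (c \<odot>\<^bsub>W\<^esub> w) \<ominus>\<^bsub>FP\<^esub> (c \<odot>\<^bsub>FP\<^esub> e v w) \<in> tensor_rels K V W"
  unfolding tensor_rels_def Let_def by blast+

lemma rels_carrier: "tensor_rels K V W \<subseteq> carrier FP"
proof
  fix r assume "r \<in> tensor_rels K V W"
  then show "r \<in> carrier FP" by (cases rule: rels_cases) (auto simp: e_closed)
qed

lemma null_minimal: "submodule M K FP \<Longrightarrow> tensor_rels K V W \<subseteq> M \<Longrightarrow> N \<subseteq> M"
  unfolding tensor_null_def submod_span_def by blast

lemma rels_null: "tensor_rels K V W \<subseteq> N"
  unfolding tensor_null_def submod_span_def by blast

lemma null_submodule: "submodule N K FP"
proof -
  \<comment> \<open>The family whose intersection is the span contains the whole carrier; without a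
    member the intersection would not stay inside it.\<close>
  have c: "carrier FP \<in> {M. submodule M K FP \<and> tensor_rels K V W \<subseteq> M}"
    using FP.carrier_is_submodule rels_carrier by blast
  have E: "x \<in> N \<longleftrightarrow> (\<forall>M. submodule M K FP \<longrightarrow> tensor_rels K V W \<subseteq> M \<longrightarrow> x \<in> M)" for x
    unfolding tensor_null_def submod_span_def by auto
  show ?thesis
  proof (rule FP.submoduleI)
    show "N \<subseteq> carrier FP" using c E by blast
    show "\<zero>\<^bsub>FP\<^esub> \<in> N" unfolding E by (metis submodule_def subgroup.one_closed monoid.simps(2))
  qed (use FP.submoduleE in \<open>auto simp: E\<close>)
qed

lemma null_carrier: "x \<in> N \<Longrightarrow> x \<in> carrier FP"
  using FP.submoduleE(1)[OF null_submodule] by blast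

lemma null_kernel:
  assumes "module K U" "\<phi> \<in> lin_hom K FP U" "\<And>r. r \<in> tensor_rels K V W \<Longrightarrow> \<phi> r = \<zero>\<^bsub>U\<^esub>" "x \<in> N"
  shows "\<phi> x = \<zero>\<^bsub>U\<^esub>"
  using null_minimal[OF kernel_submodule[OF FP.module_axioms assms(1,2)]] assms(3,4) rels_carrier
  by blast

lemma FP_minus_distr:
  assumes "x \<in> carrier FP" "y \<in> carrier FP" "z \<in> carrier FP"
  shows "z \<otimes>\<^bsub>FP\<^esub> (x \<ominus>\<^bsub>FP\<^esub> y) = z \<otimes>\<^bsub>FP\<^esub> x \<ominus>\<^bsub>FP\<^esub> z \<otimes>\<^bsub>FP\<^esub> y"
    "(x \<ominus>\<^bsub>FP\<^esub> y) \<otimes>\<^bsub>FP\<^esub> z = x \<otimes>\<^bsub>FP\<^esub> z \<ominus>\<^bsub>FP\<^esub> y \<otimes>\<^bsub>FP\<^esub> z"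
  using assms by (simp_all add: a_minus_def FP.A.r_distr FP.A.l_distr FP.A.r_minus FP.A.l_minus)

text \<open>Multiplication by a pair distributes over a relation and yields a relation of the same
  kind for the multiplied vectors. This is what turns the linear span of the relations into an
  ideal.\<close>

lemma rels_e_mult:
  assumes "v0 \<in> carrier V" "w0 \<in> carrier W" "r \<in> tensor_rels K V W"
  shows "e v0 w0 \<otimes>\<^bsub>FP\<^esub> r \<in> tensor_rels K V W" and "r \<otimes>\<^bsub>FP\<^esub> e v0 w0 \<in> tensor_rels K V W"
proof -
  note s = FP_minus_distr e_closed FP.A.r_distr FP.A.l_distr FP.smult_mult_left FP.smult_mult_right
    V.A.r_distr V.A.l_distr V.smult_mult_left V.smult_mult_right
    W.A.r_distr W.A.l_distr W.smult_mult_left W.smult_mult_right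
  have "e v0 w0 \<otimes>\<^bsub>FP\<^esub> r \<in> tensor_rels K V W \<and> r \<otimes>\<^bsub>FP\<^esub> e v0 w0 \<in> tensor_rels K V W"
    using assms(3)
  proof (cases rule: rels_cases)
    case (add_left v v' w)
    then show ?thesis using assms(1,2) by (auto simp: s e_mult intro!: rels_intro)
  next
    case (add_right v w w')
    then show ?thesis using assms(1,2) by (auto simp: s e_mult intro!: rels_intro)
  next
    case (smult_left c v w)
    then show ?thesis using assms(1,2) by (auto simp: s e_mult intro!: rels_intro)
  next
    case (smult_right c v w)
    then show ?thesis using assms(1,2) by (auto simp: s e_mult intro!: rels_intro)
  qed
  then show "e v0 w0 \<otimes>\<^bsub>FP\<^esub> r \<in> tensor_rels K V W" "r \<otimes>\<^bsub>FP\<^esub> e v0 w0 \<in> tensor_rels K V W" by auto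
qed

lemma null_ideal: "ideal N FP"
proof (rule idealI)
  show "ring FP" by (rule FP.A.ring_axioms)
  show "subgroup N (add_monoid FP)" using null_submodule by (rule submodule.axioms(1))
  note N = FP.submoduleE[OF null_submodule]
  have basis: "e v w \<otimes>\<^bsub>FP\<^esub> a \<in> N \<and> a \<otimes>\<^bsub>FP\<^esub> e v w \<in> N"
    if a: "a \<in> N" and vw: "v \<in> carrier V" "w \<in> carrier W" for a v w
  proof -
    \<comment> \<open>The elements sent into \<open>N\<close> by multiplication with
      \<open>e v w\<close> from both sides form a submodule containing the relations, hence
      containing their span \<open>N\<close>.\<close>
    let ?M = "{x \<in> carrier FP. e v w \<otimes>\<^bsub>FP\<^esub> x \<in> N \<and> x \<otimes>\<^bsub>FP\<^esub> e v w \<in> N}"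
    have Z: "\<zero>\<^bsub>FP\<^esub> \<in> N" using null_submodule by (metis submodule_def subgroup.one_closed monoid.simps(2))
    have "submodule ?M K FP"
      using e_closed[OF vw] N Z
      by (intro FP.submoduleI) (auto simp: FP.A.l_distr FP.A.r_distr FP.A.r_minus FP.A.l_minus
          FP.smult_mult_left FP.smult_mult_right)
    then have "N \<subseteq> ?M"
      using rels_e_mult[OF vw] rels_null rels_carrier by (intro null_minimal) auto
    then show ?thesis using a by blast
  qed
  \<comment> \<open>Pairs span the free module, so the closure passes from \<open>e v w\<close> to
    an arbitrary factor by linearity.\<close>
  have both: "x \<otimes>\<^bsub>FP\<^esub> a \<in> N \<and> a \<otimes>\<^bsub>FP\<^esub> x \<in> N" if "a \<in> N" "x \<in> carrier FP" for a x
    using that(2)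
  proof (induction rule: FP_induct)
    case (basis v w)
    then show ?case using basis that(1) \<open>\<And>w v a. a \<in> N \<Longrightarrow> v \<in> carrier V \<Longrightarrow> w \<in> carrier W \<Longrightarrow> e v w \<otimes>\<^bsub>FP\<^esub> a \<in> N \<and> a \<otimes>\<^bsub>FP\<^esub> e v w \<in> N\<close> by blast
  qed (use N null_carrier[OF that(1)] in \<open>auto simp: FP.A.l_distr FP.A.r_distr FP.smult_mult_left FP.smult_mult_right\<close>)
  show "x \<otimes>\<^bsub>FP\<^esub> a \<in> N" "a \<otimes>\<^bsub>FP\<^esub> x \<in> N" if "a \<in> N" "x \<in> carrier FP" for a x
    using both[OF that] by auto
qed

end

sublocale tensor_pair \<subseteq> Q: algebra_ideal K "free_pairs K V W" "tensor_null K V W"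
  by (intro algebra_ideal.intro FP.k_algebra_axioms null_ideal)

context tensor_pair begin

lemma tensor_algebra: "k_algebra K VW"
  unfolding tensor_def by (rule Q.Q_algebra)

lemma pure_closed: "v \<in> carrier V \<Longrightarrow> w \<in> carrier W \<Longrightarrow> pure v w \<in> carrier VW"
  unfolding pure_tensor_def tensor_def by (simp add: Q.Q_carrier e_closed)

lemma null_coset_eq:
  "x \<in> carrier FP \<Longrightarrow> y \<in> carrier FP \<Longrightarrow> x \<ominus>\<^bsub>FP\<^esub> y \<in> tensor_rels K V W \<Longrightarrow> N +>\<^bsub>FP\<^esub> x = N +>\<^bsub>FP\<^esub> y"
  using rels_null by (intro Q.coset_eq) auto

text \<open>Each bilinearity law is one of the four families of relations, read modulo
  \<open>N\<close>.\<close>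

lemma pure_bilin: "bilin K V W VW pure"
proof (rule bilinI, goal_cases)
  case (1 v w)
  then show ?case by (rule pure_closed)
next
  case (2 v v' w)
  then have "N +>\<^bsub>FP\<^esub> e (v \<oplus>\<^bsub>V\<^esub> v') w = N +>\<^bsub>FP\<^esub> (e v w \<oplus>\<^bsub>FP\<^esub> e v' w)"
    by (intro null_coset_eq) (simp_all add: e_closed rels_intro)
  then show ?case
    unfolding pure_tensor_def tensor_def using 2 by (simp add: Q.Q_simps Q.Q_smult e_closed)
next
  case (3 v w w')
  then have "N +>\<^bsub>FP\<^esub> e v (w \<oplus>\<^bsub>W\<^esub> w') = N +>\<^bsub>FP\<^esub> (e v w \<oplus>\<^bsub>FP\<^esub> e v w')"
    by (intro null_coset_eq) (simp_all add: e_closed rels_intro)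
  then show ?case
    unfolding pure_tensor_def tensor_def using 3 by (simp add: Q.Q_simps Q.Q_smult e_closed)
next
  case (4 c v w)
  then have "N +>\<^bsub>FP\<^esub> e (c \<odot>\<^bsub>V\<^esub> v) w = N +>\<^bsub>FP\<^esub> (c \<odot>\<^bsub>FP\<^esub> e v w)"
    by (intro null_coset_eq) (simp_all add: e_closed rels_intro)
  then show ?case
    unfolding pure_tensor_def tensor_def using 4 by (simp add: Q.Q_simps Q.Q_smult e_closed)
next
  case (5 c v w)
  then have "N +>\<^bsub>FP\<^esub> e v (c \<odot>\<^bsub>W\<^esub> w) = N +>\<^bsub>FP\<^esub> (c \<odot>\<^bsub>FP\<^esub> e v w)"
    by (intro null_coset_eq) (simp_all add: e_closed rels_intro)
  then show ?case
    unfolding pure_tensor_def tensor_def using 5 by (simp add: Q.Q_simps Q.Q_smult e_closed)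
qed

lemma pure_mult:
  "v \<in> carrier V \<Longrightarrow> w \<in> carrier W \<Longrightarrow> v' \<in> carrier V \<Longrightarrow> w' \<in> carrier W \<Longrightarrow>
    pure v w \<otimes>\<^bsub>VW\<^esub> pure v' w' = pure (v \<otimes>\<^bsub>V\<^esub> v') (w \<otimes>\<^bsub>W\<^esub> w')"
  unfolding pure_tensor_def tensor_def by (simp add: Q.Q_simps e_closed e_mult)

lemma pure_one: "\<one>\<^bsub>VW\<^esub> = pure \<one>\<^bsub>V\<^esub> \<one>\<^bsub>W\<^esub>"
  unfolding pure_tensor_def tensor_def by (simp add: Q.Q_simps FP_one)

lemma tensor_induct [consumes 1, case_names pure add smult]:
  assumes "x \<in> carrier VW"
    "\<And>v w. v \<in> carrier V \<Longrightarrow> w \<in> carrier W \<Longrightarrow> P (pure v w)"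
    "\<And>x y. x \<in> carrier VW \<Longrightarrow> y \<in> carrier VW \<Longrightarrow> P x \<Longrightarrow> P y \<Longrightarrow> P (x \<oplus>\<^bsub>VW\<^esub> y)"
    "\<And>c x. c \<in> carrier K \<Longrightarrow> x \<in> carrier VW \<Longrightarrow> P x \<Longrightarrow> P (c \<odot>\<^bsub>VW\<^esub> x)"
  shows "P x"
proof -
  obtain f where f: "f \<in> carrier FP" "x = N +>\<^bsub>FP\<^esub> f"
    using assms(1) by (auto simp: tensor_def Q.Q_carrier)
  note hom = alg_hom_lin[OF Q.coset_hom, folded tensor_def]
  have "P (N +>\<^bsub>FP\<^esub> f)" using f(1)
  proof (induction rule: FP_induct)
    case (basis v w)
    then show ?case using assms(2) by (simp add: pure_tensor_def)
  next
    case (add f g)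
    then show ?case using assms(3) lin_hom_closed[OF hom] by (simp add: lin_hom_add[OF hom])
  next
    case (smult c f)
    then show ?case using assms(4) lin_hom_closed[OF hom] by (simp add: lin_hom_smult[OF hom])
  qed
  then show ?thesis using f by simp
qed

lemma tensor_lin_eqI:
  assumes "f \<in> lin_hom K VW U" "g \<in> lin_hom K VW U"
    "\<And>v w. v \<in> carrier V \<Longrightarrow> w \<in> carrier W \<Longrightarrow> f (pure v w) = g (pure v w)" "x \<in> carrier VW"
  shows "f x = g x"
  using assms(4)
  by (induction rule: tensor_induct) (simp_all add: assms(3) lin_hom_add[OF assms(1)]
    lin_hom_add[OF assms(2)] lin_hom_smult[OF assms(1)] lin_hom_smult[OF assms(2)])

lemma tensor_lift_quot_lift:
  "tensor_lift K U \<phi> = quot_lift (lin_ext K U (\<lambda>p. \<phi> (fst p) (snd p)))"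
  by (rule ext) (simp add: tensor_lift_def quot_lift_def lin_ext_def Let_def)

text \<open>The bilinearity laws of \<open>\<phi>\<close> say that its linear extension kills the
  four families of relations; the kernel is a submodule and so contains their span.\<close>

lemma lin_ext_null:
  assumes "module K U" "bilin K V W U \<phi>"
  shows "lin_ext K U (\<lambda>p. \<phi> (fst p) (snd p)) \<in> lin_hom K FP U"
    "v \<in> carrier V \<Longrightarrow> w \<in> carrier W \<Longrightarrow> lin_ext K U (\<lambda>p. \<phi> (fst p) (snd p)) (e v w) = \<phi> v w"
    "x \<in> N \<Longrightarrow> lin_ext K U (\<lambda>p. \<phi> (fst p) (snd p)) x = \<zero>\<^bsub>U\<^esub>"
proof -
  interpret U: module K U by fact
  let ?L = "lin_ext K U (\<lambda>p. \<phi> (fst p) (snd p))"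
  have f: "(\<lambda>p. \<phi> (fst p) (snd p)) \<in> carrier (V \<times>\<times> W) \<rightarrow> carrier U"
    using bilinD(1)[OF assms(2)] by auto
  show lin: "?L \<in> lin_hom K FP U"
    unfolding free_pairs_def by (rule P.lin_ext_lin[OF assms(1) f])
  have e: "?L (e v w) = \<phi> v w" if "v \<in> carrier V" "w \<in> carrier W" for v w
    using P.lin_ext_basis[OF assms(1) f, of "(v, w)"] that by simp
  show "v \<in> carrier V \<Longrightarrow> w \<in> carrier W \<Longrightarrow> ?L (e v w) = \<phi> v w" by (rule e)
  have "?L r = \<zero>\<^bsub>U\<^esub>" if "r \<in> tensor_rels K V W" for r
  proof -
    note m = lin_hom_minus[OF FP.module_axioms assms(1) lin]
    note s = m lin_hom_add[OF lin] lin_hom_smult[OF lin] e e_closed bilinD[OF assms(2)] U.M.r_neg a_minus_def[of U]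
    show ?thesis using that
      by (cases rule: rels_cases) (simp_all add: s)
  qed
  then show "x \<in> N \<Longrightarrow> ?L x = \<zero>\<^bsub>U\<^esub>" by (rule null_kernel[OF assms(1) lin])
qed

lemma tensor_lift_lin:
  assumes "module K U" "bilin K V W U \<phi>"
  shows "tensor_lift K U \<phi> \<in> lin_hom K VW U"
  unfolding tensor_lift_quot_lift tensor_def
  by (intro Q.quot_lift_lin assms lin_ext_null)

lemma tensor_lift_pure:
  assumes "module K U" "bilin K V W U \<phi>" "v \<in> carrier V" "w \<in> carrier W"
  shows "tensor_lift K U \<phi> (pure v w) = \<phi> v w"
proof -
  have "tensor_lift K U \<phi> (pure v w) = lin_ext K U (\<lambda>p. \<phi> (fst p) (snd p)) (e v w)"
    unfolding tensor_lift_quot_lift pure_tensor_def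
    by (rule Q.quot_lift_coset[OF assms(1) lin_ext_null(1)[OF assms(1,2)]
        lin_ext_null(3)[OF assms(1,2)] e_closed[OF assms(3,4)]])
  then show ?thesis using lin_ext_null(2)[OF assms] by simp
qed

text \<open>Both sides of multiplicativity are bilinear and pure tensors span, so a condition on
  pure tensors is enough.\<close>

lemma tensor_lin_mult:
  assumes "k_algebra K U" "f \<in> lin_hom K VW U" "f \<one>\<^bsub>VW\<^esub> = \<one>\<^bsub>U\<^esub>"
    "\<And>v w v' w'. v \<in> carrier V \<Longrightarrow> w \<in> carrier W \<Longrightarrow> v' \<in> carrier V \<Longrightarrow> w' \<in> carrier W \<Longrightarrow>
      f (pure (v \<otimes>\<^bsub>V\<^esub> v') (w \<otimes>\<^bsub>W\<^esub> w')) = f (pure v w) \<otimes>\<^bsub>U\<^esub> f (pure v' w')"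
  shows "f \<in> alg_hom K VW U"
proof (rule alg_homI[OF assms(2,3)])
  interpret U: k_algebra K U by fact
  interpret T: k_algebra K VW by (rule tensor_algebra)
  note s = lin_hom_add[OF assms(2)] lin_hom_smult[OF assms(2)] lin_hom_closed[OF assms(2)] pure_closed
    T.A.l_distr T.A.r_distr T.smult_mult_left T.smult_mult_right
    U.A.l_distr U.A.r_distr U.smult_mult_left U.smult_mult_right
  show "f (x \<otimes>\<^bsub>VW\<^esub> y) = f x \<otimes>\<^bsub>U\<^esub> f y" if "x \<in> carrier VW" "y \<in> carrier VW" for x y
    using that
  proof (induction x rule: tensor_induct)
    case (pure v w)
    show ?case using pure(3,1,2)
      by (induction y rule: tensor_induct) (simp_all add: s pure_mult assms(4))
  qed (simp_all add: s)
qed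

lemma tensor_lift_alg:
  assumes "k_algebra K U" "bilin K V W U \<phi>" "\<phi> \<one>\<^bsub>V\<^esub> \<one>\<^bsub>W\<^esub> = \<one>\<^bsub>U\<^esub>"
    "\<And>v w v' w'. v \<in> carrier V \<Longrightarrow> w \<in> carrier W \<Longrightarrow> v' \<in> carrier V \<Longrightarrow> w' \<in> carrier W \<Longrightarrow>
      \<phi> (v \<otimes>\<^bsub>V\<^esub> v') (w \<otimes>\<^bsub>W\<^esub> w') = \<phi> v w \<otimes>\<^bsub>U\<^esub> \<phi> v' w'"
  shows "tensor_lift K U \<phi> \<in> alg_hom K VW U"
  using k_algebra_module[OF assms(1)] assms
  by (intro tensor_lin_mult tensor_lift_lin) (simp_all add: tensor_lift_pure pure_one)

text \<open>\<open>\<phi>\<close> and \<open>\<psi>\<close> agree on the carriers only, so the two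
  lifts are compared as linear maps on pure tensors and not by rewriting under the lift.\<close>

lemma tensor_lift_cong:
  assumes "module K U" "bilin K V W U \<phi>"
    "\<And>v w. v \<in> carrier V \<Longrightarrow> w \<in> carrier W \<Longrightarrow> \<phi> v w = \<psi> v w" "x \<in> carrier VW"
  shows "tensor_lift K U \<phi> x = tensor_lift K U \<psi> x"
proof -
  have b: "bilin K V W U \<psi>"
    using assms(2) by (intro bilinI) (simp_all add: bilinD[OF assms(2)] assms(3)[symmetric])
  show ?thesis
    by (rule tensor_lin_eqI[OF tensor_lift_lin[OF assms(1,2)] tensor_lift_lin[OF assms(1) b] _ assms(4)])
      (simp add: tensor_lift_pure assms b)
qed

end

lemma tensor_pairI: "k_algebra K V \<Longrightarrow> k_algebra K W \<Longrightarrow> tensor_pair K V W"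
  by (simp add: tensor_pair_def)

section \<open>Functoriality of the tensor product\<close>

locale tensor_map_pair = S: tensor_pair K V W + T: tensor_pair K V' W'
  for K :: "'k ring" and V :: "('k, 'v) module" and W :: "('k, 'w) module"
    and V' :: "('k, 'v2) module" and W' :: "('k, 'w2) module" +
  fixes f g
  assumes f_lin: "f \<in> lin_hom K V V'" and g_lin: "g \<in> lin_hom K W W'"
begin

lemma map_bilin: "bilin K V W (tensor K V' W') (\<lambda>v w. pure_tensor K V' W' (f v) (g w))"
  by (rule bilin_precomp[OF T.pure_bilin f_lin g_lin])

lemma map_lin: "tensor_map K V' W' f g \<in> lin_hom K (tensor K V W) (tensor K V' W')"
  unfolding tensor_map_def
  by (rule S.tensor_lift_lin[OF k_algebra_module[OF T.tensor_algebra] map_bilin])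

lemma map_pure:
  "v \<in> carrier V \<Longrightarrow> w \<in> carrier W \<Longrightarrow>
    tensor_map K V' W' f g (pure_tensor K V W v w) = pure_tensor K V' W' (f v) (g w)"
  unfolding tensor_map_def
  by (rule S.tensor_lift_pure[OF k_algebra_module[OF T.tensor_algebra] map_bilin])

lemma map_alg:
  assumes "f \<in> alg_hom K V V'" "g \<in> alg_hom K W W'"
  shows "tensor_map K V' W' f g \<in> alg_hom K (tensor K V W) (tensor K V' W')"
  unfolding tensor_map_def
  by (rule S.tensor_lift_alg[OF T.tensor_algebra map_bilin])
    (simp_all add: alg_hom_one[OF assms(1)] alg_hom_one[OF assms(2)] T.pure_one T.pure_mult
      alg_hom_mult[OF assms(1)] alg_hom_mult[OF assms(2)] lin_hom_closed[OF f_lin] lin_hom_closed[OF g_lin])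

lemma lift_map:
  assumes "module K U" "bilin K V' W' U \<phi>" "x \<in> carrier (tensor K V W)"
  shows "tensor_lift K U \<phi> (tensor_map K V' W' f g x) = tensor_lift K U (\<lambda>v w. \<phi> (f v) (g w)) x"
  by (rule S.tensor_lin_eqI[OF lin_hom_comp[OF map_lin T.tensor_lift_lin[OF assms(1,2)]]
      S.tensor_lift_lin[OF assms(1) bilin_precomp[OF assms(2) f_lin g_lin]] _ assms(3)])
    (simp add: map_pure T.tensor_lift_pure[OF assms(1,2)] lin_hom_closed[OF f_lin] lin_hom_closed[OF g_lin]
      S.tensor_lift_pure[OF assms(1) bilin_precomp[OF assms(2) f_lin g_lin]])

lemma map_map:
  assumes "tensor_map_pair K V' W' V2 W2 f' g'" "x \<in> carrier (tensor K V W)"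
  shows "tensor_map K V2 W2 f' g' (tensor_map K V' W' f g x)
    = tensor_map K V2 W2 (\<lambda>v. f' (f v)) (\<lambda>w. g' (g w)) x"
proof -
  interpret M: tensor_map_pair K V' W' V2 W2 f' g' by fact
  show ?thesis unfolding tensor_map_def[of K V2]
    by (rule lift_map[OF k_algebra_module[OF M.T.tensor_algebra] M.map_bilin assms(2)])
qed

end

lemma tensor_map_pairI:
  assumes "k_algebra K V" "k_algebra K W" "k_algebra K V'" "k_algebra K W'"
    "f \<in> lin_hom K V V'" "g \<in> lin_hom K W W'"
  shows "tensor_map_pair K V W V' W' f g"
  using assms by (simp add: tensor_map_pair_def tensor_map_pair_axioms_def tensor_pair_def)

lemma tensor_map_id:
  assumes "k_algebra K V" "k_algebra K W" "x \<in> carrier (tensor K V W)"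
    "\<And>v. v \<in> carrier V \<Longrightarrow> f v = v" "\<And>w. w \<in> carrier W \<Longrightarrow> g w = w"
  shows "tensor_map K V W f g x = x"
proof -
  interpret V: k_algebra K V by fact
  interpret W: k_algebra K W by fact
  interpret M: tensor_map_pair K V W V W f g
    using assms by (intro tensor_map_pairI) (auto intro!: lin_homI)
  show ?thesis
    by (rule M.S.tensor_lin_eqI[OF M.map_lin lin_hom_id _ assms(3)]) (simp add: M.map_pure assms)
qed

section \<open>Associativity of the tensor product\<close>

locale tensor_triple = U: k_algebra K U + V: k_algebra K V + W: k_algebra K W
  for K :: "'k ring" and U :: "('k, 'u) module" and V :: "('k, 'v) module" and W :: "('k, 'w) module"

sublocale tensor_triple \<subseteq> UV: tensor_pair K U V by (intro tensor_pairI U.k_algebra_axioms V.k_algebra_axioms)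
sublocale tensor_triple \<subseteq> VW: tensor_pair K V W by (intro tensor_pairI V.k_algebra_axioms W.k_algebra_axioms)
sublocale tensor_triple \<subseteq> UV_W: tensor_pair K "tensor K U V" W
  by (intro tensor_pairI UV.tensor_algebra W.k_algebra_axioms)
sublocale tensor_triple \<subseteq> U_VW: tensor_pair K U "tensor K V W"
  by (intro tensor_pairI U.k_algebra_axioms VW.tensor_algebra)

context tensor_triple begin

lemma assoc_inner_bilin:
  assumes "u \<in> carrier U"
  shows "bilin K V W (tensor K (tensor K U V) W)
    (\<lambda>v w. pure_tensor K (tensor K U V) W (pure_tensor K U V u v) w)"
proof -
  have "pure_tensor K U V u \<in> lin_hom K V (tensor K U V)"
    using UV.pure_bilin assms by (simp add: bilin_def)
  from bilin_precomp[OF UV_W.pure_bilin this lin_hom_id] show ?thesis .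
qed

lemma T_module: "module K (tensor K (tensor K U V) W)"
  by (rule k_algebra_module[OF UV_W.tensor_algebra])

text \<open>The associator is a lift whose value at \<open>u\<close> is itself a lift in the other
  two arguments. Linearity of that inner lift in \<open>u\<close> is an equality of linear maps in
  \<open>x\<close>, hence checked on pure tensors.\<close>

lemma assoc_outer_bilin:
  "bilin K U (tensor K V W) (tensor K (tensor K U V) W)
    (\<lambda>u. tensor_lift K (tensor K (tensor K U V) W) (\<lambda>v w.
         pure_tensor K (tensor K U V) W (pure_tensor K U V u v) w))"
proof -
  interpret T: module K "tensor K (tensor K U V) W" by (rule T_module)
  let ?\<phi> = "\<lambda>u. \<lambda>v w. pure_tensor K (tensor K U V) W (pure_tensor K U V u v) w"
  let ?L = "\<lambda>u. tensor_lift K (tensor K (tensor K U V) W) (?\<phi> u)"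
  have lin: "?L u \<in> lin_hom K (tensor K V W) (tensor K (tensor K U V) W)" if "u \<in> carrier U" for u
    by (rule VW.tensor_lift_lin[OF T_module assoc_inner_bilin[OF that]])
  have p: "?L u (pure_tensor K V W v w) = ?\<phi> u v w"
    if "u \<in> carrier U" "v \<in> carrier V" "w \<in> carrier W" for u v w
    by (rule VW.tensor_lift_pure[OF T_module assoc_inner_bilin[OF that(1)] that(2,3)])
  have add: "?L (u \<oplus>\<^bsub>U\<^esub> u') x = ?L u x \<oplus>\<^bsub>tensor K (tensor K U V) W\<^esub> ?L u' x"
    if u: "u \<in> carrier U" "u' \<in> carrier U" and x: "x \<in> carrier (tensor K V W)" for u u' x
  proof (rule VW.tensor_lin_eqI[OF lin _ _ x])
    show "(\<lambda>x. ?L u x \<oplus>\<^bsub>tensor K (tensor K U V) W\<^esub> ?L u' x)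
        \<in> lin_hom K (tensor K V W) (tensor K (tensor K U V) W)"
      using lin_hom_closed[OF lin[OF u(1)]] lin_hom_closed[OF lin[OF u(2)]]
      by (intro lin_homI) (simp_all add: lin_hom_add[OF lin] lin_hom_smult[OF lin] u
         T.smult_r_distr T.M.a_ac)
  qed (use u in \<open>simp_all add: p bilinD[OF UV.pure_bilin] bilinD[OF UV_W.pure_bilin]\<close>)
  have smult: "?L (c \<odot>\<^bsub>U\<^esub> u) x = c \<odot>\<^bsub>tensor K (tensor K U V) W\<^esub> ?L u x"
    if u: "c \<in> carrier K" "u \<in> carrier U" and x: "x \<in> carrier (tensor K V W)" for u c x
  proof (rule VW.tensor_lin_eqI[OF lin _ _ x])
    show "(\<lambda>x. c \<odot>\<^bsub>tensor K (tensor K U V) W\<^esub> ?L u x)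
        \<in> lin_hom K (tensor K V W) (tensor K (tensor K U V) W)"
      using lin_hom_closed[OF lin[OF u(2)]]
      by (intro lin_homI) (simp_all add: lin_hom_add[OF lin] lin_hom_smult[OF lin] u
         T.smult_r_distr T.smult_assoc1[symmetric] U.K.m_comm)
  qed (use u in \<open>simp_all add: p bilinD[OF UV.pure_bilin] bilinD[OF UV_W.pure_bilin]\<close>)
  show ?thesis
    by (rule bilinI) (simp_all add: add smult lin_hom_closed[OF lin] lin_hom_add[OF lin] lin_hom_smult[OF lin])
qed

lemma assoc_lin:
  "tensor_assoc K U V W \<in> lin_hom K (tensor K U (tensor K V W)) (tensor K (tensor K U V) W)"
  unfolding tensor_assoc_def by (rule U_VW.tensor_lift_lin[OF T_module assoc_outer_bilin])

lemma assoc_pure: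
  assumes "u \<in> carrier U" "v \<in> carrier V" "w \<in> carrier W"
  shows "tensor_assoc K U V W (pure_tensor K U (tensor K V W) u (pure_tensor K V W v w))
    = pure_tensor K (tensor K U V) W (pure_tensor K U V u v) w"
  unfolding tensor_assoc_def
  using assms by (simp add: U_VW.tensor_lift_pure[OF T_module assoc_outer_bilin] VW.pure_closed
    VW.tensor_lift_pure[OF T_module assoc_inner_bilin])

text \<open>Pure tensors are used twice: for fixed \<open>u\<close> both maps are linear in the
  inner tensor, which may then be taken pure as well.\<close>

lemma triple_lin_eqI:
  assumes "f \<in> lin_hom K (tensor K U (tensor K V W)) Z" "g \<in> lin_hom K (tensor K U (tensor K V W)) Z"
    "\<And>u v w. u \<in> carrier U \<Longrightarrow> v \<in> carrier V \<Longrightarrow> w \<in> carrier W \<Longrightarrow>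
      f (pure_tensor K U (tensor K V W) u (pure_tensor K V W v w)) =
      g (pure_tensor K U (tensor K V W) u (pure_tensor K V W v w))"
    "x \<in> carrier (tensor K U (tensor K V W))"
  shows "f x = g x"
proof (rule U_VW.tensor_lin_eqI[OF assms(1,2) _ assms(4)])
  fix u y assume u: "u \<in> carrier U" and y: "y \<in> carrier (tensor K V W)"
  have p: "pure_tensor K U (tensor K V W) u \<in> lin_hom K (tensor K V W) (tensor K U (tensor K V W))"
    using U_VW.pure_bilin u by (simp add: bilin_def)
  show "f (pure_tensor K U (tensor K V W) u y) = g (pure_tensor K U (tensor K V W) u y)"
    by (rule VW.tensor_lin_eqI[OF lin_hom_comp[OF p assms(1)] lin_hom_comp[OF p assms(2)] _ y])
      (simp add: assms(3) u)
qed

end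

section \<open>Tensor algebra and symmetric algebra\<close>

text \<open>The value on words that \<open>tensor_alg_lift\<close> extends linearly, in the same
  \<open>foldr\<close> form.\<close>

definition wprod :: "('k, 'a) module \<Rightarrow> ('v \<Rightarrow> 'a) \<Rightarrow> 'v list \<Rightarrow> 'a" where
  "wprod A f w = foldr (\<lambda>v a. f v \<otimes>\<^bsub>A\<^esub> a) w \<one>\<^bsub>A\<^esub>"

lemma free_monoid_monoid: "monoid (free_monoid X)"
  by (auto simp: free_monoid_def intro!: monoidI)

locale tensor_algebra_of = V: k_algebra K V for K :: "'k ring" and V :: "('k, 'v) module"

sublocale tensor_algebra_of \<subseteq> P: field_monoid K "free_monoid (carrier V)"
  by (intro field_monoid.intro V.K.field_axioms free_monoid_monoid)

sublocale tensor_algebra_of \<subseteq> FW: k_algebra K "free_words K V"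
  unfolding free_words_def by (rule P.F_algebra)

context tensor_algebra_of begin

abbreviation "FW \<equiv> free_words K V"
abbreviation "T \<equiv> tensor_alg K V"
abbreviation "S \<equiv> sym_alg K V"
abbreviation e :: "'v list \<Rightarrow> 'v list \<Rightarrow> 'k" where "e w \<equiv> basis_elem K w"
abbreviation "X \<equiv> X_gen K V"
abbreviation "t \<equiv> t_gen K V"

abbreviation rels where "rels \<equiv>
  {e [v \<oplus>\<^bsub>V\<^esub> w] \<ominus>\<^bsub>FW\<^esub> (e [v] \<oplus>\<^bsub>FW\<^esub> e [w]) | v w. v \<in> carrier V \<and> w \<in> carrier V} \<union>
       {e [c \<odot>\<^bsub>V\<^esub> v] \<ominus>\<^bsub>FW\<^esub> (c \<odot>\<^bsub>FW\<^esub> e [v]) | c v. c \<in> carrier K \<and> v \<in> carrier V}"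

lemma e_closed: "set w \<subseteq> carrier V \<Longrightarrow> e w \<in> carrier FW"
  unfolding free_words_def by (rule P.basis_closed) (auto simp: free_monoid_def)

lemma e_mult: "set w \<subseteq> carrier V \<Longrightarrow> set w' \<subseteq> carrier V \<Longrightarrow> e w \<otimes>\<^bsub>FW\<^esub> e w' = e (w @ w')"
  unfolding free_words_def by (subst P.F_mult_basis) (auto simp: free_monoid_def)

lemma e_one: "\<one>\<^bsub>FW\<^esub> = e []"
  unfolding free_words_def by (simp add: P.F_one) (simp add: free_monoid_def)

lemma null_genideal: "tensor_alg_null K V = Idl\<^bsub>FW\<^esub> rels"
  by (simp add: tensor_alg_null_def Let_def)

lemma rels_carrier: "rels \<subseteq> carrier FW"
  by (auto simp: e_closed)

lemma null_ideal: "ideal (tensor_alg_null K V) FW"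
  unfolding null_genideal by (rule FW.A.genideal_ideal[OF rels_carrier])

end

sublocale tensor_algebra_of \<subseteq> Q: algebra_ideal K "free_words K V" "tensor_alg_null K V"
  by (intro algebra_ideal.intro FW.k_algebra_axioms null_ideal)

context tensor_algebra_of begin

lemma T_algebra: "k_algebra K T"
  unfolding tensor_alg_def by (rule Q.Q_algebra)

lemma X_lin: "X \<in> lin_hom K V T"
proof (rule lin_homI, goal_cases)
  case (1 v)
  then show ?case by (simp add: X_gen_def tensor_alg_def Q.Q_carrier e_closed)
next
  case (2 v w)
  have "e [v \<oplus>\<^bsub>V\<^esub> w] \<ominus>\<^bsub>FW\<^esub> (e [v] \<oplus>\<^bsub>FW\<^esub> e [w]) \<in> rels" using 2 by blast
  then have "tensor_alg_null K V +>\<^bsub>FW\<^esub> e [v \<oplus>\<^bsub>V\<^esub> w] = tensor_alg_null K V +>\<^bsub>FW\<^esub> (e [v] \<oplus>\<^bsub>FW\<^esub> e [w])"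
    using 2 FW.A.genideal_self[OF rels_carrier, folded null_genideal]
    by (intro Q.coset_eq) (auto simp: e_closed)
  then show ?case using 2 by (simp add: X_gen_def tensor_alg_def Q.Q_simps e_closed)
next
  case (3 c v)
  have "e [c \<odot>\<^bsub>V\<^esub> v] \<ominus>\<^bsub>FW\<^esub> (c \<odot>\<^bsub>FW\<^esub> e [v]) \<in> rels" using 3 by blast
  then have "tensor_alg_null K V +>\<^bsub>FW\<^esub> e [c \<odot>\<^bsub>V\<^esub> v] = tensor_alg_null K V +>\<^bsub>FW\<^esub> (c \<odot>\<^bsub>FW\<^esub> e [v])"
    using 3 FW.A.genideal_self[OF rels_carrier, folded null_genideal]
    by (intro Q.coset_eq) (auto simp: e_closed)
  then show ?case using 3 by (simp add: X_gen_def tensor_alg_def Q.Q_smult e_closed)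
qed

text \<open>Words are built letter by letter from the left, so left multiplication by a generator
  reaches every monomial from the unit.\<close>

lemma T_induct [consumes 1, case_names one mult add smult]:
  assumes "x \<in> carrier T"
    "P \<one>\<^bsub>T\<^esub>"
    "\<And>v x. v \<in> carrier V \<Longrightarrow> x \<in> carrier T \<Longrightarrow> P x \<Longrightarrow> P (X v \<otimes>\<^bsub>T\<^esub> x)"
    "\<And>x y. x \<in> carrier T \<Longrightarrow> y \<in> carrier T \<Longrightarrow> P x \<Longrightarrow> P y \<Longrightarrow> P (x \<oplus>\<^bsub>T\<^esub> y)"
    "\<And>c x. c \<in> carrier K \<Longrightarrow> x \<in> carrier T \<Longrightarrow> P x \<Longrightarrow> P (c \<odot>\<^bsub>T\<^esub> x)"
  shows "P x"
proof -
  note alg = Q.coset_hom[folded tensor_alg_def]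
  note hom = alg_hom_lin[OF alg]
  obtain f where f: "f \<in> carrier FW" "x = tensor_alg_null K V +>\<^bsub>FW\<^esub> f"
    using assms(1) by (auto simp: tensor_alg_def Q.Q_carrier)
  have word: "P (tensor_alg_null K V +>\<^bsub>FW\<^esub> e w)" if "set w \<subseteq> carrier V" for w
    using that
  proof (induction w)
    case Nil
    then show ?case using assms(2) alg_hom_one[OF alg] by (simp add: e_one)
  next
    case (Cons v w)
    have "tensor_alg_null K V +>\<^bsub>FW\<^esub> e (v # w) = X v \<otimes>\<^bsub>T\<^esub> (tensor_alg_null K V +>\<^bsub>FW\<^esub> e w)"
      using Cons.prems alg_hom_mult[OF alg, of "e [v]" "e w"]
      by (simp add: X_gen_def e_closed e_mult)
    then show ?case using Cons assms(3) lin_hom_closed[OF hom] by (simp add: e_closed)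
  qed
  have "P (tensor_alg_null K V +>\<^bsub>FW\<^esub> f)" using f(1)[unfolded free_words_def]
  proof (induction rule: P.F_induct)
    case (basis w)
    then show ?case using word by (auto simp: free_monoid_def)
  next
    case (add f g)
    note add = add[folded free_words_def]
    then show ?case using assms(4) lin_hom_closed[OF hom]
      unfolding free_words_def[symmetric] by (simp add: lin_hom_add[OF hom])
  next
    case (smult c f)
    note smult = smult[folded free_words_def]
    then show ?case using assms(5) lin_hom_closed[OF hom]
      unfolding free_words_def[symmetric] by (simp add: lin_hom_smult[OF hom])
  qed
  then show ?thesis using f by simp
qed

lemma T_alg_eqI:
  assumes "f \<in> alg_hom K T A" "g \<in> alg_hom K T A" "\<And>v. v \<in> carrier V \<Longrightarrow> f (X v) = g (X v)" "x \<in> carrier T"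
  shows "f x = g x"
  using assms(4)
proof (induction rule: T_induct)
  case (mult v x)
  then show ?case using lin_hom_closed[OF X_lin] assms(3)
    by (simp add: alg_hom_mult[OF assms(1)] alg_hom_mult[OF assms(2)])
qed (simp_all add: alg_hom_one[OF assms(1)] alg_hom_one[OF assms(2)]
    lin_hom_add[OF alg_hom_lin[OF assms(1)]] lin_hom_add[OF alg_hom_lin[OF assms(2)]]
    lin_hom_smult[OF alg_hom_lin[OF assms(1)]] lin_hom_smult[OF alg_hom_lin[OF assms(2)]])

lemma tensor_alg_lift_quot_lift: "tensor_alg_lift K A f = quot_lift (lin_ext K A (wprod A f))"
  by (rule ext) (simp add: tensor_alg_lift_def quot_lift_def lin_ext_def wprod_def Let_def)

context
  fixes A :: "('k, 'a) module" and f
  assumes A: "k_algebra K A" and f: "f \<in> lin_hom K V A"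
begin

text \<open>Linearity of \<open>f\<close> puts the relations into the kernel. The kernel of an
  algebra morphism is an ideal, so it contains the ideal they generate.\<close>

lemma word_ext:
  shows "lin_ext K A (wprod A f) \<in> alg_hom K FW A"
    and "v \<in> carrier V \<Longrightarrow> lin_ext K A (wprod A f) (e [v]) = f v"
    and "x \<in> tensor_alg_null K V \<Longrightarrow> lin_ext K A (wprod A f) x = \<zero>\<^bsub>A\<^esub>"
proof -
  interpret A: k_algebra K A by (rule A)
  let ?L = "lin_ext K A (wprod A f)"
  have closed: "wprod A f w \<in> carrier A" if "set w \<subseteq> carrier V" for w
    using that by (induction w) (auto simp: wprod_def lin_hom_closed[OF f])
  have append: "wprod A f (w @ w') = wprod A f w \<otimes>\<^bsub>A\<^esub> wprod A f w'"
    if "set w \<subseteq> carrier V" "set w' \<subseteq> carrier V" for w w'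
    using that(1)
  proof (induction w)
    case Nil
    then show ?case using closed[OF that(2)] by (simp add: wprod_def)
  next
    case (Cons v w)
    then show ?case using closed[OF that(2)] closed[of w] lin_hom_closed[OF f, of v]
      by (simp add: wprod_def A.A.m_assoc)
  qed
  have pi: "wprod A f \<in> carrier (free_monoid (carrier V)) \<rightarrow> carrier A"
    using closed by (auto simp: free_monoid_def)
  show alg: "?L \<in> alg_hom K FW A" unfolding free_words_def
    by (rule P.lin_ext_alg[OF A pi]) (use append in \<open>auto simp: free_monoid_def wprod_def lists_eq_set\<close>)
  have v: "?L (e [v]) = f v" if "v \<in> carrier V" for v
    using P.lin_ext_basis[OF A.module_axioms pi, of "[v]"] that lin_hom_closed[OF f that]
    by (simp add: free_monoid_def wprod_def)
  show "v \<in> carrier V \<Longrightarrow> ?L (e [v]) = f v" by (rule v)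
  have zero: "?L r = \<zero>\<^bsub>A\<^esub>" if "r \<in> rels" for r
  proof -
    note lin = alg_hom_lin[OF alg]
    note m = lin_hom_minus[OF FW.module_axioms A.module_axioms lin]
    have "f x \<in> carrier A" if "x \<in> carrier V" for x using lin_hom_closed[OF f that] .
    then show ?thesis using that
      by (auto simp: m e_closed v lin_hom_add[OF lin] lin_hom_smult[OF lin] lin_hom_add[OF f]
          lin_hom_smult[OF f] a_minus_def[of A] A.M.r_neg)
  qed
  have "rels \<subseteq> {x \<in> carrier FW. ?L x = \<zero>\<^bsub>A\<^esub>}"
    by (rule subsetI, rule CollectI, rule conjI, erule rels_carrier[THEN subsetD], erule zero)
  from FW.A.genideal_minimal[OF kernel_ideal[OF FW.k_algebra_axioms A alg] this]
  show "x \<in> tensor_alg_null K V \<Longrightarrow> ?L x = \<zero>\<^bsub>A\<^esub>" unfolding null_genideal by blast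
qed

lemma T_lift_alg: "tensor_alg_lift K A f \<in> alg_hom K T A"
  unfolding tensor_alg_lift_quot_lift tensor_alg_def
  by (rule Q.quot_lift_alg[OF k_algebra_module[OF A] word_ext(1,3)])

lemma T_lift_X: "v \<in> carrier V \<Longrightarrow> tensor_alg_lift K A f (X v) = f v"
  unfolding tensor_alg_lift_quot_lift X_gen_def
  by (subst Q.quot_lift_coset[OF k_algebra_module[OF A] alg_hom_lin[OF word_ext(1)] word_ext(3)])
    (auto simp: e_closed word_ext(2))

end

section \<open>The symmetric algebra\<close>

abbreviation comms where "comms \<equiv>
  {X v \<otimes>\<^bsub>T\<^esub> X w \<ominus>\<^bsub>T\<^esub> X w \<otimes>\<^bsub>T\<^esub> X v | v w. v \<in> carrier V \<and> w \<in> carrier V}"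

lemma sym_null_genideal: "sym_alg_null K V = Idl\<^bsub>T\<^esub> comms"
  by (simp add: sym_alg_null_def Let_def)

end

sublocale tensor_algebra_of \<subseteq> TA: k_algebra K "tensor_alg K V" by (rule T_algebra)

context tensor_algebra_of begin

lemma comms_carrier: "comms \<subseteq> carrier T"
  using lin_hom_closed[OF X_lin] by auto

lemma sym_null_ideal: "ideal (sym_alg_null K V) T"
  unfolding sym_null_genideal by (rule TA.A.genideal_ideal[OF comms_carrier])

end

sublocale tensor_algebra_of \<subseteq> QS: algebra_ideal K "tensor_alg K V" "sym_alg_null K V"
  by (intro algebra_ideal.intro T_algebra sym_null_ideal)

context tensor_algebra_of begin

lemma S_algebra: "k_algebra K S"
  unfolding sym_alg_def by (rule QS.Q_algebra)

lemma t_lin: "t \<in> lin_hom K V S"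
  using lin_hom_comp[OF X_lin alg_hom_lin[OF QS.coset_hom]]
  unfolding sym_alg_def t_gen_def .

lemma t_comm:
  assumes "v \<in> carrier V" "w \<in> carrier V"
  shows "t v \<otimes>\<^bsub>S\<^esub> t w = t w \<otimes>\<^bsub>S\<^esub> t v"
proof -
  note X = lin_hom_closed[OF X_lin assms(1)] lin_hom_closed[OF X_lin assms(2)]
  have "X v \<otimes>\<^bsub>T\<^esub> X w \<ominus>\<^bsub>T\<^esub> X w \<otimes>\<^bsub>T\<^esub> X v \<in> comms" using assms by blast
  then have "X v \<otimes>\<^bsub>T\<^esub> X w \<ominus>\<^bsub>T\<^esub> X w \<otimes>\<^bsub>T\<^esub> X v \<in> sym_alg_null K V"
    using TA.A.genideal_self[OF comms_carrier, folded sym_null_genideal] by blast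
  then have "sym_alg_null K V +>\<^bsub>T\<^esub> (X v \<otimes>\<^bsub>T\<^esub> X w) = sym_alg_null K V +>\<^bsub>T\<^esub> (X w \<otimes>\<^bsub>T\<^esub> X v)"
    using X by (intro QS.coset_eq) auto
  then show ?thesis using X by (simp add: t_gen_def sym_alg_def QS.Q_simps)
qed

lemma S_induct [consumes 1, case_names one mult add smult]:
  assumes "x \<in> carrier S"
    "P \<one>\<^bsub>S\<^esub>"
    "\<And>v x. v \<in> carrier V \<Longrightarrow> x \<in> carrier S \<Longrightarrow> P x \<Longrightarrow> P (t v \<otimes>\<^bsub>S\<^esub> x)"
    "\<And>x y. x \<in> carrier S \<Longrightarrow> y \<in> carrier S \<Longrightarrow> P x \<Longrightarrow> P y \<Longrightarrow> P (x \<oplus>\<^bsub>S\<^esub> y)"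
    "\<And>c x. c \<in> carrier K \<Longrightarrow> x \<in> carrier S \<Longrightarrow> P x \<Longrightarrow> P (c \<odot>\<^bsub>S\<^esub> x)"
  shows "P x"
proof -
  note alg = QS.coset_hom[folded sym_alg_def]
  note hom = alg_hom_lin[OF alg]
  obtain y where y: "y \<in> carrier T" "x = sym_alg_null K V +>\<^bsub>T\<^esub> y"
    using assms(1) by (auto simp: sym_alg_def QS.Q_carrier)
  have "P (sym_alg_null K V +>\<^bsub>T\<^esub> y)" using y(1)
  proof (induction rule: T_induct)
    case one
    then show ?case using assms(2) alg_hom_one[OF alg] by simp
  next
    case (mult v y)
    then show ?case using assms(3) lin_hom_closed[OF hom] lin_hom_closed[OF X_lin]
      by (simp add: alg_hom_mult[OF alg] t_gen_def)
  next
    case (add x y)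
    then show ?case using assms(4) lin_hom_closed[OF hom] by (simp add: lin_hom_add[OF hom])
  next
    case (smult c x)
    then show ?case using assms(5) lin_hom_closed[OF hom] by (simp add: lin_hom_smult[OF hom])
  qed
  then show ?thesis using y by simp
qed

text \<open>Commuting images of the generators put all commutators into the kernel of the lift to
  \<open>T\<close>, which therefore descends to \<open>S\<close>. In the application the target is
  \<open>B\<close>.\<close>

lemma S_lift:
  assumes A: "k_algebra K A" and f: "f \<in> lin_hom K V A"
    and comm: "\<And>v w. v \<in> carrier V \<Longrightarrow> w \<in> carrier V \<Longrightarrow> f v \<otimes>\<^bsub>A\<^esub> f w = f w \<otimes>\<^bsub>A\<^esub> f v"
  obtains g where "g \<in> alg_hom K S A" "\<And>v. v \<in> carrier V \<Longrightarrow> g (t v) = f v"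
proof -
  interpret A: k_algebra K A by (rule A)
  let ?L = "tensor_alg_lift K A f"
  note alg = T_lift_alg[OF A f]
  note lin = alg_hom_lin[OF alg]
  have zero: "?L r = \<zero>\<^bsub>A\<^esub>" if r: "r \<in> comms" for r
  proof -
    obtain v w where vw: "v \<in> carrier V" "w \<in> carrier V"
      and r: "r = X v \<otimes>\<^bsub>T\<^esub> X w \<ominus>\<^bsub>T\<^esub> X w \<otimes>\<^bsub>T\<^esub> X v" using r by blast
    note X = lin_hom_closed[OF X_lin vw(1)] lin_hom_closed[OF X_lin vw(2)]
    have "?L r = f v \<otimes>\<^bsub>A\<^esub> f w \<ominus>\<^bsub>A\<^esub> f w \<otimes>\<^bsub>A\<^esub> f v"
      unfolding r using X vw
      by (simp add: lin_hom_minus[OF TA.module_axioms A.module_axioms lin] alg_hom_mult[OF alg] T_lift_X[OF A f])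
    then show ?thesis using lin_hom_closed[OF f] vw by (simp add: comm[OF vw] a_minus_def A.M.r_neg)
  qed
  have "comms \<subseteq> {x \<in> carrier T. ?L x = \<zero>\<^bsub>A\<^esub>}"
    by (rule subsetI, rule CollectI, rule conjI, erule comms_carrier[THEN subsetD], erule zero)
  from TA.A.genideal_minimal[OF kernel_ideal[OF T_algebra A alg] this]
  have null: "?L x = \<zero>\<^bsub>A\<^esub>" if "x \<in> sym_alg_null K V" for x using that unfolding sym_null_genideal by blast
  show thesis
  proof
    show "quot_lift ?L \<in> alg_hom K S A"
      unfolding sym_alg_def by (rule QS.quot_lift_alg[OF A.module_axioms alg null])
    show "quot_lift ?L (t v) = f v" if "v \<in> carrier V" for v
      unfolding t_gen_def
      using QS.quot_lift_coset[OF A.module_axioms lin null] lin_hom_closed[OF X_lin that] T_lift_X[OF A f that]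
      by simp
  qed
qed

end

section \<open>Separation of points by linear functionals\<close>

text \<open>A separate notion, because \<open>lin_hom\<close> expects a module record as target
  while the values here lie in the ring record \<open>K\<close>.\<close>

definition functional :: "'k ring \<Rightarrow> ('k, 'v) module \<Rightarrow> ('v \<Rightarrow> 'k) \<Rightarrow> bool" where
  "functional K V \<chi> \<longleftrightarrow> (\<forall>x\<in>carrier V. \<chi> x \<in> carrier K) \<and>
     (\<forall>x\<in>carrier V. \<forall>y\<in>carrier V. \<chi> (x \<oplus>\<^bsub>V\<^esub> y) = \<chi> x \<oplus>\<^bsub>K\<^esub> \<chi> y) \<and>
     (\<forall>c\<in>carrier K. \<forall>x\<in>carrier V. \<chi> (c \<odot>\<^bsub>V\<^esub> x) = c \<otimes>\<^bsub>K\<^esub> \<chi> x)"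

locale vector_space_K = K?: field K + V?: module K V for K :: "'k ring" and V :: "('k, 'v) module"
begin

definition adjoin where
  "adjoin M x = {m \<oplus>\<^bsub>V\<^esub> c \<odot>\<^bsub>V\<^esub> x | m c. m \<in> M \<and> c \<in> carrier K}"

lemma adjoin_submodule:
  assumes "submodule M K V" "x \<in> carrier V"
  shows "submodule (adjoin M x) K V"
proof (rule submoduleI)
  note M = submoduleE[OF assms(1)]
  have Mc: "m \<in> carrier V" if "m \<in> M" for m using M(1) that by blast
  have Z: "\<zero>\<^bsub>V\<^esub> \<in> M" using assms(1) by (metis submodule_def subgroup.one_closed monoid.simps(2))
  show "adjoin M x \<subseteq> carrier V" using Mc assms(2) by (auto simp: adjoin_def)
  have "\<zero>\<^bsub>V\<^esub> = \<zero>\<^bsub>V\<^esub> \<oplus>\<^bsub>V\<^esub> \<zero>\<^bsub>K\<^esub> \<odot>\<^bsub>V\<^esub> x" using assms(2) by simp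
  then show "\<zero>\<^bsub>V\<^esub> \<in> adjoin M x" unfolding adjoin_def using Z by blast
  show smult: "a \<odot>\<^bsub>V\<^esub> y \<in> adjoin M x" if a: "a \<in> carrier K" and y: "y \<in> adjoin M x" for a y
  proof -
    obtain m c where *: "y = m \<oplus>\<^bsub>V\<^esub> c \<odot>\<^bsub>V\<^esub> x" "m \<in> M" "c \<in> carrier K"
      using y by (auto simp: adjoin_def)
    have "a \<odot>\<^bsub>V\<^esub> y = a \<odot>\<^bsub>V\<^esub> m \<oplus>\<^bsub>V\<^esub> (a \<otimes>\<^bsub>K\<^esub> c) \<odot>\<^bsub>V\<^esub> x"
      using * a Mc assms(2) by (simp add: V.smult_r_distr smult_assoc1)
    then show ?thesis using * a M(4) unfolding adjoin_def by blast
  qed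
  show "\<ominus>\<^bsub>V\<^esub> a \<in> adjoin M x" if "a \<in> adjoin M x" for a
    using smult[of "\<ominus>\<^bsub>K\<^esub> \<one>\<^bsub>K\<^esub>" a] that \<open>adjoin M x \<subseteq> carrier V\<close> by (auto simp: a_inv_eq_smult)
  show "a \<oplus>\<^bsub>V\<^esub> b \<in> adjoin M x" if ab: "a \<in> adjoin M x" "b \<in> adjoin M x" for a b
  proof -
    obtain m c where a: "a = m \<oplus>\<^bsub>V\<^esub> c \<odot>\<^bsub>V\<^esub> x" "m \<in> M" "c \<in> carrier K"
      using ab(1) by (auto simp: adjoin_def)
    obtain n d where b: "b = n \<oplus>\<^bsub>V\<^esub> d \<odot>\<^bsub>V\<^esub> x" "n \<in> M" "d \<in> carrier K"
      using ab(2) by (auto simp: adjoin_def)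
    have "a \<oplus>\<^bsub>V\<^esub> b = (m \<oplus>\<^bsub>V\<^esub> n) \<oplus>\<^bsub>V\<^esub> (c \<oplus>\<^bsub>K\<^esub> d) \<odot>\<^bsub>V\<^esub> x"
      using a b Mc assms(2) by (simp add: smult_l_distr V.M.a_ac)
    then show ?thesis using M(5)[OF a(2) b(2)] a(3) b(3) unfolding adjoin_def by blast
  qed
qed

lemma eq_diff0: "a \<in> carrier K \<Longrightarrow> b \<in> carrier K \<Longrightarrow> a \<ominus>\<^bsub>K\<^esub> b = \<zero>\<^bsub>K\<^esub> \<longleftrightarrow> a = b"
  by (metis a_minus_def K.add.inv_closed K.l_neg K.minus_equality K.minus_minus K.r_neg)

text \<open>Zorn's lemma gives a submodule \<open>M\<close> maximal among those containing
  \<open>W\<close> and missing \<open>v\<close>. It is a hyperplane complementary to the line of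
  \<open>v\<close>, and the functional reads off the coefficient of \<open>v\<close> along this
  decomposition.\<close>

lemma separating_functional:
  assumes W: "submodule W K V" and v: "v \<in> carrier V" "v \<notin> W"
  obtains \<chi> where "functional K V \<chi>" "\<And>w. w \<in> W \<Longrightarrow> \<chi> w = \<zero>\<^bsub>K\<^esub>" "\<chi> v = \<one>\<^bsub>K\<^esub>"
proof -
  let ?A = "{M. submodule M K V \<and> W \<subseteq> M \<and> v \<notin> M}"
  have "\<exists>M\<in>?A. \<forall>X\<in>?A. M \<subseteq> X \<longrightarrow> X = M"
  proof (rule subset_Zorn_nonempty)
    show "?A \<noteq> {}" using W v by blast
    fix C assume C: "C \<noteq> {}" "subset.chain ?A C"
    have CA: "C \<subseteq> ?A" and lin: "\<And>X Y. X \<in> C \<Longrightarrow> Y \<in> C \<Longrightarrow> X \<subseteq> Y \<or> Y \<subseteq> X"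
      using C(2) by (auto simp: subset_chain_def)
    have sub: "submodule X K V" if "X \<in> C" for X using CA that by blast
    have "submodule (\<Union>C) K V"
    proof (rule submoduleI)
      obtain X where X: "X \<in> C" using C by blast
      have "\<zero>\<^bsub>V\<^esub> \<in> X" using sub[OF X] by (metis submodule_def subgroup.one_closed monoid.simps(2))
      then show "\<zero>\<^bsub>V\<^esub> \<in> \<Union>C" using X by blast
      show "\<Union>C \<subseteq> carrier V" using submoduleE(1)[OF sub] by blast
      show "\<ominus>\<^bsub>V\<^esub> a \<in> \<Union>C" if "a \<in> \<Union>C" for a using that submoduleE(3)[OF sub] by blast
      show "c \<odot>\<^bsub>V\<^esub> a \<in> \<Union>C" if "c \<in> carrier K" "a \<in> \<Union>C" for c a
        using that submoduleE(4)[OF sub] by blast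
      show "a \<oplus>\<^bsub>V\<^esub> b \<in> \<Union>C" if ab: "a \<in> \<Union>C" "b \<in> \<Union>C" for a b
      proof -
        obtain X Y where XY: "X \<in> C" "a \<in> X" "Y \<in> C" "b \<in> Y" using ab by blast
        then obtain Z where "Z \<in> C" "a \<in> Z" "b \<in> Z" using lin[OF XY(1,3)] by blast
        then show ?thesis using submoduleE(5)[OF sub] by blast
      qed
    qed
    then show "\<Union>C \<in> ?A" using CA C(1) by blast
  qed
  then obtain M where MA: "M \<in> ?A" and max: "\<forall>X\<in>?A. M \<subseteq> X \<longrightarrow> X = M" by (elim bexE)
  then have M: "submodule M K V" "W \<subseteq> M" "v \<notin> M" by simp_all
  note ME = submoduleE[OF M(1)]
  have Mc: "m \<in> carrier V" if "m \<in> M" for m using ME(1) that by blast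
  have Z: "\<zero>\<^bsub>V\<^esub> \<in> M" using M(1) by (metis submodule_def subgroup.one_closed monoid.simps(2))
  define dec where "dec x c \<longleftrightarrow> c \<in> carrier K \<and> (\<exists>m\<in>M. x = m \<oplus>\<^bsub>V\<^esub> c \<odot>\<^bsub>V\<^esub> v)" for x c
  have ex: "\<exists>c. dec x c" if x: "x \<in> carrier V" for x
  proof (cases "x \<in> M")
    case True
    then have "dec x \<zero>\<^bsub>K\<^esub>" using v Mc by (auto simp: dec_def)
    then show ?thesis by blast
  next
    case False
    have sub: "M \<subseteq> adjoin M x"
    proof
      fix m assume m: "m \<in> M"
      have "m = m \<oplus>\<^bsub>V\<^esub> \<zero>\<^bsub>K\<^esub> \<odot>\<^bsub>V\<^esub> x" using m Mc x by simp
      then show "m \<in> adjoin M x" unfolding adjoin_def using m by blast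
    qed
    have "x = \<zero>\<^bsub>V\<^esub> \<oplus>\<^bsub>V\<^esub> \<one>\<^bsub>K\<^esub> \<odot>\<^bsub>V\<^esub> x" using x by simp
    then have "x \<in> adjoin M x" unfolding adjoin_def using Z by blast
    \<comment> \<open>Adjoining \<open>x\<close> strictly enlarges \<open>M\<close>, so maximality
      forces \<open>v\<close> into the result. The coefficient of \<open>x\<close> in that
      expression is nonzero since \<open>v\<close> is not in \<open>M\<close>, and the equation can
      be solved for \<open>x\<close>.\<close>
    then have "v \<in> adjoin M x"
      using False bspec[OF max, of "adjoin M x"] adjoin_submodule[OF M(1) x] sub M(2) by auto
    then obtain m c where mc: "m \<in> M" "c \<in> carrier K" "v = m \<oplus>\<^bsub>V\<^esub> c \<odot>\<^bsub>V\<^esub> x" by (auto simp: adjoin_def)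
    have "c \<noteq> \<zero>\<^bsub>K\<^esub>" using mc M(3) x Mc[OF mc(1)] by auto
    then have cU: "c \<in> Units K" using mc(2) field_Units by blast
    then have ic: "inv\<^bsub>K\<^esub> c \<in> carrier K" "inv\<^bsub>K\<^esub> c \<otimes>\<^bsub>K\<^esub> c = \<one>\<^bsub>K\<^esub>" by auto
    have m': "\<ominus>\<^bsub>V\<^esub> (inv\<^bsub>K\<^esub> c \<odot>\<^bsub>V\<^esub> m) \<in> M" using ME(3,4) mc ic by blast
    have "inv\<^bsub>K\<^esub> c \<odot>\<^bsub>V\<^esub> v = inv\<^bsub>K\<^esub> c \<odot>\<^bsub>V\<^esub> m \<oplus>\<^bsub>V\<^esub> x"
      using mc ic x Mc by (simp add: smult_r_distr smult_assoc1[symmetric])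
    then have "x = \<ominus>\<^bsub>V\<^esub> (inv\<^bsub>K\<^esub> c \<odot>\<^bsub>V\<^esub> m) \<oplus>\<^bsub>V\<^esub> inv\<^bsub>K\<^esub> c \<odot>\<^bsub>V\<^esub> v"
      using ic x Mc[OF mc(1)] by (simp add: V.M.a_assoc[symmetric] V.M.l_neg)
    then have "dec x (inv\<^bsub>K\<^esub> c)" using m' ic by (auto simp: dec_def)
    then show ?thesis by blast
  qed
  have uniq: "c = d" if "dec x c" "dec x d" for x c d
  proof (rule ccontr)
    assume ne: "c \<noteq> d"
    obtain m n where *: "m \<in> M" "n \<in> M" "x = m \<oplus>\<^bsub>V\<^esub> c \<odot>\<^bsub>V\<^esub> v" "x = n \<oplus>\<^bsub>V\<^esub> d \<odot>\<^bsub>V\<^esub> v"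
      "c \<in> carrier K" "d \<in> carrier K" using \<open>dec x c\<close> \<open>dec x d\<close> by (auto simp: dec_def)
    \<comment> \<open>Two different coefficients would put a nonzero multiple of \<open>v\<close>,
      and hence \<open>v\<close> itself, into \<open>M\<close>.\<close>
    let ?a = "c \<ominus>\<^bsub>K\<^esub> d"
    have a: "?a \<in> carrier K" "?a \<noteq> \<zero>\<^bsub>K\<^esub>" using * ne by (auto simp: eq_diff0)
    then have "?a \<in> Units K" using field_Units by blast
    then have ia: "inv\<^bsub>K\<^esub> ?a \<in> carrier K" "inv\<^bsub>K\<^esub> ?a \<otimes>\<^bsub>K\<^esub> ?a = \<one>\<^bsub>K\<^esub>" by auto
    have "c \<odot>\<^bsub>V\<^esub> v = (\<ominus>\<^bsub>V\<^esub> m \<oplus>\<^bsub>V\<^esub> m) \<oplus>\<^bsub>V\<^esub> c \<odot>\<^bsub>V\<^esub> v"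
      using * v Mc by (simp add: V.M.l_neg)
    also have "\<dots> = \<ominus>\<^bsub>V\<^esub> m \<oplus>\<^bsub>V\<^esub> (n \<oplus>\<^bsub>V\<^esub> d \<odot>\<^bsub>V\<^esub> v)"
      using * v Mc[OF *(1)] Mc[OF *(2)] by (simp add: V.M.a_assoc)
    finally have cv: "c \<odot>\<^bsub>V\<^esub> v = \<ominus>\<^bsub>V\<^esub> m \<oplus>\<^bsub>V\<^esub> (n \<oplus>\<^bsub>V\<^esub> d \<odot>\<^bsub>V\<^esub> v)" .
    have "?a \<odot>\<^bsub>V\<^esub> v = c \<odot>\<^bsub>V\<^esub> v \<oplus>\<^bsub>V\<^esub> \<ominus>\<^bsub>V\<^esub> (d \<odot>\<^bsub>V\<^esub> v)"
      using * v by (simp add: a_minus_def smult_l_distr smult_l_minus)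
    also have "\<dots> = \<ominus>\<^bsub>V\<^esub> m \<oplus>\<^bsub>V\<^esub> n" unfolding cv
      using *(5,6) v Mc[OF *(1)] Mc[OF *(2)] by (simp add: V.M.a_assoc V.M.r_neg)
    finally have "?a \<odot>\<^bsub>V\<^esub> v \<in> M" using ME(3,5) * by simp
    then have "inv\<^bsub>K\<^esub> ?a \<odot>\<^bsub>V\<^esub> (?a \<odot>\<^bsub>V\<^esub> v) \<in> M" using ME(4) ia by blast
    then show False using M(3) v ia a by (simp add: smult_assoc1[symmetric])
  qed
  define \<chi> where "\<chi> x = (THE c. dec x c)" for x
  have chi: "dec x (\<chi> x)" if "x \<in> carrier V" for x
    unfolding \<chi>_def using ex[OF that] uniq by (metis (mono_tags, lifting) theI)
  have eqI: "\<chi> x = c" if "dec x c" for x c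
    unfolding \<chi>_def using that uniq by blast
  show thesis
  proof
    have "\<chi> (x \<oplus>\<^bsub>V\<^esub> y) = \<chi> x \<oplus>\<^bsub>K\<^esub> \<chi> y" if xy: "x \<in> carrier V" "y \<in> carrier V" for x y
    proof (rule eqI)
      obtain m n where *: "m \<in> M" "n \<in> M" "x = m \<oplus>\<^bsub>V\<^esub> \<chi> x \<odot>\<^bsub>V\<^esub> v" "y = n \<oplus>\<^bsub>V\<^esub> \<chi> y \<odot>\<^bsub>V\<^esub> v"
        "\<chi> x \<in> carrier K" "\<chi> y \<in> carrier K" using chi[OF xy(1)] chi[OF xy(2)] by (auto simp: dec_def)
      have "x \<oplus>\<^bsub>V\<^esub> y = (m \<oplus>\<^bsub>V\<^esub> \<chi> x \<odot>\<^bsub>V\<^esub> v) \<oplus>\<^bsub>V\<^esub> (n \<oplus>\<^bsub>V\<^esub> \<chi> y \<odot>\<^bsub>V\<^esub> v)" using *(3,4) by simp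
      also have "\<dots> = (m \<oplus>\<^bsub>V\<^esub> n) \<oplus>\<^bsub>V\<^esub> (\<chi> x \<oplus>\<^bsub>K\<^esub> \<chi> y) \<odot>\<^bsub>V\<^esub> v"
        using *(1,2,5,6) Mc v by (simp add: smult_l_distr V.M.a_ac)
      finally show "dec (x \<oplus>\<^bsub>V\<^esub> y) (\<chi> x \<oplus>\<^bsub>K\<^esub> \<chi> y)"
        using ME(5)[OF *(1,2)] *(5,6) unfolding dec_def by blast
    qed
    moreover have "\<chi> (c \<odot>\<^bsub>V\<^esub> x) = c \<otimes>\<^bsub>K\<^esub> \<chi> x" if c: "c \<in> carrier K" "x \<in> carrier V" for c x
    proof (rule eqI)
      obtain m where *: "m \<in> M" "x = m \<oplus>\<^bsub>V\<^esub> \<chi> x \<odot>\<^bsub>V\<^esub> v" "\<chi> x \<in> carrier K"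
        using chi[OF c(2)] by (auto simp: dec_def)
      have "c \<odot>\<^bsub>V\<^esub> x = c \<odot>\<^bsub>V\<^esub> (m \<oplus>\<^bsub>V\<^esub> \<chi> x \<odot>\<^bsub>V\<^esub> v)" using *(2) by simp
      also have "\<dots> = c \<odot>\<^bsub>V\<^esub> m \<oplus>\<^bsub>V\<^esub> (c \<otimes>\<^bsub>K\<^esub> \<chi> x) \<odot>\<^bsub>V\<^esub> v"
        using *(1,3) Mc v c by (simp add: smult_r_distr smult_assoc1)
      finally show "dec (c \<odot>\<^bsub>V\<^esub> x) (c \<otimes>\<^bsub>K\<^esub> \<chi> x)"
        using ME(4)[OF c(1) *(1)] *(3) c unfolding dec_def by blast
    qed
    moreover have "\<chi> x \<in> carrier K" if "x \<in> carrier V" for x using chi[OF that] by (simp add: dec_def)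
    ultimately show "functional K V \<chi>" by (simp add: functional_def)
    show "\<chi> w = \<zero>\<^bsub>K\<^esub>" if "w \<in> W" for w
      using M(2) that Mc v by (intro eqI) (auto simp: dec_def intro!: bexI[of _ w])
    show "\<chi> v = \<one>\<^bsub>K\<^esub>"
      using Z v by (intro eqI) (auto simp: dec_def intro!: bexI[of _ "\<zero>\<^bsub>V\<^esub>"])
  qed
qed

text \<open>The head of the list is adjoined last, so induction on the list removes one variable at
  a time. The vectors of the list may be linearly dependent.\<close>

fun list_span where
  "list_span [] = {\<zero>\<^bsub>V\<^esub>}"
| "list_span (v # vs) = adjoin (list_span vs) v"

lemma list_span_submodule: "set vs \<subseteq> carrier V \<Longrightarrow> submodule (list_span vs) K V"
  by (induction vs) (auto intro!: adjoin_submodule submoduleI)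

lemma adjoin_mono: "M \<subseteq> N \<Longrightarrow> adjoin M v \<subseteq> adjoin N v"
  by (auto simp: adjoin_def)

lemma adjoin_superset:
  assumes "submodule M K V" "v \<in> carrier V"
  shows "M \<subseteq> adjoin M v"
proof
  fix m assume m: "m \<in> M"
  have "m = m \<oplus>\<^bsub>V\<^esub> \<zero>\<^bsub>K\<^esub> \<odot>\<^bsub>V\<^esub> v" using m submoduleE(1)[OF assms(1)] assms(2) by auto
  then show "m \<in> adjoin M v" unfolding adjoin_def using m by blast
qed

lemma list_span_append:
  assumes "set vs \<subseteq> carrier V" "set ws \<subseteq> carrier V"
  shows "list_span ws \<subseteq> list_span (vs @ ws)" and "list_span vs \<subseteq> list_span (vs @ ws)"
proof -
  show "list_span ws \<subseteq> list_span (vs @ ws)" using assms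
  proof (induction vs)
    case (Cons v vs)
    then show ?case using adjoin_superset[OF list_span_submodule[of "vs @ ws"], of v] by auto
  qed auto
  show "list_span vs \<subseteq> list_span (vs @ ws)" using assms
  proof (induction vs)
    case Nil
    then show ?case using list_span_submodule[of ws]
      by (auto simp: submodule_def dest: subgroup.one_closed)
  next
    case (Cons v vs)
    then show ?case using adjoin_mono by auto
  qed
qed

text \<open>With a \<open>\<psi>\<close> that vanishes on a subspace, this changes
  \<open>\<chi>\<close> elsewhere without touching its values on that subspace.\<close>

lemma functional_add_smult:
  assumes "functional K V \<chi>" "functional K V \<psi>" "c \<in> carrier K"
  shows "functional K V (\<lambda>x. \<chi> x \<oplus>\<^bsub>K\<^esub> c \<otimes>\<^bsub>K\<^esub> \<psi> x)"
  using assms by (auto simp: functional_def K.r_distr K.a_ac K.m_ac)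

text \<open>The value at the scalar \<open>c\<close> of the polynomial whose coefficients are the
  vectors in \<open>as\<close>, constant term first.\<close>

definition horner where
  "horner c as = foldr (\<lambda>a b. a \<oplus>\<^bsub>V\<^esub> c \<odot>\<^bsub>V\<^esub> b) as \<zero>\<^bsub>V\<^esub>"

lemma horner_closed: "c \<in> carrier K \<Longrightarrow> set as \<subseteq> carrier V \<Longrightarrow> horner c as \<in> carrier V"
  by (induction as) (auto simp: horner_def)

text \<open>Division of a polynomial by \<open>c - c0\<close>; the last clause recovers the vanishing of the dividend's
  coefficients from that of quotient and remainder.\<close>

lemma horner_division:
  assumes "c0 \<in> carrier K" "a \<in> carrier V" "set as \<subseteq> carrier V"
  shows "\<exists>bs r. length bs = length as \<and> set bs \<subseteq> carrier V \<and> r \<in> carrier V \<and>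
    (\<forall>c\<in>carrier K. horner c (a # as) = r \<oplus>\<^bsub>V\<^esub> (c \<ominus>\<^bsub>K\<^esub> c0) \<odot>\<^bsub>V\<^esub> horner c bs) \<and>
    (r = \<zero>\<^bsub>V\<^esub> \<longrightarrow> set bs \<subseteq> {\<zero>\<^bsub>V\<^esub>} \<longrightarrow> set (a # as) \<subseteq> {\<zero>\<^bsub>V\<^esub>})"
  using assms(2,3)
proof (induction as arbitrary: a)
  case Nil
  then show ?case using assms(1) by (intro exI[of _ "[]"] exI[of _ a]) (auto simp: horner_def)
next
  case (Cons b as)
  have b: "b \<in> carrier V" "set as \<subseteq> carrier V" using Cons.prems by auto
  from Cons.IH[OF b] obtain bs r where IH: "length bs = length as" "set bs \<subseteq> carrier V" "r \<in> carrier V"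
    "\<forall>c\<in>carrier K. horner c (b # as) = r \<oplus>\<^bsub>V\<^esub> (c \<ominus>\<^bsub>K\<^esub> c0) \<odot>\<^bsub>V\<^esub> horner c bs"
    "r = \<zero>\<^bsub>V\<^esub> \<longrightarrow> set bs \<subseteq> {\<zero>\<^bsub>V\<^esub>} \<longrightarrow> set (b # as) \<subseteq> {\<zero>\<^bsub>V\<^esub>}" by blast
  \<comment> \<open>Synthetic division: if dividing \<open>b # as\<close> gives quotient
    \<open>bs\<close> and remainder \<open>r\<close>, then the new quotient is
    \<open>r # bs\<close>, and the new remainder is \<open>a\<close> plus \<open>c0\<close> times
    \<open>r\<close>.\<close>
  have "horner c (a # b # as) = (a \<oplus>\<^bsub>V\<^esub> c0 \<odot>\<^bsub>V\<^esub> r) \<oplus>\<^bsub>V\<^esub> (c \<ominus>\<^bsub>K\<^esub> c0) \<odot>\<^bsub>V\<^esub> horner c (r # bs)"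
    if c: "c \<in> carrier K" for c
  proof -
    let ?h = "horner c bs" and ?d = "c \<ominus>\<^bsub>K\<^esub> c0"
    have h: "?h \<in> carrier V" using horner_closed c IH(2) by blast
    have d: "?d \<in> carrier K" using c assms(1) by simp
    have cr: "c \<odot>\<^bsub>V\<^esub> r = c0 \<odot>\<^bsub>V\<^esub> r \<oplus>\<^bsub>V\<^esub> ?d \<odot>\<^bsub>V\<^esub> r"
    proof -
      have "c = c0 \<oplus>\<^bsub>K\<^esub> ?d" using c assms(1) by algebra
      then have "c \<odot>\<^bsub>V\<^esub> r = (c0 \<oplus>\<^bsub>K\<^esub> ?d) \<odot>\<^bsub>V\<^esub> r" by simp
      then show ?thesis using c d assms(1) IH(3) by (simp add: smult_l_distr)
    qed
    have "horner c (a # b # as) = a \<oplus>\<^bsub>V\<^esub> c \<odot>\<^bsub>V\<^esub> horner c (b # as)" by (simp add: horner_def)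
    also have "\<dots> = a \<oplus>\<^bsub>V\<^esub> (c \<odot>\<^bsub>V\<^esub> r \<oplus>\<^bsub>V\<^esub> ?d \<odot>\<^bsub>V\<^esub> (c \<odot>\<^bsub>V\<^esub> ?h))"
      using c d h IH(3) by (simp add: IH(4)[rule_format] smult_r_distr smult_assoc1[symmetric] K.m_comm)
    also have "\<dots> = a \<oplus>\<^bsub>V\<^esub> c0 \<odot>\<^bsub>V\<^esub> r \<oplus>\<^bsub>V\<^esub> ?d \<odot>\<^bsub>V\<^esub> (r \<oplus>\<^bsub>V\<^esub> c \<odot>\<^bsub>V\<^esub> ?h)"
      unfolding cr using c d h IH(3) Cons.prems assms(1) by (simp add: smult_r_distr V.M.a_assoc)
    also have "r \<oplus>\<^bsub>V\<^esub> c \<odot>\<^bsub>V\<^esub> ?h = horner c (r # bs)" by (simp add: horner_def)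
    finally show ?thesis .
  qed
  \<comment> \<open>A vanishing new quotient has \<open>r\<close> as its head, so \<open>r\<close>
    is zero; the new remainder then reduces to \<open>a\<close>, and the remaining coefficients are
    left to the induction hypothesis.\<close>
  moreover have "set (a # b # as) \<subseteq> {\<zero>\<^bsub>V\<^esub>}"
    if z: "a \<oplus>\<^bsub>V\<^esub> c0 \<odot>\<^bsub>V\<^esub> r = \<zero>\<^bsub>V\<^esub>" "set (r # bs) \<subseteq> {\<zero>\<^bsub>V\<^esub>}"
    using z IH(5) Cons.prems(1) assms(1) by auto
  ultimately show ?case using IH(1-3) Cons.prems assms(1)
    by (intro exI[of _ "r # bs"] exI[of _ "a \<oplus>\<^bsub>V\<^esub> c0 \<odot>\<^bsub>V\<^esub> r"]) auto
qed

text \<open>Dividing by a linear factor shortens the coefficient list by one and spends one root.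
  The set \<open>R\<close> of roots is kept general, since the spent root has to be removed from it
  before the next division.\<close>

lemma horner_zero:
  assumes "infinite R" "R \<subseteq> carrier K" "set as \<subseteq> carrier V" "\<And>c. c \<in> R \<Longrightarrow> horner c as = \<zero>\<^bsub>V\<^esub>"
  shows "set as \<subseteq> {\<zero>\<^bsub>V\<^esub>}"
  using assms
proof (induction "length as" arbitrary: as R)
  case (Suc n)
  then obtain a as' where as: "as = a # as'" "length as' = n" by (cases as) auto
  obtain c0 where c0: "c0 \<in> R" using Suc.prems(1) by fastforce
  have a: "a \<in> carrier V" "set as' \<subseteq> carrier V" using Suc.prems(3) as(1) by auto
  have c0K: "c0 \<in> carrier K" using c0 Suc.prems(2) by blast
  obtain bs r where bs: "length bs = n" "set bs \<subseteq> carrier V" "r \<in> carrier V"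
    "\<forall>c\<in>carrier K. horner c as = r \<oplus>\<^bsub>V\<^esub> (c \<ominus>\<^bsub>K\<^esub> c0) \<odot>\<^bsub>V\<^esub> horner c bs"
    "r = \<zero>\<^bsub>V\<^esub> \<longrightarrow> set bs \<subseteq> {\<zero>\<^bsub>V\<^esub>} \<longrightarrow> set as \<subseteq> {\<zero>\<^bsub>V\<^esub>}"
    using horner_division[OF c0K a] unfolding as(1)[symmetric] as(2) by blast
  \<comment> \<open>Evaluation at the root \<open>c0\<close> isolates the remainder.\<close>
  have r: "r = \<zero>\<^bsub>V\<^esub>"
    using bs(4)[rule_format, OF c0K] Suc.prems(4)[OF c0] bs(3) c0K horner_closed[OF c0K bs(2)]
    by (simp add: a_minus_def K.r_neg)
  have "set bs \<subseteq> {\<zero>\<^bsub>V\<^esub>}"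
  proof (rule Suc.hyps(1))
    show "infinite (R - {c0})" using Suc.prems(1) by simp
    show "horner c bs = \<zero>\<^bsub>V\<^esub>" if c: "c \<in> R - {c0}" for c
    proof -
      have cK: "c \<in> carrier K" using c Suc.prems(2) by blast
      let ?d = "c \<ominus>\<^bsub>K\<^esub> c0"
      note h = horner_closed[OF cK bs(2)]
      \<comment> \<open>Away from \<open>c0\<close> the linear factor is a nonzero scalar and can be
        cancelled.\<close>
      have "?d \<noteq> \<zero>\<^bsub>K\<^esub>" using c cK c0K by (auto simp: eq_diff0)
      then have "?d \<in> Units K" using field_Units cK c0K by auto
      then have i: "inv\<^bsub>K\<^esub> ?d \<in> carrier K" "inv\<^bsub>K\<^esub> ?d \<otimes>\<^bsub>K\<^esub> ?d = \<one>\<^bsub>K\<^esub>" by auto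
      have "?d \<odot>\<^bsub>V\<^esub> horner c bs = \<zero>\<^bsub>V\<^esub>"
        using bs(4)[rule_format, OF cK] Suc.prems(4) c r h cK c0K by simp
      then have "inv\<^bsub>K\<^esub> ?d \<odot>\<^bsub>V\<^esub> (?d \<odot>\<^bsub>V\<^esub> horner c bs) = \<zero>\<^bsub>V\<^esub>" using i by simp
      then show ?thesis using i h cK c0K by (simp add: smult_assoc1[symmetric])
    qed
  qed (use bs Suc.prems in auto)
  then show ?case using bs(5) r by blast
qed simp

end

text \<open>\<open>C\<close> stands for \<open>S(t\<^sub>H) \<otimes> A\<close>, \<open>\<tau> v\<close> for multiplication by \<open>t\<^sub>v \<otimes> 1\<close>, \<open>\<iota> a\<close> for \<open>1 \<otimes> a\<close> and
  \<open>ev \<chi>\<close> for the map induced by \<open>t\<^sub>v \<mapsto> \<chi> v\<close>. Only these properties are needed to separate points, so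
  neither a basis of \<open>A\<close> nor the freeness of \<open>S(t\<^sub>H)\<close> enters.\<close>

locale polynomial_action = V: vector_space_K K V + A: vector_space_K K A + C: module K C
  for K :: "'k ring" and V :: "('k, 'v) module" and A :: "('k, 'a) module"
    and C :: "('k, 'c) module" +
  fixes \<tau> :: "'v \<Rightarrow> 'c \<Rightarrow> 'c" and \<iota> :: "'a \<Rightarrow> 'c" and ev :: "('v \<Rightarrow> 'k) \<Rightarrow> 'c \<Rightarrow> 'a"
  assumes bilin: "bilin K V C C \<tau>"
    and comm: "\<lbrakk>v \<in> carrier V; w \<in> carrier V; z \<in> carrier C\<rbrakk> \<Longrightarrow> \<tau> v (\<tau> w z) = \<tau> w (\<tau> v z)"
    and iota_lin: "\<iota> \<in> lin_hom K A C"
    and ev_lin: "functional K V \<chi> \<Longrightarrow> ev \<chi> \<in> lin_hom K C A"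
    and ev_iota: "functional K V \<chi> \<Longrightarrow> a \<in> carrier A \<Longrightarrow> ev \<chi> (\<iota> a) = a"
    and ev_tau: "functional K V \<chi> \<Longrightarrow> v \<in> carrier V \<Longrightarrow> z \<in> carrier C \<Longrightarrow>
      ev \<chi> (\<tau> v z) = \<chi> v \<odot>\<^bsub>A\<^esub> ev \<chi> z"
begin

text \<open>Polynomial expressions with coefficients from \<open>A\<close> whose variables are
  indexed by \<open>W\<close>. The parameter \<open>W\<close> records which variables may occur, so
  that they can be removed one by one.\<close>

inductive_set generated :: "'v set \<Rightarrow> 'c set" for W where
  iota: "a \<in> carrier A \<Longrightarrow> \<iota> a \<in> generated W"
| add: "x \<in> generated W \<Longrightarrow> y \<in> generated W \<Longrightarrow> x \<oplus>\<^bsub>C\<^esub> y \<in> generated W"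
| smult: "c \<in> carrier K \<Longrightarrow> x \<in> generated W \<Longrightarrow> c \<odot>\<^bsub>C\<^esub> x \<in> generated W"
| tau: "v \<in> W \<Longrightarrow> x \<in> generated W \<Longrightarrow> \<tau> v x \<in> generated W"

lemma generated_carrier: "W \<subseteq> carrier V \<Longrightarrow> x \<in> generated W \<Longrightarrow> x \<in> carrier C"
  by (rotate_tac, induction rule: generated.induct) (auto simp: lin_hom_closed[OF iota_lin] bilinD(1)[OF bilin])

lemma generated_mono: "W \<subseteq> W' \<Longrightarrow> x \<in> generated W \<Longrightarrow> x \<in> generated W'"
  by (rotate_tac, induction rule: generated.induct) (auto intro: generated.intros)

text \<open>Only finitely many variables occur in one expression; for a sum the two lists are
  concatenated.\<close>

lemma generated_list_span:
  assumes "x \<in> generated (carrier V)"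
  shows "\<exists>vs. set vs \<subseteq> carrier V \<and> x \<in> generated (V.list_span vs)"
  using assms
proof (induction rule: generated.induct)
  case (iota a)
  then show ?case using generated.iota by (intro exI[of _ "[]"]) auto
next
  case (add x y)
  then obtain vs ws where *: "set vs \<subseteq> carrier V" "x \<in> generated (V.list_span vs)"
    "set ws \<subseteq> carrier V" "y \<in> generated (V.list_span ws)" by auto
  have "x \<oplus>\<^bsub>C\<^esub> y \<in> generated (V.list_span (vs @ ws))"
    using generated_mono[OF V.list_span_append(2)[OF *(1,3)] *(2)]
      generated_mono[OF V.list_span_append(1)[OF *(1,3)] *(4)] by (rule generated.add)
  then show ?case using * by (intro exI[of _ "vs @ ws"]) auto
next
  case (smult c x)
  then show ?case using generated.smult by blast
next
  case (tau v x)
  then obtain vs where *: "set vs \<subseteq> carrier V" "x \<in> generated (V.list_span vs)" by auto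
  have sub: "set (v # vs) \<subseteq> carrier V" using * tau by auto
  have "\<zero>\<^bsub>V\<^esub> \<in> V.list_span vs"
    using V.list_span_submodule[OF *(1)] by (metis submodule_def subgroup.one_closed monoid.simps(2))
  moreover have "v = \<zero>\<^bsub>V\<^esub> \<oplus>\<^bsub>V\<^esub> \<one>\<^bsub>K\<^esub> \<odot>\<^bsub>V\<^esub> v" using tau by simp
  ultimately have "v \<in> V.list_span (v # vs)" unfolding V.list_span.simps V.adjoin_def by blast
  moreover have "x \<in> generated (V.list_span (v # vs))"
    using generated_mono[OF V.list_span_append(1)[of "[v]" vs] *(2)] * tau by auto
  ultimately have "\<tau> v x \<in> generated (V.list_span (v # vs))" by (rule generated.tau)
  then show ?case using sub by blast
qed

text \<open>The counterpart of \<open>horner\<close> before evaluation: a polynomial in the single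
  variable \<open>\<tau> v\<close> with coefficients in \<open>C\<close>, constant term
  first.\<close>

definition tau_horner where
  "tau_horner v zs = foldr (\<lambda>z y. z \<oplus>\<^bsub>C\<^esub> \<tau> v y) zs \<zero>\<^bsub>C\<^esub>"

lemma tau_zero: "v \<in> carrier V \<Longrightarrow> \<tau> v \<zero>\<^bsub>C\<^esub> = \<zero>\<^bsub>C\<^esub>"
  using bilin by (intro lin_hom_zero[OF C.module_axioms C.module_axioms]) (simp add: bilin_def)

lemma tau_horner_closed:
  "v \<in> carrier V \<Longrightarrow> set zs \<subseteq> carrier C \<Longrightarrow> tau_horner v zs \<in> carrier C"
  by (induction zs) (auto simp: tau_horner_def bilinD(1)[OF bilin])

text \<open>An additive map commuting with \<open>\<tau> v\<close> acts coefficientwise. It is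
  applied to scalar multiplications and to \<open>\<tau> w\<close> for other vectors
  \<open>w\<close>.\<close>

lemma tau_horner_map:
  assumes "v \<in> carrier V" "set zs \<subseteq> carrier C"
    and f: "\<And>z. z \<in> carrier C \<Longrightarrow> f z \<in> carrier C"
      "\<And>x y. x \<in> carrier C \<Longrightarrow> y \<in> carrier C \<Longrightarrow> f (x \<oplus>\<^bsub>C\<^esub> y) = f x \<oplus>\<^bsub>C\<^esub> f y"
      "\<And>z. z \<in> carrier C \<Longrightarrow> f (\<tau> v z) = \<tau> v (f z)" "f \<zero>\<^bsub>C\<^esub> = \<zero>\<^bsub>C\<^esub>"
  shows "f (tau_horner v zs) = tau_horner v (map f zs)"
  using assms(2)
proof (induction zs)
  case (Cons z zs)
  have "tau_horner v zs \<in> carrier C" using Cons.prems assms(1) by (intro tau_horner_closed) auto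
  then show ?case using Cons f assms(1)
    by (simp add: tau_horner_def bilinD(1)[OF bilin])
qed (simp add: tau_horner_def f(4))

text \<open>Coefficients are added degree by degree; when one list ends, the rest of the other is
  kept unchanged.\<close>

lemma tau_horner_add:
  assumes "v \<in> carrier V" "set xs \<subseteq> generated W" "set ys \<subseteq> generated W" "W \<subseteq> carrier V"
  shows "\<exists>zs. set zs \<subseteq> generated W \<and> tau_horner v xs \<oplus>\<^bsub>C\<^esub> tau_horner v ys = tau_horner v zs"
  using assms(2,3)
proof (induction xs arbitrary: ys)
  case Nil
  then have "tau_horner v ys \<in> carrier C"
    using assms generated_carrier by (intro tau_horner_closed) auto
  then show ?case using Nil by (intro exI[of _ ys]) (auto simp: tau_horner_def)
next
  case (Cons x xs)
  note c = generated_carrier[OF assms(4)]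
  have "set xs \<subseteq> carrier C" "set ys \<subseteq> carrier C" using Cons.prems c by auto
  note sc = this
  have hx: "tau_horner v (x # xs) \<in> carrier C" "tau_horner v xs \<in> carrier C" "x \<in> carrier C"
    using Cons.prems c sc assms(1) by (auto intro!: tau_horner_closed)
  show ?case
  proof (cases ys)
    case Nil
    then show ?thesis using Cons.prems hx by (intro exI[of _ "x # xs"]) (auto simp: tau_horner_def)
  next
    case (Cons y ys')
    have hy: "tau_horner v ys' \<in> carrier C" "y \<in> carrier C"
      using sc(2) Cons assms(1) by (auto intro!: tau_horner_closed)
    obtain zs where zs: "set zs \<subseteq> generated W" "tau_horner v xs \<oplus>\<^bsub>C\<^esub> tau_horner v ys' = tau_horner v zs"
      using Cons.IH[of ys'] Cons.prems Cons by auto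
    have "tau_horner v (x # xs) \<oplus>\<^bsub>C\<^esub> tau_horner v ys
        = (x \<oplus>\<^bsub>C\<^esub> \<tau> v (tau_horner v xs)) \<oplus>\<^bsub>C\<^esub> (y \<oplus>\<^bsub>C\<^esub> \<tau> v (tau_horner v ys'))"
      by (simp add: tau_horner_def Cons)
    also have "\<dots> = (x \<oplus>\<^bsub>C\<^esub> y) \<oplus>\<^bsub>C\<^esub> \<tau> v (tau_horner v xs \<oplus>\<^bsub>C\<^esub> tau_horner v ys')"
      using hx hy assms(1) by (simp add: bilinD[OF bilin] C.M.a_ac)
    also have "\<dots> = tau_horner v ((x \<oplus>\<^bsub>C\<^esub> y) # zs)" unfolding zs(2) by (simp add: tau_horner_def)
    finally show ?thesis using zs(1) Cons.prems Cons generated.add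
      by (intro exI[of _ "(x \<oplus>\<^bsub>C\<^esub> y) # zs"]) auto
  qed
qed

text \<open>After one vector is adjoined, every expression is a polynomial in the new variable with
  coefficients over the old ones, because such polynomials are closed under all formation
  rules.\<close>

lemma generated_adjoin:
  assumes v: "v \<in> carrier V" and W: "W \<subseteq> carrier V" and x: "x \<in> generated (V.adjoin W v)"
  shows "\<exists>zs. set zs \<subseteq> generated W \<and> x = tau_horner v zs"
  using x
proof (induction rule: generated.induct)
  case (iota a)
  then show ?case using v generated.iota
    by (intro exI[of _ "[\<iota> a]"]) (auto simp: tau_horner_def tau_zero lin_hom_closed[OF iota_lin])
next
  case (add x y)
  then obtain xs ys where "set xs \<subseteq> generated W" "x = tau_horner v xs"
    "set ys \<subseteq> generated W" "y = tau_horner v ys" by blast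
  then show ?case using tau_horner_add[OF v _ _ W] by blast
next
  case (smult c x)
  then obtain xs where xs: "set xs \<subseteq> generated W" "x = tau_horner v xs" by blast
  have "c \<odot>\<^bsub>C\<^esub> x = tau_horner v (map (\<lambda>z. c \<odot>\<^bsub>C\<^esub> z) xs)"
    unfolding xs(2) using xs(1) generated_carrier[OF W] smult(1) v
    by (intro tau_horner_map) (auto simp: C.smult_r_distr bilinD[OF bilin])
  moreover have "set (map (\<lambda>z. c \<odot>\<^bsub>C\<^esub> z) xs) \<subseteq> generated W"
    using xs(1) smult(1) by (auto intro: generated.smult)
  ultimately show ?case by blast
next
  case (tau v' x)
  \<comment> \<open>The action of \<open>v'\<close> splits: \<open>w\<close> acts on the
    coefficients, by commutation with \<open>\<tau> v\<close>, and the multiple of \<open>v\<close>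
    shifts them by one degree.\<close>
  obtain w c where wc: "v' = w \<oplus>\<^bsub>V\<^esub> c \<odot>\<^bsub>V\<^esub> v" "w \<in> W" "c \<in> carrier K"
    using tau(1) by (auto simp: V.adjoin_def)
  have w: "w \<in> carrier V" using wc W by auto
  obtain xs where xs: "set xs \<subseteq> generated W" "x = tau_horner v xs" using tau by blast
  have xsc: "set xs \<subseteq> carrier C" using xs generated_carrier[OF W] by blast
  note h = tau_horner_closed[OF v xsc]
  have "\<tau> w (tau_horner v xs) = tau_horner v (map (\<tau> w) xs)"
    using xsc v w by (intro tau_horner_map) (auto simp: bilinD[OF bilin] tau_zero comm)
  moreover have "set (map (\<tau> w) xs) \<subseteq> generated W" using xs(1) wc by (auto intro: generated.tau)
  \<comment> \<open>Multiplication by the variable prepends a zero coefficient.\<close>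
  moreover have "c \<odot>\<^bsub>C\<^esub> \<tau> v (tau_horner v xs) = tau_horner v (map (\<lambda>z. c \<odot>\<^bsub>C\<^esub> z) (\<zero>\<^bsub>C\<^esub> # xs))"
  proof -
    have "\<tau> v (tau_horner v xs) = tau_horner v (\<zero>\<^bsub>C\<^esub> # xs)"
      using h v by (simp add: tau_horner_def bilinD(1)[OF bilin])
    then show ?thesis using xsc v wc(3)
      by (subst tau_horner_map[symmetric]) (auto simp: C.smult_r_distr bilinD[OF bilin])
  qed
  moreover have "set (map (\<lambda>z. c \<odot>\<^bsub>C\<^esub> z) (\<zero>\<^bsub>C\<^esub> # xs)) \<subseteq> generated W"
  proof -
    \<comment> \<open>Zero is not among the formation rules and is obtained as the image of zero
      under \<open>\<iota>\<close>.\<close>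
    have "\<iota> \<zero>\<^bsub>A\<^esub> = \<zero>\<^bsub>C\<^esub>" by (rule lin_hom_zero[OF A.module_axioms C.module_axioms iota_lin])
    then have "\<zero>\<^bsub>C\<^esub> \<in> generated W" using generated.iota[of "\<zero>\<^bsub>A\<^esub>" W] by simp
    then show ?thesis using xs(1) wc(3) by (auto intro!: generated.smult)
  qed
  moreover have "\<tau> v' x = \<tau> w (tau_horner v xs) \<oplus>\<^bsub>C\<^esub> c \<odot>\<^bsub>C\<^esub> \<tau> v (tau_horner v xs)"
    unfolding wc xs using h v w wc(3) by (simp add: bilinD[OF bilin])
  ultimately show ?case using tau_horner_add[OF v _ _ W] by metis
qed

text \<open>\<open>ev \<chi>\<close> replaces the operator \<open>\<tau> v\<close> by the scalar
  \<open>\<chi> v\<close> and thus turns one Horner scheme into the other.\<close>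

lemma ev_horner:
  assumes "functional K V \<chi>" "v \<in> carrier V" "set zs \<subseteq> carrier C"
  shows "ev \<chi> (tau_horner v zs) = A.horner (\<chi> v) (map (ev \<chi>) zs)"
  using assms(3)
proof (induction zs)
  case Nil
  show ?case using lin_hom_zero[OF C.module_axioms A.module_axioms ev_lin[OF assms(1)]]
    by (simp add: tau_horner_def A.horner_def)
next
  case (Cons z zs)
  have "tau_horner v zs \<in> carrier C" using Cons.prems assms(2) by (intro tau_horner_closed) auto
  then show ?case using Cons assms(2)
    by (simp add: tau_horner_def A.horner_def lin_hom_add[OF ev_lin[OF assms(1)]] ev_tau[OF assms(1)]
      bilinD(1)[OF bilin])
qed

text \<open>An expression over \<open>W\<close> sees a functional through its values on
  \<open>W\<close> alone. This freezes the coefficients while the value at a new vector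
  varies.\<close>

lemma ev_cong:
  assumes "functional K V \<chi>" "functional K V \<psi>" "W \<subseteq> carrier V" "\<And>w. w \<in> W \<Longrightarrow> \<chi> w = \<psi> w" "x \<in> generated W"
  shows "ev \<chi> x = ev \<psi> x"
  using assms(5)
proof (induction rule: generated.induct)
  case (tau v x)
  then show ?case using assms(3,4) generated_carrier[OF assms(3)]
    by (simp add: ev_tau[OF assms(1)] ev_tau[OF assms(2)] subset_iff)
qed (simp_all add: ev_iota assms(1,2) lin_hom_add[OF ev_lin] lin_hom_smult[OF ev_lin]
    generated_carrier[OF assms(3)])

text \<open>For a new vector \<open>v\<close>, write \<open>z\<close> as a polynomial in
  \<open>\<tau> v\<close>. Its evaluated coefficients form a polynomial that vanishes at every
  scalar, so each coefficient is killed by all \<open>ev \<chi>\<close>. Each lies over the shorter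
  list, where the induction hypothesis applies.\<close>

lemma list_span_separated:
  assumes inf: "infinite (carrier K)" and "set vs \<subseteq> carrier V" "z \<in> generated (V.list_span vs)"
    "\<And>\<chi>. functional K V \<chi> \<Longrightarrow> ev \<chi> z = \<zero>\<^bsub>A\<^esub>"
  shows "z = \<zero>\<^bsub>C\<^esub>"
  using assms(2-4)
proof (induction vs arbitrary: z)
  case Nil
  \<comment> \<open>Over the zero space \<open>\<tau>\<close> contributes only zero, so constants
    from \<open>A\<close> are all there is; the zero functional already recovers a constant.\<close>
  have "z \<in> \<iota> ` carrier A" using Nil(2) unfolding V.list_span.simps
  proof (induction rule: generated.induct)
    case (add x y)
    then obtain a b where "a \<in> carrier A" "b \<in> carrier A" "x = \<iota> a" "y = \<iota> b" by blast
    then have "x \<oplus>\<^bsub>C\<^esub> y = \<iota> (a \<oplus>\<^bsub>A\<^esub> b)" "a \<oplus>\<^bsub>A\<^esub> b \<in> carrier A"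
      by (simp_all add: lin_hom_add[OF iota_lin])
    then show ?case by blast
  next
    case (smult c x)
    then obtain a where "a \<in> carrier A" "x = \<iota> a" by blast
    then have "c \<odot>\<^bsub>C\<^esub> x = \<iota> (c \<odot>\<^bsub>A\<^esub> a)" "c \<odot>\<^bsub>A\<^esub> a \<in> carrier A"
      using smult by (simp_all add: lin_hom_smult[OF iota_lin])
    then show ?case by blast
  next
    case (tau v x)
    have x: "x \<in> carrier C" using tau lin_hom_closed[OF iota_lin] by blast
    have "\<tau> v x = \<zero>\<^bsub>C\<^esub>"
      using tau(1) bilinD(4)[OF bilin, of "\<zero>\<^bsub>K\<^esub>" "\<zero>\<^bsub>V\<^esub>" x] x bilinD(1)[OF bilin _ x] by simp
    also have "\<dots> = \<iota> \<zero>\<^bsub>A\<^esub>" by (rule lin_hom_zero[OF A.module_axioms C.module_axioms iota_lin, symmetric])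
    finally show ?case using imageI[of "\<zero>\<^bsub>A\<^esub>" "carrier A" \<iota>] by simp
  qed blast
  then obtain a where a: "a \<in> carrier A" "z = \<iota> a" by blast
  have "functional K V (\<lambda>x. \<zero>\<^bsub>K\<^esub>)" by (auto simp: functional_def)
  then have "a = \<zero>\<^bsub>A\<^esub>" using Nil(3) a ev_iota by force
  then show ?case using a lin_hom_zero[OF A.module_axioms C.module_axioms iota_lin] by simp
next
  case (Cons v vs)
  have v: "v \<in> carrier V" and vs: "set vs \<subseteq> carrier V" using Cons.prems(1) by auto
  note sub = V.list_span_submodule[OF vs]
  note subc = V.submoduleE(1)[OF sub]
  show ?case
  proof (cases "v \<in> V.list_span vs")
    case True
    \<comment> \<open>A dependent vector enlarges nothing, and the shorter list suffices.\<close>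
    have "V.adjoin (V.list_span vs) v \<subseteq> V.list_span vs"
      using True V.submoduleE(4,5)[OF sub] by (auto simp: V.adjoin_def)
    then have "z \<in> generated (V.list_span vs)" using Cons.prems(2) generated_mono by auto
    then show ?thesis using Cons.IH[OF vs] Cons.prems(3) by blast
  next
    case False
    \<comment> \<open>Adding multiples of this functional changes the value at \<open>v\<close> and
      leaves the earlier span alone.\<close>
    obtain \<chi>0 where \<chi>0: "functional K V \<chi>0" "\<And>w. w \<in> V.list_span vs \<Longrightarrow> \<chi>0 w = \<zero>\<^bsub>K\<^esub>" "\<chi>0 v = \<one>\<^bsub>K\<^esub>"
      using V.separating_functional[OF sub v False] by metis
    obtain zs where zs: "set zs \<subseteq> generated (V.list_span vs)" "z = tau_horner v zs"
      using generated_adjoin[OF v subc] Cons.prems(2) by auto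
    have zsc: "set zs \<subseteq> carrier C" using zs generated_carrier[OF subc] by blast
    have "ev \<chi> y = \<zero>\<^bsub>A\<^esub>" if \<chi>: "functional K V \<chi>" and y: "y \<in> set zs" for \<chi> y
    proof -
      have \<chi>v: "\<chi> w \<in> carrier K" if "w \<in> carrier V" for w using \<chi> that by (simp add: functional_def)
      have "set (map (ev \<chi>) zs) \<subseteq> {\<zero>\<^bsub>A\<^esub>}"
      proof (rule A.horner_zero[OF inf])
        show "set (map (ev \<chi>) zs) \<subseteq> carrier A" using zsc lin_hom_closed[OF ev_lin[OF \<chi>]] by auto
        fix c assume c: "c \<in> carrier K"
        \<comment> \<open>\<open>\<psi>\<close> agrees with \<open>\<chi>\<close> on the earlier variables and takes the arbitrary value \<open>c\<close> at \<open>v\<close>\<close>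
        let ?\<psi> = "\<lambda>x. \<chi> x \<oplus>\<^bsub>K\<^esub> (c \<ominus>\<^bsub>K\<^esub> \<chi> v) \<otimes>\<^bsub>K\<^esub> \<chi>0 x"
        have \<psi>: "functional K V ?\<psi>" using c \<chi>v v by (intro V.functional_add_smult \<chi> \<chi>0) auto
        have \<psi>v: "?\<psi> v = c"
        proof -
          have "\<chi> v \<oplus>\<^bsub>K\<^esub> (c \<ominus>\<^bsub>K\<^esub> \<chi> v) = c" using c \<chi>v[OF v] by algebra
          then show ?thesis using c \<chi>v[OF v] \<chi>0(3) by simp
        qed
        have "ev ?\<psi> y = ev \<chi> y" if "y \<in> generated (V.list_span vs)" for y
          using subc c \<chi>v v by (intro ev_cong[OF \<psi> \<chi> subc _ that]) (auto simp: \<chi>0(2) subset_iff)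
        then have "map (ev ?\<psi>) zs = map (ev \<chi>) zs" using zs(1) by auto
        from this[symmetric] have "A.horner c (map (ev \<chi>) zs) = ev ?\<psi> z"
          unfolding zs(2) ev_horner[OF \<psi> v zsc] \<psi>v by (rule arg_cong)
        then show "A.horner c (map (ev \<chi>) zs) = \<zero>\<^bsub>A\<^esub>" using Cons.prems(3)[OF \<psi>] by simp
      qed simp
      then show ?thesis using y by auto
    qed
    then have "set zs \<subseteq> {\<zero>\<^bsub>C\<^esub>}" using Cons.IH[OF vs] zs(1) by blast
    then have "tau_horner v zs = \<zero>\<^bsub>C\<^esub>"
      by (induction zs) (auto simp: tau_horner_def tau_zero v)
    then show ?thesis using zs(2) by simp
  qed
qed

lemma separated:
  assumes "infinite (carrier K)" "z \<in> generated (carrier V)"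
    "\<And>\<chi>. functional K V \<chi> \<Longrightarrow> ev \<chi> z = \<zero>\<^bsub>A\<^esub>"
  shows "z = \<zero>\<^bsub>C\<^esub>"
  using generated_list_span[OF assms(2)] list_span_separated[OF assms(1) _ _ assms(3)] by blast

end

section \<open>Comodule algebras with central coinvariants\<close>

lemma tensor_map_cong:
  assumes "tensor_map_pair K V W V' W' f g" "x \<in> carrier (tensor K V W)"
    "\<And>v. v \<in> carrier V \<Longrightarrow> f v = f' v" "\<And>w. w \<in> carrier W \<Longrightarrow> g w = g' w"
  shows "tensor_map K V' W' f g x = tensor_map K V' W' f' g' x"
proof -
  interpret tensor_map_pair K V W V' W' f g by fact
  show ?thesis unfolding tensor_map_def
    by (rule S.tensor_lift_cong[OF k_algebra_module[OF T.tensor_algebra] map_bilin _ assms(2)])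
      (simp add: assms(3,4))
qed

text \<open>Both sides are linear in \<open>y\<close>; on a pure triple each applies
  \<open>f\<close> to the first factor and regroups.\<close>

lemma tensor_assoc_natural:
  assumes "tensor_triple K U V W" "k_algebra K U'" "f \<in> lin_hom K U U'"
    "y \<in> carrier (tensor K U (tensor K V W))"
  shows "tensor_map K (tensor K U' V) W (tensor_map K U' V f (\<lambda>v. v)) (\<lambda>w. w) (tensor_assoc K U V W y)
    = tensor_assoc K U' V W (tensor_map K U' (tensor K V W) f (\<lambda>x. x) y)"
proof -
  interpret U: tensor_triple K U V W by fact
  interpret U': tensor_triple K U' V W
    by (intro tensor_triple.intro assms(2) U.V.k_algebra_axioms U.W.k_algebra_axioms)
  interpret m: tensor_map_pair K U V U' V f "\<lambda>v. v"
    by (intro tensor_map_pairI U.U.k_algebra_axioms U.V.k_algebra_axioms assms(2,3) lin_hom_id)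
  interpret l: tensor_map_pair K "tensor K U V" W "tensor K U' V" W "tensor_map K U' V f (\<lambda>v. v)" "\<lambda>w. w"
    by (intro tensor_map_pairI U.UV.tensor_algebra U.W.k_algebra_axioms U'.UV.tensor_algebra m.map_lin lin_hom_id)
  interpret r: tensor_map_pair K U "tensor K V W" U' "tensor K V W" f "\<lambda>x. x"
    by (intro tensor_map_pairI U.U.k_algebra_axioms U.VW.tensor_algebra assms(2,3) lin_hom_id)
  show ?thesis
    by (rule U.triple_lin_eqI[OF lin_hom_comp[OF U.assoc_lin l.map_lin]
        lin_hom_comp[OF r.map_lin U'.assoc_lin] _ assms(4)])
      (simp add: U.assoc_pure l.map_pure m.map_pure r.map_pure U'.assoc_pure U.UV.pure_closed
        U.VW.pure_closed lin_hom_closed[OF assms(3)])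
qed

locale central_comodule =
  fixes K :: "'k ring"
    and H :: "('k, 'h) module"
    and \<Delta> :: "'h \<Rightarrow> ('h \<times> 'h \<Rightarrow> 'k) set"
    and \<epsilon> :: "'h \<Rightarrow> 'k"
    and S :: "'h \<Rightarrow> 'h"
    and A B :: "('k, 'a) module"
    and \<delta> :: "'a \<Rightarrow> ('a \<times> 'h \<Rightarrow> 'k) set"
    and u :: "('a \<times> 'h \<Rightarrow> 'k) set \<Rightarrow> 'a"
  assumes hopf: "hopf_algebra K H \<Delta> \<epsilon> S"
    and comodule: "comodule_algebra K H \<Delta> \<epsilon> A \<delta>"
    and B_def: "B = coinvariants K H A \<delta>"
    and central: "\<forall>b\<in>carrier B. \<forall>a\<in>carrier A. b \<otimes>\<^bsub>A\<^esub> a = a \<otimes>\<^bsub>A\<^esub> b"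
    and iso: "B_linear_comodule_iso K H \<Delta> A \<delta> B u"

sublocale central_comodule \<subseteq> Hopf: hopf_algebra K H \<Delta> \<epsilon> S by (rule hopf)
sublocale central_comodule \<subseteq> Com: comodule_algebra K H \<Delta> \<epsilon> A \<delta> by (rule comodule)

context central_comodule begin

lemma kH: "k_algebra K H" by (rule Hopf.k_algebra_axioms)
lemma kA: "k_algebra K A" by (rule Com.k_algebra_axioms)

end

sublocale central_comodule \<subseteq> AH: tensor_pair K A H by (intro tensor_pairI kA kH)

section \<open>The algebra of coinvariants\<close>

context central_comodule begin

lemma delta_lin: "\<delta> \<in> lin_hom K A (tensor K A H)"
  by (rule alg_hom_lin[OF Com.coaction_hom])

lemma B_simps:
  "mult B = mult A" "one B = one A" "zero B = zero A" "add B = add A" "smult B = smult A"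
  by (simp_all add: B_def coinvariants_def)

lemma B_carrier: "b \<in> carrier B \<longleftrightarrow> b \<in> carrier A \<and> \<delta> b = pure_tensor K A H b \<one>\<^bsub>H\<^esub>"
  by (simp add: B_def coinvariants_def)

text \<open>The coinvariants are the elements on which \<open>\<delta>\<close> and
  \<open>a \<mapsto> a \<otimes> 1\<close> agree. Both respect the algebra structure, so the set
  where they agree is a subalgebra.\<close>

lemma kB: "k_algebra K B"
proof -
  note alg = Com.coaction_hom
  note lin = delta_lin
  have sub: "submodule (carrier B) K A"
  proof (rule Com.submoduleI)
    show smult: "c \<odot>\<^bsub>A\<^esub> b \<in> carrier B" if "c \<in> carrier K" "b \<in> carrier B" for c b
      using that by (simp add: B_carrier lin_hom_smult[OF lin] bilinD[OF AH.pure_bilin])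
    show "\<zero>\<^bsub>A\<^esub> \<in> carrier B"
    proof -
      have "pure_tensor K A H \<zero>\<^bsub>A\<^esub> \<one>\<^bsub>H\<^esub> = \<zero>\<^bsub>tensor K A H\<^esub>"
        using AH.pure_bilin
        by (intro lin_hom_zero[OF Com.module_axioms k_algebra_module[OF AH.tensor_algebra], of "\<lambda>v. pure_tensor K A H v \<one>\<^bsub>H\<^esub>"])
          (simp add: bilin_def)
      then show ?thesis
        by (simp add: B_carrier lin_hom_zero[OF Com.module_axioms k_algebra_module[OF AH.tensor_algebra] lin])
    qed
    show "\<ominus>\<^bsub>A\<^esub> b \<in> carrier B" if "b \<in> carrier B" for b
      using smult[of "\<ominus>\<^bsub>K\<^esub> \<one>\<^bsub>K\<^esub>" b] that by (simp add: B_carrier Com.a_inv_eq_smult)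
    show "a \<oplus>\<^bsub>A\<^esub> b \<in> carrier B" if "a \<in> carrier B" "b \<in> carrier B" for a b
      using that by (simp add: B_carrier lin_hom_add[OF lin] bilinD[OF AH.pure_bilin])
  qed (auto simp: B_carrier)
  have eq: "A\<lparr>carrier := carrier B\<rparr> = B" by (simp add: B_def coinvariants_def)
  interpret B: module K B
    using submodule.submodule_is_module[OF sub Com.module_axioms] unfolding eq .
  have mult: "a \<otimes>\<^bsub>A\<^esub> b \<in> carrier B" if "a \<in> carrier B" "b \<in> carrier B" for a b
    using that Hopf.A.r_one[of "\<one>\<^bsub>H\<^esub>"] by (simp add: B_carrier alg_hom_mult[OF alg] AH.pure_mult)
  have one: "\<one>\<^bsub>A\<^esub> \<in> carrier B"
    by (simp add: B_carrier alg_hom_one[OF alg] AH.pure_one)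
  have "ring B"
  proof (rule ringI)
    show "abelian_group B" by (rule B.abelian_group_axioms)
    show "Group.monoid B"
      by (rule monoidI) (auto simp: B_simps mult one, auto simp: B_carrier Com.A.m_assoc)
  qed (auto simp: B_simps B_carrier Com.A.l_distr Com.A.r_distr)
  then show ?thesis
    using B.module_axioms Hopf.K.field_axioms
    by (auto simp: k_algebra_def k_algebra_axioms_def B_simps B_carrier
      Com.smult_mult_left Com.smult_mult_right)
qed

end

sublocale central_comodule \<subseteq> BH: tensor_pair K B H by (intro tensor_pairI kB kH)
sublocale central_comodule \<subseteq> HH: tensor_pair K H H by (intro tensor_pairI kH)
sublocale central_comodule \<subseteq> BHH: tensor_triple K B H H by (intro tensor_triple.intro kB kH)
sublocale central_comodule \<subseteq> HHH: tensor_triple K H H H by (intro tensor_triple.intro kH)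
sublocale central_comodule \<subseteq> HT: tensor_algebra_of K H by (intro tensor_algebra_of.intro kH)
sublocale central_comodule \<subseteq> TH: tensor_pair K "tensor_alg K H" H by (intro tensor_pairI kH HT.T_algebra)
sublocale central_comodule \<subseteq> SA: tensor_pair K "sym_alg K H" A by (intro tensor_pairI kA HT.S_algebra)

section \<open>Comodule maps from H to A built from linear maps into B\<close>

context central_comodule begin

lemma B_closed_A: "b \<in> carrier B \<Longrightarrow> b \<in> carrier A"
  by (simp add: B_carrier)

lemma Delta_lin: "\<Delta> \<in> lin_hom K H (tensor K H H)"
  by (rule alg_hom_lin[OF Hopf.comul_hom])

lemma Delta_closed: "h \<in> carrier H \<Longrightarrow> \<Delta> h \<in> carrier (tensor K H H)"
  by (rule lin_hom_closed[OF Delta_lin])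

lemma u_lin: "u \<in> lin_hom K (tensor K B H) A"
  using iso by (simp add: B_linear_comodule_iso_def comodule_map_def)

lemma u_bij: "bij_betw u (carrier (tensor K B H)) (carrier A)"
  using iso by (simp add: B_linear_comodule_iso_def)

abbreviation "cofree \<equiv> cofree_coaction K H \<Delta> B"

lemma u_comodule:
  "x \<in> carrier (tensor K B H) \<Longrightarrow> \<delta> (u x) = tensor_map K A H u (\<lambda>h. h) (cofree x)"
  using iso by (simp add: B_linear_comodule_iso_def comodule_map_def)

text \<open>The restriction of \<open>u\<close> to \<open>1 \<otimes> H\<close>, which determines
  \<open>u\<close> by \<open>B\<close>-linearity.\<close>

definition u1 where "u1 h = u (pure_tensor K B H \<one>\<^bsub>B\<^esub> h)"

lemma u1_lin: "u1 \<in> lin_hom K H A"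
proof -
  have "pure_tensor K B H \<one>\<^bsub>B\<^esub> \<in> lin_hom K H (tensor K B H)"
    using BH.pure_bilin by (simp add: bilin_def)
  from lin_hom_comp[OF this u_lin] show ?thesis by (simp add: u1_def[abs_def])
qed

text \<open>The tensor of \<open>b\<close> and \<open>h\<close> is \<open>b\<close> acting on the
  tensor of the unit and \<open>h\<close>.\<close>

lemma u_pure:
  assumes "b \<in> carrier B" "h \<in> carrier H"
  shows "u (pure_tensor K B H b h) = b \<otimes>\<^bsub>A\<^esub> u1 h"
proof -
  interpret m: tensor_map_pair K B H B H "\<lambda>b'. b \<otimes>\<^bsub>B\<^esub> b'" "\<lambda>h. h"
    using assms(1)
    by (intro tensor_map_pairI kB kH lin_hom_id lin_homI)
      (auto simp: BH.V.A.r_distr BH.V.smult_mult_right)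
  have "u (tensor_map K B H (\<lambda>b'. b \<otimes>\<^bsub>B\<^esub> b') (\<lambda>h. h) (pure_tensor K B H \<one>\<^bsub>B\<^esub> h))
      = b \<otimes>\<^bsub>A\<^esub> u (pure_tensor K B H \<one>\<^bsub>B\<^esub> h)"
    using iso assms BH.pure_closed[of "\<one>\<^bsub>B\<^esub>" h] by (simp add: B_linear_comodule_iso_def)
  then show ?thesis using assms by (simp add: m.map_pure u1_def)
qed

text \<open>The convolution product of \<open>\<nu>\<close> and \<open>u1\<close>.\<close>

definition twist where
  "twist \<nu> h = tensor_lift K A (\<lambda>x y. \<nu> x \<otimes>\<^bsub>A\<^esub> u1 y) (\<Delta> h)"

definition comodule_linear :: "('h \<Rightarrow> 'a) \<Rightarrow> bool" where
  "comodule_linear f \<longleftrightarrow> f \<in> lin_hom K H A \<and>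
     (\<forall>h\<in>carrier H. \<delta> (f h) = tensor_map K A H f (\<lambda>h. h) (\<Delta> h))"

context
  fixes \<nu> assumes lam: "\<nu> \<in> lin_hom K H B"
begin

lemma lam_A: "\<nu> \<in> lin_hom K H A"
  using lam by (auto simp: lin_hom_def B_simps B_closed_A Pi_iff)

lemma lam_bilin: "bilin K H H A (\<lambda>x y. \<nu> x \<otimes>\<^bsub>A\<^esub> u1 y)"
  by (rule bilinI) (simp_all add: lin_hom_closed[OF lam_A] lin_hom_closed[OF u1_lin]
    lin_hom_add[OF lam_A] lin_hom_add[OF u1_lin] lin_hom_smult[OF lam_A] lin_hom_smult[OF u1_lin]
    Com.A.l_distr Com.A.r_distr Com.smult_mult_left Com.smult_mult_right)

interpretation l: tensor_map_pair K H H B H \<nu> "\<lambda>h. h"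
  by (intro tensor_map_pairI kB kH lin_hom_id lam)

text \<open>Two readings of the twist: as \<open>u\<close> after
  \<open>(\<nu> \<otimes> id) \<circ> \<Delta>\<close> it is accessible to colinearity arguments,
  and as a sum of products in \<open>A\<close> it is what specializing \<open>mu_A\<close>
  produces.\<close>

lemma twist_eq:
  assumes "h \<in> carrier H"
  shows "twist \<nu> h = u (tensor_map K B H \<nu> (\<lambda>h. h) (\<Delta> h))"
  unfolding twist_def
  by (rule HH.tensor_lin_eqI[OF HH.tensor_lift_lin[OF Com.module_axioms lam_bilin]
      lin_hom_comp[OF l.map_lin u_lin] _ Delta_closed[OF assms]])
    (simp add: HH.tensor_lift_pure[OF Com.module_axioms lam_bilin] l.map_pure u_pure lin_hom_closed[OF lam])

text \<open>The map \<open>G\<close>, which is \<open>\<nu> \<otimes> id\<close> after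
  \<open>\<Delta>\<close>, is colinear into the cofree comodule on \<open>B\<close>: this is
  coassociativity pushed forward along \<open>\<nu>\<close>. Composition with the colinear
  \<open>u\<close> gives the twist.\<close>

lemma twist_comodule: "comodule_linear (twist \<nu>)"
proof -
  define G where "G h = tensor_map K B H \<nu> (\<lambda>h. h) (\<Delta> h)" for h
  have G_lin: "G \<in> lin_hom K H (tensor K B H)"
    unfolding G_def[abs_def] by (rule lin_hom_comp[OF Delta_lin l.map_lin])
  have tw: "twist \<nu> h = u (G h)" if "h \<in> carrier H" for h using twist_eq[OF that] by (simp add: G_def)
  have lin: "twist \<nu> \<in> lin_hom K H A"
    unfolding twist_def[abs_def]
    by (rule lin_hom_comp[OF Delta_lin HH.tensor_lift_lin[OF Com.module_axioms lam_bilin]])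
  have "\<delta> (twist \<nu> h) = tensor_map K A H (twist \<nu>) (\<lambda>h. h) (\<Delta> h)" if h: "h \<in> carrier H" for h
  proof -
    note D = Delta_closed[OF h]
    interpret iD: tensor_map_pair K H H H "tensor K H H" "\<lambda>x. x" \<Delta>
      by (intro tensor_map_pairI kH HH.tensor_algebra lin_hom_id Delta_lin)
    interpret Di: tensor_map_pair K H H "tensor K H H" H \<Delta> "\<lambda>x. x"
      by (intro tensor_map_pairI kH HH.tensor_algebra lin_hom_id Delta_lin)
    interpret BD: tensor_map_pair K B H B "tensor K H H" "\<lambda>x. x" \<Delta>
      by (intro tensor_map_pairI kH kB HH.tensor_algebra lin_hom_id Delta_lin)
    interpret l2: tensor_map_pair K H "tensor K H H" B "tensor K H H" \<nu> "\<lambda>x. x"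
      by (intro tensor_map_pairI kH kB HH.tensor_algebra lin_hom_id lam)
    interpret ll: tensor_map_pair K "tensor K H H" H "tensor K B H" H "tensor_map K B H \<nu> (\<lambda>h. h)" "\<lambda>x. x"
      by (intro tensor_map_pairI kH HH.tensor_algebra BH.tensor_algebra lin_hom_id l.map_lin)
    interpret GH: tensor_map_pair K H H "tensor K B H" H G "\<lambda>x. x"
      by (intro tensor_map_pairI kH BH.tensor_algebra lin_hom_id G_lin)
    interpret uH: tensor_map_pair K "tensor K B H" H A H u "\<lambda>x. x"
      by (intro tensor_map_pairI kH kA BH.tensor_algebra lin_hom_id u_lin)
    have "cofree (G h) = tensor_assoc K B H H
        (tensor_map K B (tensor K H H) (\<lambda>x. x) \<Delta> (tensor_map K B H \<nu> (\<lambda>h. h) (\<Delta> h)))"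
      by (simp add: cofree_coaction_def G_def)
    also have "tensor_map K B (tensor K H H) (\<lambda>x. x) \<Delta> (tensor_map K B H \<nu> (\<lambda>h. h) (\<Delta> h))
        = tensor_map K B (tensor K H H) \<nu> \<Delta> (\<Delta> h)"
      using l.map_map[OF BD.tensor_map_pair_axioms D] by simp
    also have "\<dots> = tensor_map K B (tensor K H H) \<nu> (\<lambda>x. x) (tensor_map K H (tensor K H H) (\<lambda>x. x) \<Delta> (\<Delta> h))"
      using iD.map_map[OF l2.tensor_map_pair_axioms D] by simp
    \<comment> \<open>Naturality moves \<open>\<nu>\<close> outside the associator and leaves one
      side of coassociativity for \<open>\<Delta>\<close> inside.\<close>
    also have "tensor_assoc K B H H \<dots> = tensor_map K (tensor K B H) H (tensor_map K B H \<nu> (\<lambda>v. v)) (\<lambda>w. w)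
        (tensor_assoc K H H H (tensor_map K H (tensor K H H) (\<lambda>x. x) \<Delta> (\<Delta> h)))"
      by (rule tensor_assoc_natural[OF HHH.tensor_triple_axioms kB lam lin_hom_closed[OF iD.map_lin D], symmetric])
    also have "tensor_assoc K H H H (tensor_map K H (tensor K H H) (\<lambda>x. x) \<Delta> (\<Delta> h))
        = tensor_map K (tensor K H H) H \<Delta> (\<lambda>x. x) (\<Delta> h)"
      using Hopf.coassoc[OF h] by simp
    also have "tensor_map K (tensor K B H) H (tensor_map K B H \<nu> (\<lambda>v. v)) (\<lambda>w. w) \<dots>
        = tensor_map K (tensor K B H) H G (\<lambda>x. x) (\<Delta> h)"
      using Di.map_map[OF ll.tensor_map_pair_axioms D] by (simp add: G_def[abs_def])
    finally have cG: "cofree (G h) = tensor_map K (tensor K B H) H G (\<lambda>x. x) (\<Delta> h)" .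
    have "\<delta> (twist \<nu> h) = tensor_map K A H u (\<lambda>h. h) (cofree (G h))"
      unfolding tw[OF h] by (rule u_comodule[OF lin_hom_closed[OF G_lin h]])
    also have "\<dots> = tensor_map K A H (\<lambda>h. u (G h)) (\<lambda>h. h) (\<Delta> h)"
      unfolding cG using GH.map_map[OF uH.tensor_map_pair_axioms D] by simp
    also have "\<dots> = tensor_map K A H (twist \<nu>) (\<lambda>h. h) (\<Delta> h)"
      by (rule tensor_map_cong[OF _ D])
        (simp_all add: tw tensor_map_pairI kH kA lin_hom_id lin_hom_comp[OF G_lin u_lin])
    finally show ?thesis .
  qed
  then show ?thesis using lin by (simp add: comodule_linear_def)
qed

text \<open>Centrality enters twice. The values of \<open>\<nu>\<close> commute with each other, so
  \<open>\<nu>\<close> extends to a morphism \<open>g\<close> from the symmetric algebra to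
  \<open>B\<close>. They also commute with \<open>A\<close>, which makes the product of
  \<open>g s\<close> and \<open>a\<close> multiplicative in the pair.\<close>

lemma specialization:
  obtains \<Psi> where "\<Psi> \<in> alg_hom K (tensor K (sym_alg K H) A) A"
    "\<And>h a. h \<in> carrier H \<Longrightarrow> a \<in> carrier A \<Longrightarrow>
      \<Psi> (pure_tensor K (sym_alg K H) A (t_gen K H h) a) = \<nu> h \<otimes>\<^bsub>A\<^esub> a"
    "\<And>a. a \<in> carrier A \<Longrightarrow> \<Psi> (pure_tensor K (sym_alg K H) A \<one>\<^bsub>sym_alg K H\<^esub> a) = a"
proof -
  have "\<nu> v \<otimes>\<^bsub>B\<^esub> \<nu> w = \<nu> w \<otimes>\<^bsub>B\<^esub> \<nu> v" if "v \<in> carrier H" "w \<in> carrier H" for v w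
    using central lin_hom_closed[OF lam that(1)] lin_hom_closed[OF lam_A that(2)] unfolding B_simps by blast
  then obtain g where g: "g \<in> alg_hom K (sym_alg K H) B" "\<And>v. v \<in> carrier H \<Longrightarrow> g (t_gen K H v) = \<nu> v"
    using HT.S_lift[OF kB lam] by blast
  note gl = alg_hom_lin[OF g(1)]
  note gB = lin_hom_closed[OF gl]
  have gA: "g s \<in> carrier A" if "s \<in> carrier (sym_alg K H)" for s using gB[OF that] by (rule B_closed_A)
  have bil: "bilin K (sym_alg K H) A A (\<lambda>s a. g s \<otimes>\<^bsub>A\<^esub> a)"
    by (rule bilinI) (simp_all add: gA lin_hom_add[OF gl] lin_hom_smult[OF gl] B_simps
      Com.A.l_distr Com.A.r_distr Com.smult_mult_left Com.smult_mult_right)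
  note lp = SA.tensor_lift_pure[OF Com.module_axioms bil]
  show thesis
  proof
    show "tensor_lift K A (\<lambda>s a. g s \<otimes>\<^bsub>A\<^esub> a) \<in> alg_hom K (tensor K (sym_alg K H) A) A"
    proof (rule SA.tensor_lift_alg[OF kA bil])
      show "g \<one>\<^bsub>sym_alg K H\<^esub> \<otimes>\<^bsub>A\<^esub> \<one>\<^bsub>A\<^esub> = \<one>\<^bsub>A\<^esub>" by (simp add: alg_hom_one[OF g(1)] B_simps)
      fix s a s' a' assume *: "s \<in> carrier (sym_alg K H)" "a \<in> carrier A"
        "s' \<in> carrier (sym_alg K H)" "a' \<in> carrier A"
      have "g s' \<otimes>\<^bsub>A\<^esub> a = a \<otimes>\<^bsub>A\<^esub> g s'" using central gB * by blast
      then have "g s' \<otimes>\<^bsub>A\<^esub> (a \<otimes>\<^bsub>A\<^esub> a') = a \<otimes>\<^bsub>A\<^esub> (g s' \<otimes>\<^bsub>A\<^esub> a')"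
        using gA * by (simp add: Com.A.m_assoc[symmetric])
      then show "g (s \<otimes>\<^bsub>sym_alg K H\<^esub> s') \<otimes>\<^bsub>A\<^esub> (a \<otimes>\<^bsub>A\<^esub> a') = (g s \<otimes>\<^bsub>A\<^esub> a) \<otimes>\<^bsub>A\<^esub> (g s' \<otimes>\<^bsub>A\<^esub> a')"
        using gA * by (simp add: alg_hom_mult[OF g(1)] B_simps Com.A.m_assoc)
    qed
  next
    fix h a assume "h \<in> carrier H" "a \<in> carrier A"
    then show "tensor_lift K A (\<lambda>s a. g s \<otimes>\<^bsub>A\<^esub> a) (pure_tensor K (sym_alg K H) A (t_gen K H h) a) = \<nu> h \<otimes>\<^bsub>A\<^esub> a"
      using lp lin_hom_closed[OF HT.t_lin] g(2) by simp
  next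
    fix a assume "a \<in> carrier A"
    then show "tensor_lift K A (\<lambda>s a. g s \<otimes>\<^bsub>A\<^esub> a) (pure_tensor K (sym_alg K H) A \<one>\<^bsub>sym_alg K H\<^esub> a) = a"
      using lp by (simp add: alg_hom_one[OF g(1)] B_simps)
  qed
qed

end

section \<open>The morphism \<open>mu_A\<close> and its specializations\<close>

interpretation tu: tensor_map_pair K H H "sym_alg K H" A "t_gen K H" u1
  by (intro tensor_map_pairI kH kA HT.S_algebra HT.t_lin u1_lin)

lemma mu_A_eq: "mu_A K H \<Delta> A B u = tensor_alg_lift K (tensor K (sym_alg K H) A)
    (\<lambda>h. tensor_map K (sym_alg K H) A (t_gen K H) u1 (\<Delta> h))"
  by (simp add: mu_A_def u1_def[abs_def])

lemma mu_A_gen_lin: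
  "(\<lambda>h. tensor_map K (sym_alg K H) A (t_gen K H) u1 (\<Delta> h)) \<in> lin_hom K H (tensor K (sym_alg K H) A)"
  by (rule lin_hom_comp[OF Delta_lin tu.map_lin])

lemma mu_A_hom: "mu_A K H \<Delta> A B u \<in> alg_hom K (tensor_alg K H) (tensor K (sym_alg K H) A)"
  unfolding mu_A_eq by (rule HT.T_lift_alg[OF SA.tensor_algebra mu_A_gen_lin])

text \<open>Both sides are algebra morphisms on the tensor algebra, so generators suffice. On a
  generator, \<open>\<Psi>\<close> multiplies the two legs of \<open>\<Delta> h\<close> after
  \<open>\<nu>\<close> and \<open>u1\<close> are applied, which is the convolution.\<close>

lemma specialize_mu_A:
  assumes lam: "\<nu> \<in> lin_hom K H B" and \<mu>: "\<mu> \<in> alg_hom K (tensor_alg K H) A"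
    and gen: "\<And>h. h \<in> carrier H \<Longrightarrow> \<mu> (X_gen K H h) = twist \<nu> h"
    and \<Psi>: "\<Psi> \<in> alg_hom K (tensor K (sym_alg K H) A) A"
      "\<And>h a. h \<in> carrier H \<Longrightarrow> a \<in> carrier A \<Longrightarrow>
        \<Psi> (pure_tensor K (sym_alg K H) A (t_gen K H h) a) = \<nu> h \<otimes>\<^bsub>A\<^esub> a"
    and P: "P \<in> carrier (tensor_alg K H)"
  shows "\<Psi> (mu_A K H \<Delta> A B u P) = \<mu> P"
proof (rule HT.T_alg_eqI[OF alg_hom_comp[OF mu_A_hom \<Psi>(1)] \<mu> _ P])
  fix h assume h: "h \<in> carrier H"
  have "\<Psi> (tensor_map K (sym_alg K H) A (t_gen K H) u1 (\<Delta> h)) = twist \<nu> h"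
    unfolding twist_def
    by (rule HH.tensor_lin_eqI[OF lin_hom_comp[OF tu.map_lin alg_hom_lin[OF \<Psi>(1)]]
        HH.tensor_lift_lin[OF Com.module_axioms lam_bilin[OF lam]] _ Delta_closed[OF h]])
      (simp add: tu.map_pure \<Psi>(2) lin_hom_closed[OF u1_lin]
        HH.tensor_lift_pure[OF Com.module_axioms lam_bilin[OF lam]])
  then show "\<Psi> (mu_A K H \<Delta> A B u (X_gen K H h)) = \<mu> (X_gen K H h)"
    unfolding mu_A_eq using gen[OF h] by (simp add: HT.T_lift_X[OF SA.tensor_algebra mu_A_gen_lin h])
qed

section \<open>Comodule algebra morphisms out of the tensor algebra\<close>

interpretation XH: tensor_map_pair K H H "tensor_alg K H" H "X_gen K H" "\<lambda>h. h"
  by (intro tensor_map_pairI kH HT.T_algebra HT.X_lin lin_hom_id)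

lemma T_coaction_gen_lin:
  "(\<lambda>h. tensor_map K (tensor_alg K H) H (X_gen K H) (\<lambda>h'. h') (\<Delta> h)) \<in> lin_hom K H (tensor K (tensor_alg K H) H)"
  by (rule lin_hom_comp[OF Delta_lin XH.map_lin])

lemma T_coaction_hom: "T_coaction K H \<Delta> \<in> alg_hom K (tensor_alg K H) (tensor K (tensor_alg K H) H)"
  unfolding T_coaction_def by (rule HT.T_lift_alg[OF TH.tensor_algebra T_coaction_gen_lin])

lemma T_coaction_X: "h \<in> carrier H \<Longrightarrow>
    T_coaction K H \<Delta> (X_gen K H h) = tensor_map K (tensor_alg K H) H (X_gen K H) (\<lambda>h'. h') (\<Delta> h)"
  unfolding T_coaction_def by (rule HT.T_lift_X[OF TH.tensor_algebra T_coaction_gen_lin])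

lemma map_T_coaction_X:
  assumes "\<mu> \<in> alg_hom K (tensor_alg K H) A" "h \<in> carrier H"
  shows "tensor_map K A H \<mu> (\<lambda>h. h) (T_coaction K H \<Delta> (X_gen K H h))
    = tensor_map K A H (\<lambda>h. \<mu> (X_gen K H h)) (\<lambda>h. h) (\<Delta> h)"
proof -
  interpret m: tensor_map_pair K "tensor_alg K H" H A H \<mu> "\<lambda>h. h"
    by (intro tensor_map_pairI kH kA HT.T_algebra alg_hom_lin[OF assms(1)] lin_hom_id)
  show ?thesis using XH.map_map[OF m.tensor_map_pair_axioms Delta_closed[OF assms(2)]]
    by (simp add: T_coaction_X assms(2))
qed

lemma comodule_hom_restrict:
  assumes "\<mu> \<in> alg_hom K (tensor_alg K H) A"
    "comodule_map K H (tensor_alg K H) (T_coaction K H \<Delta>) A \<delta> \<mu>"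
  shows "comodule_linear (\<lambda>h. \<mu> (X_gen K H h))"
  unfolding comodule_linear_def
proof (intro conjI ballI)
  show "(\<lambda>h. \<mu> (X_gen K H h)) \<in> lin_hom K H A"
    by (rule lin_hom_comp[OF HT.X_lin alg_hom_lin[OF assms(1)]])
  fix h assume h: "h \<in> carrier H"
  show "\<delta> (\<mu> (X_gen K H h)) = tensor_map K A H (\<lambda>h. \<mu> (X_gen K H h)) (\<lambda>h. h) (\<Delta> h)"
    using assms(2) lin_hom_closed[OF HT.X_lin h] map_T_coaction_X[OF assms(1) h]
    by (simp add: comodule_map_def)
qed

text \<open>Colinearity propagates from the generators: \<open>\<delta>\<close> after the lift, and
  the lift tensored with the identity after \<open>T_coaction\<close>, are algebra morphisms
  agreeing on every \<open>X_gen\<close>.\<close>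

lemma comodule_hom_extend:
  assumes f: "comodule_linear f"
  shows "tensor_alg_lift K A f \<in> alg_hom K (tensor_alg K H) A"
    and "comodule_map K H (tensor_alg K H) (T_coaction K H \<Delta>) A \<delta> (tensor_alg_lift K A f)"
proof -
  let ?\<mu> = "tensor_alg_lift K A f"
  have lin: "f \<in> lin_hom K H A" using f by (simp add: comodule_linear_def)
  show alg: "?\<mu> \<in> alg_hom K (tensor_alg K H) A" by (rule HT.T_lift_alg[OF kA lin])
  interpret m: tensor_map_pair K "tensor_alg K H" H A H ?\<mu> "\<lambda>h. h"
    by (intro tensor_map_pairI kH kA HT.T_algebra alg_hom_lin[OF alg] lin_hom_id)
  have id: "(\<lambda>h. h) \<in> alg_hom K H H" by (intro alg_homI lin_hom_id refl)
  have "\<delta> (?\<mu> x) = tensor_map K A H ?\<mu> (\<lambda>h. h) (T_coaction K H \<Delta> x)" if x: "x \<in> carrier (tensor_alg K H)" for x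
  proof (rule HT.T_alg_eqI[OF alg_hom_comp[OF alg Com.coaction_hom]
        alg_hom_comp[OF T_coaction_hom m.map_alg[OF alg id]] _ x])
    fix h assume h: "h \<in> carrier H"
    have "tensor_map K A H f (\<lambda>h. h) (\<Delta> h) = tensor_map K A H (\<lambda>h. ?\<mu> (X_gen K H h)) (\<lambda>h. h) (\<Delta> h)"
      by (rule tensor_map_cong[OF _ Delta_closed[OF h]])
        (simp_all add: tensor_map_pairI kH kA lin lin_hom_id HT.T_lift_X[OF kA lin])
    then show "\<delta> (?\<mu> (X_gen K H h)) = tensor_map K A H ?\<mu> (\<lambda>h. h) (T_coaction K H \<Delta> (X_gen K H h))"
      using f h by (simp add: map_T_coaction_X[OF alg h] HT.T_lift_X[OF kA lin h] comodule_linear_def)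
  qed
  then show "comodule_map K H (tensor_alg K H) (T_coaction K H \<Delta>) A \<delta> ?\<mu>"
    using alg_hom_lin[OF alg] by (simp add: comodule_map_def)
qed

section \<open>The universal property of the cofree comodule\<close>

lemma counit_bilin: "bilin K B H B (\<lambda>b h. \<epsilon> h \<odot>\<^bsub>B\<^esub> b)"
  using Hopf.counit_hom
  by (intro bilinI) (simp_all add: ring_hom_closed ring_hom_add Hopf.counit_smult
    BH.V.smult_l_distr BH.V.smult_r_distr BH.V.smult_assoc1[symmetric] Hopf.K.m_comm)

lemma counit_bilin_H: "bilin K H H H (\<lambda>x y. \<epsilon> x \<odot>\<^bsub>H\<^esub> y)"
  using Hopf.counit_hom
  by (intro bilinI) (simp_all add: ring_hom_closed ring_hom_add Hopf.counit_smult
    Hopf.smult_l_distr Hopf.smult_r_distr Hopf.smult_assoc1[symmetric] Hopf.K.m_comm)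

text \<open>The map \<open>id \<otimes> \<epsilon>\<close>, the counit of the cofree comodule on
  \<open>B\<close>.\<close>

definition cou where "cou = tensor_lift K B (\<lambda>b h. \<epsilon> h \<odot>\<^bsub>B\<^esub> b)"

lemma cou_lin: "cou \<in> lin_hom K (tensor K B H) B"
  unfolding cou_def by (rule BH.tensor_lift_lin[OF BH.V.module_axioms counit_bilin])

interpretation cH: tensor_map_pair K "tensor K B H" H B H cou "\<lambda>h. h"
  by (intro tensor_map_pairI kH kB BH.tensor_algebra cou_lin lin_hom_id)

interpretation iD: tensor_map_pair K B H B "tensor K H H" "\<lambda>b. b" \<Delta>
  by (intro tensor_map_pairI kH kB HH.tensor_algebra Delta_lin lin_hom_id)

lemma cofree_lin: "cofree \<in> lin_hom K (tensor K B H) (tensor K (tensor K B H) H)"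
  unfolding cofree_coaction_def[abs_def] by (rule lin_hom_comp[OF iD.map_lin BHH.assoc_lin])

text \<open>On a pure tensor, \<open>cou\<close> consumes \<open>b\<close> together with the first
  leg of \<open>\<Delta> h\<close>, so the claim is the left counit law for
  \<open>h\<close>.\<close>

lemma cofree_counit:
  assumes x: "x \<in> carrier (tensor K B H)"
  shows "tensor_map K B H cou (\<lambda>h. h) (cofree x) = x"
proof (rule BH.tensor_lin_eqI[OF lin_hom_comp[OF cofree_lin cH.map_lin] lin_hom_id _ x])
  fix b h assume b: "b \<in> carrier B" and h: "h \<in> carrier H"
  have p: "pure_tensor K B H b \<in> lin_hom K H (tensor K B H)"
    using BH.pure_bilin b by (simp add: bilin_def)
  have p2: "pure_tensor K B (tensor K H H) b \<in> lin_hom K (tensor K H H) (tensor K B (tensor K H H))"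
    using BHH.U_VW.pure_bilin b by (simp add: bilin_def)
  have "tensor_map K B H cou (\<lambda>h. h) (tensor_assoc K B H H (pure_tensor K B (tensor K H H) b (\<Delta> h)))
      = pure_tensor K B H b (tensor_lift K H (\<lambda>x y. \<epsilon> x \<odot>\<^bsub>H\<^esub> y) (\<Delta> h))"
  proof (rule HH.tensor_lin_eqI[OF lin_hom_comp[OF p2 lin_hom_comp[OF BHH.assoc_lin cH.map_lin]]
        lin_hom_comp[OF HH.tensor_lift_lin[OF Hopf.module_axioms counit_bilin_H] p] _ Delta_closed[OF h]])
    fix x y assume xy: "x \<in> carrier H" "y \<in> carrier H"
    have e: "\<epsilon> x \<in> carrier K" using Hopf.counit_hom xy by (simp add: ring_hom_closed)
    have "cou (pure_tensor K B H b x) = \<epsilon> x \<odot>\<^bsub>B\<^esub> b"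
      unfolding cou_def using BH.tensor_lift_pure[OF BH.V.module_axioms counit_bilin b xy(1)] .
    then show "tensor_map K B H cou (\<lambda>h. h) (tensor_assoc K B H H (pure_tensor K B (tensor K H H) b (pure_tensor K H H x y)))
      = pure_tensor K B H b (tensor_lift K H (\<lambda>x y. \<epsilon> x \<odot>\<^bsub>H\<^esub> y) (pure_tensor K H H x y))"
      using b xy e by (simp add: BHH.assoc_pure cH.map_pure BH.pure_closed
        HH.tensor_lift_pure[OF Hopf.module_axioms counit_bilin_H] bilinD[OF BH.pure_bilin])
  qed
  then show "tensor_map K B H cou (\<lambda>h. h) (cofree (pure_tensor K B H b h)) = pure_tensor K B H b h"
    using b h by (simp add: cofree_coaction_def iD.map_pure Hopf.counit_left)
qed

text \<open>Let \<open>g\<close> be the inverse of \<open>u\<close> after \<open>f\<close>, and let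
  \<open>\<nu>\<close> be \<open>cou\<close> after \<open>g\<close>. Since \<open>g\<close> is
  colinear, applying \<open>cou \<otimes> id\<close> to its colinearity returns \<open>g\<close> on
  one side and \<open>(\<nu> \<otimes> id) \<circ> \<Delta>\<close> on the other; \<open>u\<close>
  turns this into the twist.\<close>

lemma comodule_linear_twist:
  assumes f: "comodule_linear f"
  obtains \<nu> where "\<nu> \<in> lin_hom K H B" "\<And>h. h \<in> carrier H \<Longrightarrow> f h = twist \<nu> h"
proof -
  have f_lin: "f \<in> lin_hom K H A"
    and f_co: "\<And>h. h \<in> carrier H \<Longrightarrow> \<delta> (f h) = tensor_map K A H f (\<lambda>h. h) (\<Delta> h)"
    using f by (simp_all add: comodule_linear_def)
  interpret BHalg: k_algebra K "tensor K B H" by (rule BH.tensor_algebra)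
  define v where "v = inv_into (carrier (tensor K B H)) u"
  have vc: "v a \<in> carrier (tensor K B H)" and uv: "u (v a) = a" if "a \<in> carrier A" for a
    using that u_bij unfolding v_def bij_betw_def by (auto intro: inv_into_into f_inv_into_f)
  have vu: "v (u x) = x" if "x \<in> carrier (tensor K B H)" for x
    using that u_bij unfolding v_def bij_betw_def by (auto intro: inv_into_f_f)
  have v_lin: "v \<in> lin_hom K A (tensor K B H)"
  proof (rule lin_homI)
    show "v (a \<oplus>\<^bsub>A\<^esub> b) = v a \<oplus>\<^bsub>tensor K B H\<^esub> v b" if "a \<in> carrier A" "b \<in> carrier A" for a b
      using that vu[of "v a \<oplus>\<^bsub>tensor K B H\<^esub> v b"] by (simp add: lin_hom_add[OF u_lin] vc uv)
    show "v (c \<odot>\<^bsub>A\<^esub> a) = c \<odot>\<^bsub>tensor K B H\<^esub> v a" if "c \<in> carrier K" "a \<in> carrier A" for c a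
      using that vu[of "c \<odot>\<^bsub>tensor K B H\<^esub> v a"] by (simp add: lin_hom_smult[OF u_lin] vc uv)
  qed (rule vc)
  define g where "g h = v (f h)" for h
  have g_lin: "g \<in> lin_hom K H (tensor K B H)"
    unfolding g_def[abs_def] by (rule lin_hom_comp[OF f_lin v_lin])
  have lam: "(\<lambda>h. cou (g h)) \<in> lin_hom K H B" by (rule lin_hom_comp[OF g_lin cou_lin])
  interpret uH: tensor_map_pair K "tensor K B H" H A H u "\<lambda>x. x"
    by (intro tensor_map_pairI kH kA BH.tensor_algebra lin_hom_id u_lin)
  interpret vH: tensor_map_pair K A H "tensor K B H" H v "\<lambda>x. x"
    by (intro tensor_map_pairI kH kA BH.tensor_algebra lin_hom_id v_lin)
  interpret fH: tensor_map_pair K H H A H f "\<lambda>x. x"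
    by (intro tensor_map_pairI kH kA lin_hom_id f_lin)
  interpret gH: tensor_map_pair K H H "tensor K B H" H g "\<lambda>x. x"
    by (intro tensor_map_pairI kH BH.tensor_algebra lin_hom_id g_lin)
  show thesis
  proof
    show "(\<lambda>h. cou (g h)) \<in> lin_hom K H B" by (rule lam)
    fix h assume h: "h \<in> carrier H"
    note D = Delta_closed[OF h]
    have gh: "g h \<in> carrier (tensor K B H)" by (rule lin_hom_closed[OF g_lin h])
    note cg = lin_hom_closed[OF cofree_lin gh]
    have ug: "u (g h) = f h" using uv lin_hom_closed[OF f_lin h] by (simp add: g_def)
    \<comment> \<open>Colinearity of the inverse \<open>v\<close> comes from that of
      \<open>u\<close>: the identity is written as \<open>v\<close> after \<open>u\<close>, and the
      inner \<open>u\<close> is moved across the coaction.\<close>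
    have "cofree (g h) = tensor_map K (tensor K B H) H (\<lambda>x. v (u x)) (\<lambda>h. h) (cofree (g h))"
      using vu by (intro tensor_map_id[OF BH.tensor_algebra kH cg, symmetric]) auto
    also have "\<dots> = tensor_map K (tensor K B H) H v (\<lambda>h. h) (tensor_map K A H u (\<lambda>h. h) (cofree (g h)))"
      using uH.map_map[OF vH.tensor_map_pair_axioms cg] by simp
    also have "tensor_map K A H u (\<lambda>h. h) (cofree (g h)) = \<delta> (f h)"
      using u_comodule[OF gh] ug by simp
    also have "tensor_map K (tensor K B H) H v (\<lambda>h. h) \<dots> = tensor_map K (tensor K B H) H g (\<lambda>h. h) (\<Delta> h)"
      unfolding f_co[OF h] using fH.map_map[OF vH.tensor_map_pair_axioms D] by (simp add: g_def[abs_def])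
    finally have "tensor_map K B H cou (\<lambda>h. h) (cofree (g h))
        = tensor_map K B H (\<lambda>h. cou (g h)) (\<lambda>h. h) (\<Delta> h)"
      using gH.map_map[OF cH.tensor_map_pair_axioms D] by simp
    then have "g h = tensor_map K B H (\<lambda>h. cou (g h)) (\<lambda>h. h) (\<Delta> h)"
      by (simp add: cofree_counit[OF gh])
    then show "f h = twist (\<lambda>h. cou (g h)) h" using twist_eq[OF lam h] ug by simp
  qed
qed

section \<open>The two inclusions\<close>

lemma kernel_subset_identities:
  "a_kernel (tensor_alg K H) (tensor K (sym_alg K H) A) (mu_A K H \<Delta> A B u) \<subseteq> H_identities K H \<Delta> A \<delta>"
proof
  fix P assume "P \<in> a_kernel (tensor_alg K H) (tensor K (sym_alg K H) A) (mu_A K H \<Delta> A B u)"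
  then have P: "P \<in> carrier (tensor_alg K H)"
    and zero: "mu_A K H \<Delta> A B u P = \<zero>\<^bsub>tensor K (sym_alg K H) A\<^esub>" by (simp_all add: a_kernel_def')
  have "\<mu> P = \<zero>\<^bsub>A\<^esub>" if \<mu>: "\<mu> \<in> alg_hom K (tensor_alg K H) A"
    "comodule_map K H (tensor_alg K H) (T_coaction K H \<Delta>) A \<delta> \<mu>" for \<mu>
  proof -
    obtain \<nu> where lam: "\<nu> \<in> lin_hom K H B" "\<And>h. h \<in> carrier H \<Longrightarrow> \<mu> (X_gen K H h) = twist \<nu> h"
      using comodule_linear_twist[OF comodule_hom_restrict[OF \<mu>]] by blast
    obtain \<Psi> where \<Psi>: "\<Psi> \<in> alg_hom K (tensor K (sym_alg K H) A) A"
      "\<And>h a. h \<in> carrier H \<Longrightarrow> a \<in> carrier A \<Longrightarrow>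
        \<Psi> (pure_tensor K (sym_alg K H) A (t_gen K H h) a) = \<nu> h \<otimes>\<^bsub>A\<^esub> a"
      "\<And>a. a \<in> carrier A \<Longrightarrow> \<Psi> (pure_tensor K (sym_alg K H) A \<one>\<^bsub>sym_alg K H\<^esub> a) = a"
      by (rule specialization[OF lam(1)]) (rule that, assumption, simp, simp)
    \<comment> \<open>The morphism factors through \<open>mu_A\<close>, so it vanishes wherever
      \<open>mu_A\<close> does.\<close>
    have "\<mu> P = \<Psi> (mu_A K H \<Delta> A B u P)"
      by (rule specialize_mu_A[OF lam(1) \<mu>(1) lam(2) \<Psi>(1,2) P, symmetric])
    then show ?thesis unfolding zero
      using lin_hom_zero[OF k_algebra_module[OF SA.tensor_algebra] Com.module_axioms alg_hom_lin[OF \<Psi>(1)]] by simp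
  qed
  then show "P \<in> H_identities K H \<Delta> A \<delta>" using P by (simp add: H_identities_def)
qed

lemma identities_subset_kernel:
  assumes inf: "infinite (carrier K)"
  shows "H_identities K H \<Delta> A \<delta> \<subseteq> a_kernel (tensor_alg K H) (tensor K (sym_alg K H) A) (mu_A K H \<Delta> A B u)"
proof
  fix P assume "P \<in> H_identities K H \<Delta> A \<delta>"
  then have P: "P \<in> carrier (tensor_alg K H)"
    and ident: "\<And>\<mu>. \<mu> \<in> alg_hom K (tensor_alg K H) A \<Longrightarrow>
      comodule_map K H (tensor_alg K H) (T_coaction K H \<Delta>) A \<delta> \<mu> \<Longrightarrow> \<mu> P = \<zero>\<^bsub>A\<^esub>"
    by (simp_all add: H_identities_def)
  let ?C = "tensor K (sym_alg K H) A"
  let ?p = "pure_tensor K (sym_alg K H) A"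
  let ?t = "t_gen K H"
  let ?e = "\<one>\<^bsub>sym_alg K H\<^esub>"
  let ?z = "mu_A K H \<Delta> A B u P"
  interpret C: k_algebra K ?C by (rule SA.tensor_algebra)
  note tc = lin_hom_closed[OF HT.t_lin]
  define \<tau> where "\<tau> h z = ?p (?t h) \<one>\<^bsub>A\<^esub> \<otimes>\<^bsub>?C\<^esub> z" for h z
  \<comment> \<open>All properties wanted of \<open>ev \<chi>\<close> are collected for one
    morphism. The vanishing at \<open>?z\<close> is among them so that the later choice over all
    functionals yields it for the chosen morphism itself.\<close>
  have "\<exists>\<Psi>. \<Psi> \<in> alg_hom K ?C A \<and>
      (\<forall>h\<in>carrier H. \<Psi> (?p (?t h) \<one>\<^bsub>A\<^esub>) = \<chi> h \<odot>\<^bsub>A\<^esub> \<one>\<^bsub>A\<^esub>) \<and>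
      (\<forall>a\<in>carrier A. \<Psi> (?p ?e a) = a) \<and> \<Psi> ?z = \<zero>\<^bsub>A\<^esub>" if \<chi>: "functional K H \<chi>" for \<chi>
  proof -
    \<comment> \<open>Scalar multiples of the unit are coinvariant, so every functional gives a
      linear map into \<open>B\<close>.\<close>
    define \<nu> where "\<nu> h = \<chi> h \<odot>\<^bsub>B\<^esub> \<one>\<^bsub>B\<^esub>" for h
    have lam: "\<nu> \<in> lin_hom K H B"
      using \<chi> by (intro lin_homI) (simp_all add: \<nu>_def functional_def BH.V.smult_l_distr BH.V.smult_assoc1)
    have \<chi>c: "\<chi> h \<in> carrier K" if "h \<in> carrier H" for h using \<chi> that by (simp add: functional_def)
    obtain \<Psi> where \<Psi>: "\<Psi> \<in> alg_hom K ?C A"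
      "\<And>h a. h \<in> carrier H \<Longrightarrow> a \<in> carrier A \<Longrightarrow> \<Psi> (?p (?t h) a) = \<nu> h \<otimes>\<^bsub>A\<^esub> a"
      "\<And>a. a \<in> carrier A \<Longrightarrow> \<Psi> (?p ?e a) = a"
      by (rule specialization[OF lam]) (rule that, assumption, simp, simp)
    note tw = twist_comodule[OF lam]
    note ext = comodule_hom_extend[OF tw]
    have twl: "twist \<nu> \<in> lin_hom K H A" using tw by (simp add: comodule_linear_def)
    have "\<Psi> ?z = tensor_alg_lift K A (twist \<nu>) P"
      by (rule specialize_mu_A[OF lam ext(1) HT.T_lift_X[OF kA twl] \<Psi>(1,2) P])
    \<comment> \<open>The lift of a twist is a comodule algebra morphism, and \<open>P\<close> is an
      identity.\<close>
    also have "\<dots> = \<zero>\<^bsub>A\<^esub>" by (rule ident[OF ext])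
    finally have "\<Psi> ?z = \<zero>\<^bsub>A\<^esub>" .
    moreover have "\<Psi> (?p (?t h) \<one>\<^bsub>A\<^esub>) = \<chi> h \<odot>\<^bsub>A\<^esub> \<one>\<^bsub>A\<^esub>" if "h \<in> carrier H" for h
      using that \<chi>c by (simp add: \<Psi>(2) \<nu>_def B_simps)
    ultimately show ?thesis using \<Psi>(1,3) by blast
  qed
  then obtain ev where ev: "\<And>\<chi>. functional K H \<chi> \<Longrightarrow> ev \<chi> \<in> alg_hom K ?C A"
    "\<And>\<chi> h. functional K H \<chi> \<Longrightarrow> h \<in> carrier H \<Longrightarrow> ev \<chi> (?p (?t h) \<one>\<^bsub>A\<^esub>) = \<chi> h \<odot>\<^bsub>A\<^esub> \<one>\<^bsub>A\<^esub>"
    "\<And>\<chi> a. functional K H \<chi> \<Longrightarrow> a \<in> carrier A \<Longrightarrow> ev \<chi> (?p ?e a) = a"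
    "\<And>\<chi>. functional K H \<chi> \<Longrightarrow> ev \<chi> ?z = \<zero>\<^bsub>A\<^esub>" by metis
  interpret PA: polynomial_action K H A ?C \<tau> "\<lambda>a. ?p ?e a" ev
  proof (intro polynomial_action.intro polynomial_action_axioms.intro vector_space_K.intro
      Hopf.K.field_axioms Hopf.module_axioms Com.module_axioms C.module_axioms)
    show "bilin K H ?C ?C \<tau>"
      unfolding \<tau>_def[abs_def]
      by (rule bilinI) (simp_all add: SA.pure_closed tc lin_hom_add[OF HT.t_lin] lin_hom_smult[OF HT.t_lin]
        bilinD[OF SA.pure_bilin] C.A.l_distr C.A.r_distr C.smult_mult_left C.smult_mult_right)
    show "\<tau> v (\<tau> w z) = \<tau> w (\<tau> v z)" if "v \<in> carrier H" "w \<in> carrier H" "z \<in> carrier ?C" for v w z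
      using that unfolding \<tau>_def
      by (simp add: SA.pure_closed tc C.A.m_assoc[symmetric] SA.pure_mult HT.t_comm[OF that(1,2)])
    show "(\<lambda>a. ?p ?e a) \<in> lin_hom K A ?C" using SA.pure_bilin by (simp add: bilin_def)
    fix \<chi> assume \<chi>: "functional K H \<chi>"
    show "ev \<chi> \<in> lin_hom K ?C A" by (rule alg_hom_lin[OF ev(1)[OF \<chi>]])
    show "ev \<chi> (?p ?e a) = a" if "a \<in> carrier A" for a using ev(3)[OF \<chi> that] .
    show "ev \<chi> (\<tau> v z) = \<chi> v \<odot>\<^bsub>A\<^esub> ev \<chi> z" if "v \<in> carrier H" "z \<in> carrier ?C" for v z
    proof -
      have "\<chi> v \<in> carrier K" using \<chi> that by (simp add: functional_def)
      then show ?thesis using that lin_hom_closed[OF alg_hom_lin[OF ev(1)[OF \<chi>]] that(2)]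
        by (simp add: \<tau>_def alg_hom_mult[OF ev(1)[OF \<chi>]] SA.pure_closed tc ev(2)[OF \<chi>] Com.smult_mult_left)
    qed
  qed
  \<comment> \<open>Building \<open>s\<close> from generators reaches \<open>s \<otimes> a\<close>
    from \<open>1 \<otimes> a\<close> by repeated use of \<open>\<tau>\<close>, so all of
    \<open>?C\<close> is generated and the separation result covers \<open>?z\<close>.\<close>
  have pure_gen: "?p s a \<in> PA.generated (carrier H)" if "s \<in> carrier (sym_alg K H)" "a \<in> carrier A" for s a
    using that(1)
  proof (induction rule: HT.S_induct)
    case one
    then show ?case using PA.generated.iota[OF that(2)] by simp
  next
    case (mult v s)
    have "?p (?t v \<otimes>\<^bsub>sym_alg K H\<^esub> s) a = \<tau> v (?p s a)"
      using mult that(2) by (simp add: \<tau>_def SA.pure_mult tc)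
    then show ?case using PA.generated.tau[OF mult(1,3)] by simp
  next
    case (add x y)
    then show ?case using that(2) PA.generated.add by (simp add: bilinD[OF SA.pure_bilin])
  next
    case (smult c x)
    then show ?case using that(2) PA.generated.smult by (simp add: bilinD[OF SA.pure_bilin])
  qed
  have gen: "x \<in> PA.generated (carrier H)" if "x \<in> carrier ?C" for x
    using that by (induction rule: SA.tensor_induct)
      (auto intro: pure_gen PA.generated.add PA.generated.smult)
  have "?z = \<zero>\<^bsub>?C\<^esub>"
    by (rule PA.separated[OF inf gen[OF lin_hom_closed[OF alg_hom_lin[OF mu_A_hom] P]] ev(4)])
  then show "P \<in> a_kernel (tensor_alg K H) ?C (mu_A K H \<Delta> A B u)"
    using P by (simp add: a_kernel_def')
qed

end

theorem theorem4p3: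
  fixes K :: "'k ring"
    and H :: "('k, 'h) module"
    and \<Delta> :: "'h \<Rightarrow> ('h \<times> 'h \<Rightarrow> 'k) set"
    and \<epsilon> :: "'h \<Rightarrow> 'k"
    and S :: "'h \<Rightarrow> 'h"
    and A B :: "('k, 'a) module"
    and \<delta> :: "'a \<Rightarrow> ('a \<times> 'h \<Rightarrow> 'k) set"
    and u :: "('a \<times> 'h \<Rightarrow> 'k) set \<Rightarrow> 'a"
  assumes "field K"
    and "hopf_algebra K H \<Delta> \<epsilon> S"
    and "comodule_algebra K H \<Delta> \<epsilon> A \<delta>"
    and "B = coinvariants K H A \<delta>"
    and "\<forall>b\<in>carrier B. \<forall>a\<in>carrier A. b \<otimes>\<^bsub>A\<^esub> a = a \<otimes>\<^bsub>A\<^esub> b"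
    and "B_linear_comodule_iso K H \<Delta> A \<delta> B u"
  shows "a_kernel (tensor_alg K H) (tensor K (sym_alg K H) A) (mu_A K H \<Delta> A B u)
           \<subseteq> H_identities K H \<Delta> A \<delta> \<and>
         (infinite (carrier K) \<longrightarrow>
           H_identities K H \<Delta> A \<delta> =
           a_kernel (tensor_alg K H) (tensor K (sym_alg K H) A) (mu_A K H \<Delta> A B u))"
proof -
  interpret central_comodule K H \<Delta> \<epsilon> S A B \<delta> u
    by (rule central_comodule.intro) (fact assms)+
  show ?thesis using kernel_subset_identities identities_subset_kernel by blast
qed

end
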